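(* The system $\textsf{RCA}_0^\omega+(\exists\Theta)\textsf{SFF}(\Theta)$ proves the equivalence $(\mu^2)\leftrightarrow\textsf{UATR}$, whereas $\textsf{RCA}_0^\omega+\textsf{WKL}$ does not prove this equivalence.
   Context: Types: $0$ is the type of natural numbers, $1=0\to0$, $2=1\to0$, and $\tau^*$ is the type of finite sequences of objects of type $\tau$; for $w$ of type $\tau^*$, $g\in w$ means $g$ equals one of the entries of $w$. $\textsf{RCA}_0^\omega$ is Kohlenbach's base theory of higher-order Reverse Mathematics: $\textsf{E-PRA}^\omega+\textsf{QF-AC}^{1,0}$, where $\textsf{E-PRA}^\omega$ is extensional primitive recursive arithmetic in all finite types (classical logic, extensionality, combinators, the type-$0$ primitive recursor, quantifier-free induction), and $\textsf{QF-AC}^{1,0}$ is $(\forall x^1)(\exists y^0)\varphi(x,y)\to(\exists F^{1\to0})(\forall x^1)\varphi(x,F(x))$ for quantifier-free $\varphi$; types $\tau^*$ for finite sequences are added definitionally. $\textsf{WKL}$ is weak König's lemma: every infinite binary tree has an infinite path. $(\mu^2)$: $(\exists\mu^2)(\forall f^1)\big((\exists n^0)(f(n)=0)\to f(\mu(f))=0\big)$. $\textsf{SFF}(\Theta)$, for $\Theta$ of type $2\to1^*$ (special fan functional): $(\forall G^2)(\forall f^1\leq_11)(\exists g\in\Theta(G))\big(f\in[\overline{g}G(g)]\big)$, where $f\leq_11$ means $f(n)\le1$ for all $n$, $\overline{g}N=\langle g(0),\dots,g(N-1)\rangle$, and $f\in[\sigma]$ means that $f$ extends $\sigma$. $\textsf{UATR}$: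 there is a functional $\Phi$ mapping pairs of type 1 objects to type 1 objects such that $(\forall X^1,f^1)\big[\textsf{WO}(X)\to H_f(X,\Phi(X,f))\big]$. Here $\textsf{WO}(X)$ says that $X$ is a countable well-ordering, and $H_f(X,Y)$ is $H_\theta(X,Y)$ for $\theta(n,Z)$ defined as $(\exists m^0)(f(n,m,\overline{Z}m)=0)$, where $H_\theta(X,Y)$ says that $Y$ results from iterating $\theta$ along $X$, i.e. $Y=\{(n,j):j\in\text{field}(X)\wedge\theta(n,Y^j)\}$ with $Y^j=\{(m,i)\in Y:i<_Xj\}$ (sets coded by characteristic functions). *)

theory Defs
  imports Main
begin

section \<open>Finite types and terms\<close>

datatype ty =
    N
  | Fn ty ty  (infixr "\<rightarrow>" 65)
  | Star ty

abbreviation T1 :: ty where "T1 \<equiv> N \<rightarrow> N"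
abbreviation T2 :: ty where "T2 \<equiv> T1 \<rightarrow> N"

text \<open>
  A variable is a pair of a name and a type: equal names at different types are different
  variables. Besides zero, successor, the combinators and the type-0 recursor there are, for
  finite sequences, \<open>SeqC \<tau>\<close> (the initial segment of length n of a function of type 0 to \<open>\<tau>\<close>),
  \<open>LenC \<tau>\<close> (length) and \<open>EntC \<tau>\<close> (i-th entry).
\<close>

datatype tm =
    Var string ty
  | ZeroC
  | SucC
  | KC ty ty
  | SC ty ty ty
  | RecC
  | SeqC ty
  | LenC ty
  | EntC ty
  | App tm tm  (infixl "\<cdot>" 100)

fun cod :: "ty \<Rightarrow> ty" where
  "cod (\<sigma> \<rightarrow> \<tau>) = \<tau>"
| "cod _ = N"

text \<open>The value of \<open>typ_of\<close> is meaningful on well-typed terms (\<open>wt\<close>) only.\<close>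

primrec typ_of :: "tm \<Rightarrow> ty" where
  "typ_of (Var x \<tau>) = \<tau>"
| "typ_of ZeroC = N"
| "typ_of SucC = N \<rightarrow> N"
| "typ_of (KC \<rho> \<tau>) = \<rho> \<rightarrow> \<tau> \<rightarrow> \<rho>"
| "typ_of (SC \<delta> \<rho> \<tau>) = (\<delta> \<rightarrow> \<rho> \<rightarrow> \<tau>) \<rightarrow> (\<delta> \<rightarrow> \<rho>) \<rightarrow> \<delta> \<rightarrow> \<tau>"
| "typ_of RecC = N \<rightarrow> N \<rightarrow> (N \<rightarrow> N \<rightarrow> N) \<rightarrow> N"
| "typ_of (SeqC \<tau>) = N \<rightarrow> (N \<rightarrow> \<tau>) \<rightarrow> Star \<tau>"
| "typ_of (LenC \<tau>) = Star \<tau> \<rightarrow> N"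
| "typ_of (EntC \<tau>) = Star \<tau> \<rightarrow> N \<rightarrow> \<tau>"
| "typ_of (s \<cdot> t) = cod (typ_of s)"

primrec wt :: "tm \<Rightarrow> bool" where
  "wt (Var x \<tau>) = True"
| "wt ZeroC = True"
| "wt SucC = True"
| "wt (KC \<rho> \<tau>) = True"
| "wt (SC \<delta> \<rho> \<tau>) = True"
| "wt RecC = True"
| "wt (SeqC \<tau>) = True"
| "wt (LenC \<tau>) = True"
| "wt (EntC \<tau>) = True"
| "wt (s \<cdot> t) = (wt s \<and> wt t \<and> typ_of s = (typ_of t \<rightarrow> cod (typ_of s)))"

primrec fvt :: "tm \<Rightarrow> (string \<times> ty) set" where
  "fvt (Var x \<tau>) = {(x, \<tau>)}"
| "fvt ZeroC = {}"
| "fvt SucC = {}"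
| "fvt (KC \<rho> \<tau>) = {}"
| "fvt (SC \<delta> \<rho> \<tau>) = {}"
| "fvt RecC = {}"
| "fvt (SeqC \<tau>) = {}"
| "fvt (LenC \<tau>) = {}"
| "fvt (EntC \<tau>) = {}"
| "fvt (s \<cdot> t) = fvt s \<union> fvt t"

primrec substt :: "string \<Rightarrow> ty \<Rightarrow> tm \<Rightarrow> tm \<Rightarrow> tm" where
  "substt x \<tau> u (Var y \<sigma>) = (if y = x \<and> \<sigma> = \<tau> then u else Var y \<sigma>)"
| "substt x \<tau> u ZeroC = ZeroC"
| "substt x \<tau> u SucC = SucC"
| "substt x \<tau> u (KC \<rho> \<sigma>) = KC \<rho> \<sigma>"
| "substt x \<tau> u (SC \<delta> \<rho> \<sigma>) = SC \<delta> \<rho> \<sigma>"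
| "substt x \<tau> u RecC = RecC"
| "substt x \<tau> u (SeqC \<sigma>) = SeqC \<sigma>"
| "substt x \<tau> u (LenC \<sigma>) = LenC \<sigma>"
| "substt x \<tau> u (EntC \<sigma>) = EntC \<sigma>"
| "substt x \<tau> u (s \<cdot> t) = substt x \<tau> u s \<cdot> substt x \<tau> u t"

text \<open>Lambda abstraction of the variable \<open>(x, \<tau>)\<close>, defined from the combinators.\<close>

fun lam :: "string \<Rightarrow> ty \<Rightarrow> tm \<Rightarrow> tm" where
  "lam x \<tau> (s \<cdot> t) =
     SC \<tau> (typ_of t) (cod (typ_of s)) \<cdot> lam x \<tau> s \<cdot> lam x \<tau> t"
| "lam x \<tau> (Var y \<sigma>) =
     (if y = x \<and> \<sigma> = \<tau> then SC \<tau> (\<tau> \<rightarrow> \<tau>) \<tau> \<cdot> KC \<tau> (\<tau> \<rightarrow> \<tau>) \<cdot> KC \<tau> \<tau>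
      else KC \<sigma> \<tau> \<cdot> Var y \<sigma>)"
| "lam x \<tau> c = KC (typ_of c) \<tau> \<cdot> c"

primrec zero_tm :: "ty \<Rightarrow> tm" where
  "zero_tm N = ZeroC"
| "zero_tm (\<sigma> \<rightarrow> \<tau>) = KC \<tau> \<sigma> \<cdot> zero_tm \<tau>"
| "zero_tm (Star \<tau>) = SeqC \<tau> \<cdot> ZeroC \<cdot> (KC \<tau> N \<cdot> zero_tm \<tau>)"


section \<open>Formulas\<close>

text \<open>Classical many-sorted logic; the only atomic formulas are equations of type 0.\<close>

datatype fm =
    Eq0 tm tm  (infix "\<^bold>=" 50)
  | Fls  ("\<^bold>\<bottom>")
  | FImp fm fm  (infixr "\<^bold>\<longrightarrow>" 25)
  | FAll string ty fm  ("(3\<^bold>\<forall>_\<^bold>:_./ _)" [1000, 1000, 10] 10)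

abbreviation FNot :: "fm \<Rightarrow> fm"  ("\<^bold>\<not> _" [40] 40)
  where "\<^bold>\<not> \<phi> \<equiv> \<phi> \<^bold>\<longrightarrow> \<^bold>\<bottom>"

abbreviation FAnd :: "fm \<Rightarrow> fm \<Rightarrow> fm"  (infixr "\<^bold>\<and>" 35)
  where "\<phi> \<^bold>\<and> \<psi> \<equiv> \<^bold>\<not> (\<phi> \<^bold>\<longrightarrow> \<^bold>\<not> \<psi>)"

abbreviation FOr :: "fm \<Rightarrow> fm \<Rightarrow> fm"  (infixr "\<^bold>\<or>" 30)
  where "\<phi> \<^bold>\<or> \<psi> \<equiv> \<^bold>\<not> \<phi> \<^bold>\<longrightarrow> \<psi>"

abbreviation FIff :: "fm \<Rightarrow> fm \<Rightarrow> fm"  (infixr "\<^bold>\<longleftrightarrow>" 25)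
  where "\<phi> \<^bold>\<longleftrightarrow> \<psi> \<equiv> (\<phi> \<^bold>\<longrightarrow> \<psi>) \<^bold>\<and> (\<psi> \<^bold>\<longrightarrow> \<phi>)"

abbreviation FEx :: "string \<Rightarrow> ty \<Rightarrow> fm \<Rightarrow> fm"  ("(3\<^bold>\<exists>_\<^bold>:_./ _)" [1000, 1000, 10] 10)
  where "\<^bold>\<exists>x\<^bold>:\<tau>. \<phi> \<equiv> \<^bold>\<not> (\<^bold>\<forall>x\<^bold>:\<tau>. \<^bold>\<not> \<phi>)"

primrec fv :: "fm \<Rightarrow> (string \<times> ty) set" where
  "fv (s \<^bold>= t) = fvt s \<union> fvt t"
| "fv \<^bold>\<bottom> = {}"
| "fv (\<phi> \<^bold>\<longrightarrow> \<psi>) = fv \<phi> \<union> fv \<psi>"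
| "fv (\<^bold>\<forall>x\<^bold>:\<tau>. \<phi>) = fv \<phi> - {(x, \<tau>)}"

primrec wff :: "fm \<Rightarrow> bool" where
  "wff (s \<^bold>= t) = (wt s \<and> wt t \<and> typ_of s = N \<and> typ_of t = N)"
| "wff \<^bold>\<bottom> = True"
| "wff (\<phi> \<^bold>\<longrightarrow> \<psi>) = (wff \<phi> \<and> wff \<psi>)"
| "wff (\<^bold>\<forall>x\<^bold>:\<tau>. \<phi>) = wff \<phi>"

primrec qf :: "fm \<Rightarrow> bool" where
  "qf (s \<^bold>= t) = True"
| "qf \<^bold>\<bottom> = True"
| "qf (\<phi> \<^bold>\<longrightarrow> \<psi>) = (qf \<phi> \<and> qf \<psi>)"
| "qf (\<^bold>\<forall>x\<^bold>:\<tau>. \<phi>) = False"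

text \<open>
  Substitution does not rename bound variables; \<open>free_for u x \<tau> \<phi>\<close> is the usual side condition
  that no variable of \<open>u\<close> is captured. It is vacuous for quantifier-free formulas.
\<close>

primrec subst :: "string \<Rightarrow> ty \<Rightarrow> tm \<Rightarrow> fm \<Rightarrow> fm" where
  "subst x \<tau> u (s \<^bold>= t) = (substt x \<tau> u s \<^bold>= substt x \<tau> u t)"
| "subst x \<tau> u \<^bold>\<bottom> = \<^bold>\<bottom>"
| "subst x \<tau> u (\<phi> \<^bold>\<longrightarrow> \<psi>) = (subst x \<tau> u \<phi> \<^bold>\<longrightarrow> subst x \<tau> u \<psi>)"
| "subst x \<tau> u (\<^bold>\<forall>y\<^bold>:\<sigma>. \<phi>) =
     (if y = x \<and> \<sigma> = \<tau> then \<^bold>\<forall>y\<^bold>:\<sigma>. \<phi> else \<^bold>\<forall>y\<^bold>:\<sigma>. subst x \<tau> u \<phi>)"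

primrec free_for :: "tm \<Rightarrow> string \<Rightarrow> ty \<Rightarrow> fm \<Rightarrow> bool" where
  "free_for u x \<tau> (s \<^bold>= t) = True"
| "free_for u x \<tau> \<^bold>\<bottom> = True"
| "free_for u x \<tau> (\<phi> \<^bold>\<longrightarrow> \<psi>) = (free_for u x \<tau> \<phi> \<and> free_for u x \<tau> \<psi>)"
| "free_for u x \<tau> (\<^bold>\<forall>y\<^bold>:\<sigma>. \<phi>) =
     ((x, \<tau>) \<notin> fv (\<^bold>\<forall>y\<^bold>:\<sigma>. \<phi>) \<or> ((y, \<sigma>) \<notin> fvt u \<and> free_for u x \<tau> \<phi>))"


section \<open>Provability\<close>

text \<open>
  A Hilbert calculus for classical many-sorted first-order logic. Since generalisation is
  unrestricted, the free variables of an axiom are read as universally quantified.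
\<close>

inductive proves :: "fm set \<Rightarrow> fm \<Rightarrow> bool"  (infix "\<^bold>\<turnstile>" 20) for T :: "fm set" where
  axiom: "\<phi> \<in> T \<Longrightarrow> T \<^bold>\<turnstile> \<phi>"
| imp_K: "wff \<phi> \<Longrightarrow> wff \<psi> \<Longrightarrow> T \<^bold>\<turnstile> \<phi> \<^bold>\<longrightarrow> \<psi> \<^bold>\<longrightarrow> \<phi>"
| imp_S: "wff \<phi> \<Longrightarrow> wff \<psi> \<Longrightarrow> wff \<chi> \<Longrightarrow>
    T \<^bold>\<turnstile> (\<phi> \<^bold>\<longrightarrow> \<psi> \<^bold>\<longrightarrow> \<chi>) \<^bold>\<longrightarrow> (\<phi> \<^bold>\<longrightarrow> \<psi>) \<^bold>\<longrightarrow> \<phi> \<^bold>\<longrightarrow> \<chi>"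
| dneg: "wff \<phi> \<Longrightarrow> T \<^bold>\<turnstile> \<^bold>\<not> \<^bold>\<not> \<phi> \<^bold>\<longrightarrow> \<phi>"
| all_inst: "wff \<phi> \<Longrightarrow> wt u \<Longrightarrow> typ_of u = \<tau> \<Longrightarrow> free_for u x \<tau> \<phi> \<Longrightarrow>
    T \<^bold>\<turnstile> (\<^bold>\<forall>x\<^bold>:\<tau>. \<phi>) \<^bold>\<longrightarrow> subst x \<tau> u \<phi>"
| all_imp: "wff \<phi> \<Longrightarrow> wff \<psi> \<Longrightarrow> (x, \<tau>) \<notin> fv \<phi> \<Longrightarrow>
    T \<^bold>\<turnstile> (\<^bold>\<forall>x\<^bold>:\<tau>. \<phi> \<^bold>\<longrightarrow> \<psi>) \<^bold>\<longrightarrow> \<phi> \<^bold>\<longrightarrow> (\<^bold>\<forall>x\<^bold>:\<tau>. \<psi>)"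
| mp: "T \<^bold>\<turnstile> \<phi> \<^bold>\<longrightarrow> \<psi> \<Longrightarrow> T \<^bold>\<turnstile> \<phi> \<Longrightarrow> T \<^bold>\<turnstile> \<psi>"
| gen: "T \<^bold>\<turnstile> \<phi> \<Longrightarrow> T \<^bold>\<turnstile> (\<^bold>\<forall>x\<^bold>:\<tau>. \<phi>)"


section \<open>Arithmetical terms\<close>

definition plusC :: tm where
  "plusC = lam ''a'' N (lam ''b'' N
     (RecC \<cdot> Var ''a'' N \<cdot> Var ''b'' N \<cdot> lam ''y'' N (lam ''x'' N (SucC \<cdot> Var ''y'' N))))"

definition predC :: tm where
  "predC = lam ''a'' N
     (RecC \<cdot> Var ''a'' N \<cdot> ZeroC \<cdot> lam ''y'' N (lam ''x'' N (Var ''x'' N)))"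

definition monusC :: tm where
  "monusC = lam ''a'' N (lam ''b'' N
     (RecC \<cdot> Var ''b'' N \<cdot> Var ''a'' N \<cdot> lam ''y'' N (lam ''x'' N (predC \<cdot> Var ''y'' N))))"

text \<open>\<open>triC \<cdot> n\<close> is \<open>0 + 1 + \<dots> + n\<close>; \<open>pairC\<close> is Cantor's pairing function.\<close>

definition triC :: tm where
  "triC = lam ''a'' N (RecC \<cdot> Var ''a'' N \<cdot> ZeroC \<cdot>
     lam ''y'' N (lam ''x'' N (plusC \<cdot> Var ''y'' N \<cdot> (SucC \<cdot> Var ''x'' N))))"

definition pairC :: tm where
  "pairC = lam ''a'' N (lam ''b'' N
     (plusC \<cdot> (triC \<cdot> (plusC \<cdot> Var ''a'' N \<cdot> Var ''b'' N)) \<cdot> Var ''a'' N))"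

text \<open>
  Numerical codes of finite sequences of numbers: the empty sequence has code 0, and appending
  \<open>k\<close> to a sequence with code \<open>c\<close> gives the code \<open>pair c k + 1\<close>. Every number is the code of
  exactly one sequence.
\<close>

definition codeC :: tm where
  "codeC = lam ''w'' (Star N) (RecC \<cdot> (LenC N \<cdot> Var ''w'' (Star N)) \<cdot> ZeroC \<cdot>
     lam ''y'' N (lam ''x'' N
       (SucC \<cdot> (pairC \<cdot> Var ''y'' N \<cdot> (EntC N \<cdot> Var ''w'' (Star N) \<cdot> Var ''x'' N)))))"

abbreviation Succ :: "tm \<Rightarrow> tm" where "Succ t \<equiv> SucC \<cdot> t"
abbreviation One :: tm where "One \<equiv> SucC \<cdot> ZeroC"
abbreviation Pair0 :: "tm \<Rightarrow> tm \<Rightarrow> tm" where "Pair0 s t \<equiv> pairC \<cdot> s \<cdot> t"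
abbreviation Code :: "tm \<Rightarrow> tm" where "Code t \<equiv> codeC \<cdot> t"

text \<open>\<open>Bar g n\<close> is the sequence of the first \<open>n\<close> values of \<open>g\<close>, an object of type 0*.\<close>

abbreviation Bar :: "tm \<Rightarrow> tm \<Rightarrow> tm" where "Bar g n \<equiv> SeqC N \<cdot> n \<cdot> g"

abbreviation Le :: "tm \<Rightarrow> tm \<Rightarrow> fm"  (infix "\<^bold>\<le>" 50)
  where "s \<^bold>\<le> t \<equiv> monusC \<cdot> s \<cdot> t \<^bold>= ZeroC"

abbreviation Lt :: "tm \<Rightarrow> tm \<Rightarrow> fm"  (infix "\<^bold><" 50)
  where "s \<^bold>< t \<equiv> Succ s \<^bold>\<le> t"


section \<open>Equality in all types\<close>

primrec maxlen :: "tm \<Rightarrow> nat" where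
  "maxlen (Var x \<tau>) = length x"
| "maxlen ZeroC = 0"
| "maxlen SucC = 0"
| "maxlen (KC \<rho> \<tau>) = 0"
| "maxlen (SC \<delta> \<rho> \<tau>) = 0"
| "maxlen RecC = 0"
| "maxlen (SeqC \<tau>) = 0"
| "maxlen (LenC \<tau>) = 0"
| "maxlen (EntC \<tau>) = 0"
| "maxlen (s \<cdot> t) = max (maxlen s) (maxlen t)"

text \<open>A name longer than, hence distinct from, all names occurring in \<open>s\<close> and \<open>t\<close>.\<close>

definition fresh :: "tm \<Rightarrow> tm \<Rightarrow> string" where
  "fresh s t = replicate (Suc (max (maxlen s) (maxlen t))) (CHR ''v'')"

text \<open>
  Extensional equality: pointwise for functions; finite sequences are equal if they have equal
  length and equal entries within it.
\<close>

primrec eqF :: "ty \<Rightarrow> tm \<Rightarrow> tm \<Rightarrow> fm" where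
  "eqF N = (\<lambda>s t. s \<^bold>= t)"
| "eqF (\<rho> \<rightarrow> \<tau>) = (\<lambda>s t. let v = fresh s t in
     \<^bold>\<forall>v\<^bold>:\<rho>. eqF \<tau> (s \<cdot> Var v \<rho>) (t \<cdot> Var v \<rho>))"
| "eqF (Star \<tau>) = (\<lambda>s t. let v = fresh s t in
     LenC \<tau> \<cdot> s \<^bold>= LenC \<tau> \<cdot> t \<^bold>\<and>
     (\<^bold>\<forall>v\<^bold>:N. Var v N \<^bold>< LenC \<tau> \<cdot> s \<^bold>\<longrightarrow>
        eqF \<tau> (EntC \<tau> \<cdot> s \<cdot> Var v N) (EntC \<tau> \<cdot> t \<cdot> Var v N)))"


section \<open>The base theory\<close>

abbreviation n0 :: "string \<Rightarrow> tm" where "n0 x \<equiv> Var x N"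
abbreviation n1 :: "string \<Rightarrow> tm" where "n1 x \<equiv> Var x T1"

text \<open>
  The last three axioms define the constants for finite sequences up to extensional equality;
  entries beyond the length are fixed to be zero of the respective type.
\<close>

inductive_set E_PRA_omega :: "fm set" where
  eq_refl: "(n0 ''x'' \<^bold>= n0 ''x'') \<in> E_PRA_omega"
| eq_eucl: "(n0 ''x'' \<^bold>= n0 ''y'' \<^bold>\<longrightarrow> n0 ''x'' \<^bold>= n0 ''z'' \<^bold>\<longrightarrow> n0 ''y'' \<^bold>= n0 ''z'')
    \<in> E_PRA_omega"
| suc_nonzero: "(\<^bold>\<not> (Succ (n0 ''x'') \<^bold>= ZeroC)) \<in> E_PRA_omega"
| suc_inj: "(Succ (n0 ''x'') \<^bold>= Succ (n0 ''y'') \<^bold>\<longrightarrow> n0 ''x'' \<^bold>= n0 ''y'') \<in> E_PRA_omega"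
| comb_K: "eqF \<rho> (KC \<rho> \<tau> \<cdot> Var ''x'' \<rho> \<cdot> Var ''y'' \<tau>) (Var ''x'' \<rho>) \<in> E_PRA_omega"
| comb_S: "eqF \<tau>
    (SC \<delta> \<rho> \<tau> \<cdot> Var ''x'' (\<delta> \<rightarrow> \<rho> \<rightarrow> \<tau>) \<cdot> Var ''y'' (\<delta> \<rightarrow> \<rho>) \<cdot> Var ''z'' \<delta>)
    (Var ''x'' (\<delta> \<rightarrow> \<rho> \<rightarrow> \<tau>) \<cdot> Var ''z'' \<delta> \<cdot> (Var ''y'' (\<delta> \<rightarrow> \<rho>) \<cdot> Var ''z'' \<delta>))
    \<in> E_PRA_omega"
| rec_zero: "(RecC \<cdot> ZeroC \<cdot> n0 ''y'' \<cdot> Var ''z'' (N \<rightarrow> N \<rightarrow> N) \<^bold>= n0 ''y'') \<in> E_PRA_omega"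
| rec_suc: "(RecC \<cdot> Succ (n0 ''x'') \<cdot> n0 ''y'' \<cdot> Var ''z'' (N \<rightarrow> N \<rightarrow> N) \<^bold>=
      Var ''z'' (N \<rightarrow> N \<rightarrow> N) \<cdot> (RecC \<cdot> n0 ''x'' \<cdot> n0 ''y'' \<cdot> Var ''z'' (N \<rightarrow> N \<rightarrow> N)) \<cdot> n0 ''x'')
    \<in> E_PRA_omega"
| ext: "(eqF \<rho> (Var ''x'' \<rho>) (Var ''y'' \<rho>) \<^bold>\<longrightarrow>
      eqF \<tau> (Var ''z'' (\<rho> \<rightarrow> \<tau>) \<cdot> Var ''x'' \<rho>) (Var ''z'' (\<rho> \<rightarrow> \<tau>) \<cdot> Var ''y'' \<rho>))
    \<in> E_PRA_omega"
| qf_induct: "qf \<phi> \<Longrightarrow> wff \<phi> \<Longrightarrow>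
    (subst x N ZeroC \<phi> \<^bold>\<longrightarrow> (\<^bold>\<forall>x\<^bold>:N. \<phi> \<^bold>\<longrightarrow> subst x N (Succ (n0 x)) \<phi>) \<^bold>\<longrightarrow> (\<^bold>\<forall>x\<^bold>:N. \<phi>))
    \<in> E_PRA_omega"
| seq_len: "(LenC \<tau> \<cdot> (SeqC \<tau> \<cdot> n0 ''n'' \<cdot> Var ''f'' (N \<rightarrow> \<tau>)) \<^bold>= n0 ''n'') \<in> E_PRA_omega"
| seq_ent: "(n0 ''i'' \<^bold>< n0 ''n'' \<^bold>\<longrightarrow>
      eqF \<tau> (EntC \<tau> \<cdot> (SeqC \<tau> \<cdot> n0 ''n'' \<cdot> Var ''f'' (N \<rightarrow> \<tau>)) \<cdot> n0 ''i'')
        (Var ''f'' (N \<rightarrow> \<tau>) \<cdot> n0 ''i''))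
    \<in> E_PRA_omega"
| seq_ent_beyond: "(n0 ''n'' \<^bold>\<le> n0 ''i'' \<^bold>\<longrightarrow>
      eqF \<tau> (EntC \<tau> \<cdot> (SeqC \<tau> \<cdot> n0 ''n'' \<cdot> Var ''f'' (N \<rightarrow> \<tau>)) \<cdot> n0 ''i'') (zero_tm \<tau>))
    \<in> E_PRA_omega"

inductive_set QF_AC_1_0 :: "fm set" where
  "qf \<phi> \<Longrightarrow> wff \<phi> \<Longrightarrow> (F, T2) \<notin> fv \<phi> \<Longrightarrow>
    ((\<^bold>\<forall>x\<^bold>:T1. \<^bold>\<exists>y\<^bold>:N. \<phi>) \<^bold>\<longrightarrow>
      (\<^bold>\<exists>F\<^bold>:T2. \<^bold>\<forall>x\<^bold>:T1. subst y N (Var F T2 \<cdot> n1 x) \<phi>)) \<in> QF_AC_1_0"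

definition RCA0_omega :: "fm set" where
  "RCA0_omega = E_PRA_omega \<union> QF_AC_1_0"


section \<open>The principles\<close>

text \<open>
  The formula-valued functions below bind named variables; in all uses the arguments have
  variables with other names.
\<close>

definition mu2 :: fm where
  "mu2 = (\<^bold>\<exists>''mu''\<^bold>:T2. \<^bold>\<forall>''f''\<^bold>:T1.
     (\<^bold>\<exists>''n''\<^bold>:N. n1 ''f'' \<cdot> n0 ''n'' \<^bold>= ZeroC) \<^bold>\<longrightarrow>
     n1 ''f'' \<cdot> (Var ''mu'' T2 \<cdot> n1 ''f'') \<^bold>= ZeroC)"

definition le1_one :: "tm \<Rightarrow> fm" where
  "le1_one f = (\<^bold>\<forall>''p''\<^bold>:N. f \<cdot> n0 ''p'' \<^bold>\<le> One)"

definition extends_seq :: "tm \<Rightarrow> tm \<Rightarrow> fm" where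
  "extends_seq f s = (\<^bold>\<forall>''i''\<^bold>:N. n0 ''i'' \<^bold>< LenC N \<cdot> s \<^bold>\<longrightarrow>
     f \<cdot> n0 ''i'' \<^bold>= EntC N \<cdot> s \<cdot> n0 ''i'')"

definition elem_of :: "ty \<Rightarrow> tm \<Rightarrow> tm \<Rightarrow> fm" where
  "elem_of \<tau> g w = (\<^bold>\<exists>''i''\<^bold>:N. n0 ''i'' \<^bold>< LenC \<tau> \<cdot> w \<^bold>\<and> eqF \<tau> g (EntC \<tau> \<cdot> w \<cdot> n0 ''i''))"

definition SFF :: "tm \<Rightarrow> fm" where
  "SFF \<Theta> = (\<^bold>\<forall>''G''\<^bold>:T2. \<^bold>\<forall>''f''\<^bold>:T1. le1_one (n1 ''f'') \<^bold>\<longrightarrow>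
     (\<^bold>\<exists>''g''\<^bold>:T1. elem_of T1 (n1 ''g'') (\<Theta> \<cdot> Var ''G'' T2) \<^bold>\<and>
        extends_seq (n1 ''f'') (Bar (n1 ''g'') (Var ''G'' T2 \<cdot> n1 ''g''))))"

definition ex_SFF :: fm where
  "ex_SFF = (\<^bold>\<exists>''Theta''\<^bold>:(T2 \<rightarrow> Star T1). SFF (Var ''Theta'' (T2 \<rightarrow> Star T1)))"

text \<open>Sets of numbers are coded by characteristic functions, with value 1 for membership.\<close>

definition is_set :: "tm \<Rightarrow> fm" where
  "is_set X = le1_one X"

definition mem :: "tm \<Rightarrow> tm \<Rightarrow> fm" where
  "mem k X = (X \<cdot> k \<^bold>= One)"

definition le_in :: "tm \<Rightarrow> tm \<Rightarrow> tm \<Rightarrow> fm" where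
  "le_in X i j = mem (Pair0 i j) X"

definition less_in :: "tm \<Rightarrow> tm \<Rightarrow> tm \<Rightarrow> fm" where
  "less_in X i j = (mem (Pair0 i j) X \<^bold>\<and> \<^bold>\<not> mem (Pair0 j i) X)"

definition in_field :: "tm \<Rightarrow> tm \<Rightarrow> fm" where
  "in_field X i = mem (Pair0 i i) X"

text \<open>
  As usual in second-order arithmetic, a countable linear order is a set of pairs that is
  reflexive on its field.
\<close>

definition LO :: "tm \<Rightarrow> fm" where
  "LO X = (is_set X
     \<^bold>\<and> (\<^bold>\<forall>''i''\<^bold>:N. \<^bold>\<forall>''j''\<^bold>:N. le_in X (n0 ''i'') (n0 ''j'') \<^bold>\<longrightarrow>
          in_field X (n0 ''i'') \<^bold>\<and> in_field X (n0 ''j''))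
     \<^bold>\<and> (\<^bold>\<forall>''i''\<^bold>:N. \<^bold>\<forall>''j''\<^bold>:N. \<^bold>\<forall>''k''\<^bold>:N.
          le_in X (n0 ''i'') (n0 ''j'') \<^bold>\<and> le_in X (n0 ''j'') (n0 ''k'') \<^bold>\<longrightarrow>
          le_in X (n0 ''i'') (n0 ''k''))
     \<^bold>\<and> (\<^bold>\<forall>''i''\<^bold>:N. \<^bold>\<forall>''j''\<^bold>:N.
          le_in X (n0 ''i'') (n0 ''j'') \<^bold>\<and> le_in X (n0 ''j'') (n0 ''i'') \<^bold>\<longrightarrow> n0 ''i'' \<^bold>= n0 ''j'')
     \<^bold>\<and> (\<^bold>\<forall>''i''\<^bold>:N. \<^bold>\<forall>''j''\<^bold>:N. in_field X (n0 ''i'') \<^bold>\<and> in_field X (n0 ''j'') \<^bold>\<longrightarrow>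
          le_in X (n0 ''i'') (n0 ''j'') \<^bold>\<or> le_in X (n0 ''j'') (n0 ''i'')))"

definition WO :: "tm \<Rightarrow> fm" where
  "WO X = (LO X \<^bold>\<and>
     \<^bold>\<not> (\<^bold>\<exists>''h''\<^bold>:T1. \<^bold>\<forall>''n''\<^bold>:N. in_field X (n1 ''h'' \<cdot> n0 ''n'') \<^bold>\<and>
          less_in X (n1 ''h'' \<cdot> Succ (n0 ''n'')) (n1 ''h'' \<cdot> n0 ''n'')))"

definition theta_of :: "tm \<Rightarrow> tm \<Rightarrow> tm \<Rightarrow> fm" where
  "theta_of f n Z =
     (\<^bold>\<exists>''m''\<^bold>:N. f \<cdot> Pair0 n (Pair0 (n0 ''m'') (Code (Bar Z (n0 ''m'')))) \<^bold>= ZeroC)"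

text \<open>\<open>is_restr X Y j Z\<close> says that \<open>Z\<close> is the set of all \<open>(m, i)\<close> in \<open>Y\<close> with \<open>i\<close> below \<open>j\<close> in \<open>X\<close>.\<close>

definition is_restr :: "tm \<Rightarrow> tm \<Rightarrow> tm \<Rightarrow> tm \<Rightarrow> fm" where
  "is_restr X Y j Z = (is_set Z \<^bold>\<and>
     (\<^bold>\<forall>''l''\<^bold>:N. mem (n0 ''l'') Z \<^bold>\<longleftrightarrow>
        (\<^bold>\<exists>''m''\<^bold>:N. \<^bold>\<exists>''i''\<^bold>:N. n0 ''l'' \<^bold>= Pair0 (n0 ''m'') (n0 ''i'') \<^bold>\<and>
           mem (n0 ''l'') Y \<^bold>\<and> less_in X (n0 ''i'') j)))"

definition H :: "tm \<Rightarrow> tm \<Rightarrow> tm \<Rightarrow> fm" where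
  "H f X Y = (is_set Y \<^bold>\<and>
     (\<^bold>\<forall>''k''\<^bold>:N. mem (n0 ''k'') Y \<^bold>\<longleftrightarrow>
        (\<^bold>\<exists>''n''\<^bold>:N. \<^bold>\<exists>''j''\<^bold>:N. n0 ''k'' \<^bold>= Pair0 (n0 ''n'') (n0 ''j'') \<^bold>\<and>
           in_field X (n0 ''j'') \<^bold>\<and>
           (\<^bold>\<exists>''Z''\<^bold>:T1. is_restr X Y (n0 ''j'') (n1 ''Z'') \<^bold>\<and>
              theta_of f (n0 ''n'') (n1 ''Z'')))))"

definition UATR :: fm where
  "UATR = (\<^bold>\<exists>''Phi''\<^bold>:(T1 \<rightarrow> T1 \<rightarrow> T1). \<^bold>\<forall>''X''\<^bold>:T1. \<^bold>\<forall>''f''\<^bold>:T1.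
     WO (n1 ''X'') \<^bold>\<longrightarrow>
     H (n1 ''f'') (n1 ''X'') (Var ''Phi'' (T1 \<rightarrow> T1 \<rightarrow> T1) \<cdot> n1 ''X'' \<cdot> n1 ''f''))"

text \<open>
  Binary trees are sets of codes of finite binary sequences closed under initial segments.
\<close>

abbreviation s0 :: "string \<Rightarrow> tm" where "s0 x \<equiv> Var x (Star N)"

definition binary_tree :: "tm \<Rightarrow> fm" where
  "binary_tree T = (is_set T \<^bold>\<and>
     (\<^bold>\<forall>''s''\<^bold>:(Star N). mem (Code (s0 ''s'')) T \<^bold>\<longrightarrow>
        (\<^bold>\<forall>''i''\<^bold>:N. n0 ''i'' \<^bold>< LenC N \<cdot> s0 ''s'' \<^bold>\<longrightarrow> EntC N \<cdot> s0 ''s'' \<cdot> n0 ''i'' \<^bold>\<le> One) \<^bold>\<and>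
        (\<^bold>\<forall>''n''\<^bold>:N. n0 ''n'' \<^bold>\<le> LenC N \<cdot> s0 ''s'' \<^bold>\<longrightarrow>
           mem (Code (Bar (EntC N \<cdot> s0 ''s'') (n0 ''n''))) T)))"

definition infinite_set :: "tm \<Rightarrow> fm" where
  "infinite_set T = (\<^bold>\<forall>''m''\<^bold>:N. \<^bold>\<exists>''n''\<^bold>:N. n0 ''m'' \<^bold>< n0 ''n'' \<^bold>\<and> mem (n0 ''n'') T)"

definition WKL :: fm where
  "WKL = (\<^bold>\<forall>''T''\<^bold>:T1. binary_tree (n1 ''T'') \<^bold>\<and> infinite_set (n1 ''T'') \<^bold>\<longrightarrow>
     (\<^bold>\<exists>''g''\<^bold>:T1. \<^bold>\<forall>''n''\<^bold>:N. mem (Code (Bar (n1 ''g'') (n0 ''n''))) (n1 ''T'')))"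

end

theory Submission
  imports Defs "HOL-Library.Countable" "HOL-Library.Nat_Bijection"
begin

text \<open>Provability. A Henkin construction followed by a quotient by extensional equality reduces the
first claim to arbitrary models with true equality. Given \<open>\<mu>\<close> and \<open>\<Theta>\<close>, let \<open>G(Y)\<close> exceed the place
of a minimal error of \<open>Y\<close> as a hierarchy for \<open>f\<close> along \<open>X\<close>. Some entry of \<open>\<Theta>(G)\<close> is free of errors:
otherwise take the entry whose first erroneous column is \<open>X\<close>-maximal and correct that column; the
result, restricted to the columns up to there, lies in none of the neighbourhoods
\<open>[g G(g)]\<close>. Conversely, recursion along a one-point order decides an existential formula.

Independence. Take untyped combinator values with all functions on the numbers and the
least-number operator, and interpret the types by a logical relation between families of values over
Baire space, in which a family of numbers must have finite Borel rank. Type 1 is full, so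
\<open>WKL\<close> and \<open>\<mu>\<close> are available. A functional witnessing \<open>UATR\<close>, applied to the order \<open>\<omega>\<close>, would
give hierarchies of one finite rank that evaluate predicates of all finite ranks; diagonalisation
refutes this.\<close>

section \<open>Semantics of terms and formulas\<close>

text \<open>The detour through models pays because derivations in the calculus would have to be
  built rule by rule. Its price is that the numbers of such a model may be nonstandard: the sequence
  given by \<open>Theta\<close> can have nonstandard length, and only quantifier-free induction is
  available. Every maximum, iteration or first disagreement must therefore be expressed by a
  quantifier-free formula; \<open>mu\<close> makes this possible, since it absorbs number
  quantifiers. For the independence the full type structure is useless: there, choice gives a
  witness of \<open>UATR\<close>. With type 1 full and a least-number operator at type 2, the
  restriction can only be on how values depend on a parameter. Finite Borel rank is the right bound:
  combinators, recursion and \<open>VMu\<close> raise a rank by a finite amount, while a hierarchy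
  along omega has no finite rank. The relation concerns whole families, so that one bound holds for
  all parameters at once; and it is binary, so that its diagonal gives the domains and the relation
  itself extensional equality.\<close>

fun is_cst :: "tm \<Rightarrow> bool" where
  "is_cst (Var x \<tau>) = False"
| "is_cst (s \<cdot> t) = False"
| "is_cst c = True"

text \<open>Avoids the equation \<open>typ_of s = (typ_of t \<rightarrow> cod (typ_of s))\<close>, on which the simplifier loops.\<close>

lemma wt_AppE:
  assumes "wt (s \<cdot> t)"
  obtains \<sigma> \<tau> where "wt s" "wt t" "typ_of s = (\<sigma> \<rightarrow> \<tau>)" "typ_of t = \<sigma>"
  using assms by (metis wt.simps(10))

type_synonym 'a env = "string \<times> ty \<Rightarrow> 'a"

definition upd :: "'a env \<Rightarrow> string \<Rightarrow> ty \<Rightarrow> 'a \<Rightarrow> 'a env" where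
  "upd \<rho> x \<tau> a = (\<lambda>p. if p = (x, \<tau>) then a else \<rho> p)"

lemma upd_apply [simp]: "upd \<rho> x \<tau> a (y, \<sigma>) = (if y = x \<and> \<sigma> = \<tau> then a else \<rho> (y, \<sigma>))"
  by (simp add: upd_def)

lemma upd_apply': "upd \<rho> x \<tau> a p = (if p = (x, \<tau>) then a else \<rho> p)"
  by (simp add: upd_def)

lemma upd_upd [simp]: "upd (upd \<rho> x \<tau> a) x \<tau> b = upd \<rho> x \<tau> b"
  by (auto simp: upd_def)

lemma upd_twist: "(x, \<tau>) \<noteq> (y, \<sigma>) \<Longrightarrow> upd (upd \<rho> x \<tau> a) y \<sigma> b = upd (upd \<rho> y \<sigma> b) x \<tau> a"
  by (auto simp: upd_def)

text \<open>\<open>E\<close> interprets equality of type 0 and need not be identity: the term model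
  uses derivable equality, its quotient and the model of the second claim use \<open>(=)\<close>.
  Only the values of \<open>cst\<close> on constants matter.\<close>

locale struct =
  fixes D :: "ty \<Rightarrow> 'a set" and ap :: "'a \<Rightarrow> 'a \<Rightarrow> 'a"  (infixl "\<bullet>" 100)
    and cst :: "tm \<Rightarrow> 'a" and E :: "'a \<Rightarrow> 'a \<Rightarrow> bool"
  assumes ap_D: "a \<in> D (\<sigma> \<rightarrow> \<tau>) \<Longrightarrow> b \<in> D \<sigma> \<Longrightarrow> a \<bullet> b \<in> D \<tau>"
    and cst_D: "is_cst c \<Longrightarrow> cst c \<in> D (typ_of c)"
begin

primrec ev :: "'a env \<Rightarrow> tm \<Rightarrow> 'a" where
  "ev \<rho> (Var x \<tau>) = \<rho> (x, \<tau>)"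
| "ev \<rho> ZeroC = cst ZeroC"
| "ev \<rho> SucC = cst SucC"
| "ev \<rho> (KC \<sigma> \<tau>) = cst (KC \<sigma> \<tau>)"
| "ev \<rho> (SC \<delta> \<sigma> \<tau>) = cst (SC \<delta> \<sigma> \<tau>)"
| "ev \<rho> RecC = cst RecC"
| "ev \<rho> (SeqC \<tau>) = cst (SeqC \<tau>)"
| "ev \<rho> (LenC \<tau>) = cst (LenC \<tau>)"
| "ev \<rho> (EntC \<tau>) = cst (EntC \<tau>)"
| "ev \<rho> (s \<cdot> t) = ev \<rho> s \<bullet> ev \<rho> t"

primrec sat :: "'a env \<Rightarrow> fm \<Rightarrow> bool" where
  "sat \<rho> (s \<^bold>= t) = E (ev \<rho> s) (ev \<rho> t)"
| "sat \<rho> \<^bold>\<bottom> = False"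
| "sat \<rho> (\<phi> \<^bold>\<longrightarrow> \<psi>) = (sat \<rho> \<phi> \<longrightarrow> sat \<rho> \<psi>)"
| "sat \<rho> (\<^bold>\<forall>x\<^bold>:\<tau>. \<phi>) = (\<forall>a\<in>D \<tau>. sat (upd \<rho> x \<tau> a) \<phi>)"

definition ok :: "'a env \<Rightarrow> bool" where
  "ok \<rho> \<longleftrightarrow> (\<forall>x \<tau>. \<rho> (x, \<tau>) \<in> D \<tau>)"

lemma ok_D [simp]: "ok \<rho> \<Longrightarrow> \<rho> (x, \<tau>) \<in> D \<tau>"
  by (simp add: ok_def)

lemma ok_upd [simp]: "ok \<rho> \<Longrightarrow> a \<in> D \<tau> \<Longrightarrow> ok (upd \<rho> x \<tau> a)"
  by (simp add: ok_def)

lemma csts_D [simp]: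
  "cst ZeroC \<in> D N" "cst SucC \<in> D (N \<rightarrow> N)" "cst (KC \<sigma> \<tau>) \<in> D (\<sigma> \<rightarrow> \<tau> \<rightarrow> \<sigma>)"
  "cst (SC \<delta> \<sigma> \<tau>) \<in> D ((\<delta> \<rightarrow> \<sigma> \<rightarrow> \<tau>) \<rightarrow> (\<delta> \<rightarrow> \<sigma>) \<rightarrow> \<delta> \<rightarrow> \<tau>)"
  "cst RecC \<in> D (N \<rightarrow> N \<rightarrow> (N \<rightarrow> N \<rightarrow> N) \<rightarrow> N)"
  "cst (SeqC \<tau>) \<in> D (N \<rightarrow> (N \<rightarrow> \<tau>) \<rightarrow> Star \<tau>)"
  "cst (LenC \<tau>) \<in> D (Star \<tau> \<rightarrow> N)" "cst (EntC \<tau>) \<in> D (Star \<tau> \<rightarrow> N \<rightarrow> \<tau>)"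
  using cst_D[of ZeroC] cst_D[of SucC] cst_D[of "KC _ _"] cst_D[of "SC _ _ _"] cst_D[of RecC]
    cst_D[of "SeqC _"] cst_D[of "LenC _"] cst_D[of "EntC _"] by simp_all

lemma ev_D: "wt t \<Longrightarrow> ok \<rho> \<Longrightarrow> ev \<rho> t \<in> D (typ_of t)"
proof (induction t)
  case (App s t)
  from App.prems(1) show ?case by (rule wt_AppE) (use App.IH App.prems(2) ap_D in auto)
qed simp_all

lemma ev_D': "wt t \<Longrightarrow> ok \<rho> \<Longrightarrow> typ_of t = \<tau> \<Longrightarrow> ev \<rho> t \<in> D \<tau>"
  using ev_D by blast

lemma ev_cong: "(\<And>p. p \<in> fvt t \<Longrightarrow> \<rho> p = \<rho>' p) \<Longrightarrow> ev \<rho> t = ev \<rho>' t"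
  by (induction t) auto

lemma sat_cong: "(\<And>p. p \<in> fv \<phi> \<Longrightarrow> \<rho> p = \<rho>' p) \<Longrightarrow> sat \<rho> \<phi> = sat \<rho>' \<phi>"
proof (induction \<phi> arbitrary: \<rho> \<rho>')
  case (Eq0 s t)
  then have "ev \<rho> s = ev \<rho>' s" "ev \<rho> t = ev \<rho>' t" by (auto intro!: ev_cong)
  then show ?case by simp
next
  case (FImp \<phi> \<psi>)
  have "sat \<rho> \<phi> = sat \<rho>' \<phi>" "sat \<rho> \<psi> = sat \<rho>' \<psi>"
    by (auto intro!: FImp.IH FImp.prems)
  then show ?case by simp
next
  case (FAll x \<tau> \<phi>)
  have "sat (upd \<rho> x \<tau> a) \<phi> = sat (upd \<rho>' x \<tau> a) \<phi>" for a
    by (rule FAll.IH) (use FAll.prems in \<open>auto simp: upd_apply'\<close>)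
  then show ?case by simp
qed auto

lemma ev_upd_fresh: "(x, \<tau>) \<notin> fvt t \<Longrightarrow> ev (upd \<rho> x \<tau> a) t = ev \<rho> t"
  by (rule ev_cong) (auto simp: upd_apply')

lemma ev_substt: "ev \<rho> (substt x \<tau> u t) = ev (upd \<rho> x \<tau> (ev \<rho> u)) t"
  by (induction t) auto

lemma sat_subst:
  "free_for u x \<tau> \<phi> \<Longrightarrow> sat \<rho> (subst x \<tau> u \<phi>) = sat (upd \<rho> x \<tau> (ev \<rho> u)) \<phi>"
proof (induction \<phi> arbitrary: \<rho>)
  case (FAll y \<sigma> \<phi>)
  show ?case
  proof (cases "y = x \<and> \<sigma> = \<tau>")
    case True
    then show ?thesis by simp
  next
    case False
    then have sub: "subst x \<tau> u (\<^bold>\<forall>y\<^bold>:\<sigma>. \<phi>) = (\<^bold>\<forall>y\<^bold>:\<sigma>. subst x \<tau> u \<phi>)" by auto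
    show ?thesis
    proof (cases "(x, \<tau>) \<in> fv \<phi>")
      case True
      then have ff: "free_for u x \<tau> \<phi>" "(y, \<sigma>) \<notin> fvt u" using FAll.prems False by auto
      have "sat (upd \<rho> y \<sigma> a) (subst x \<tau> u \<phi>) = sat (upd (upd \<rho> x \<tau> (ev \<rho> u)) y \<sigma> a) \<phi>" for a
        unfolding FAll.IH[OF ff(1)] ev_upd_fresh[OF ff(2)] using False
        by (subst upd_twist) auto
      then show ?thesis by (simp only: sub sat.simps)
    next
      \<comment> \<open>\<open>free_for\<close> gives no information on \<phi> here, but the
        substitution leaves \<phi> unchanged and its truth does not depend on the changed
        value.\<close>
      case no: False
      have "subst x \<tau> u \<psi> = \<psi>" if "(x, \<tau>) \<notin> fv \<psi>" for \<psi>
      proof -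
        have "substt x \<tau> u t = t" if "(x, \<tau>) \<notin> fvt t" for t
          using that by (induction t) auto
        then show ?thesis using that by (induction \<psi>) auto
      qed
      with no have "subst x \<tau> u \<phi> = \<phi>" by blast
      moreover have "sat \<rho> (\<^bold>\<forall>y\<^bold>:\<sigma>. \<phi>) = sat (upd \<rho> x \<tau> (ev \<rho> u)) (\<^bold>\<forall>y\<^bold>:\<sigma>. \<phi>)"
        by (rule sat_cong) (use no in \<open>auto simp: upd_apply'\<close>)
      ultimately show ?thesis using sub by simp
    qed
  qed
qed (auto simp: ev_substt)

lemma qf_free_for: "qf \<phi> \<Longrightarrow> free_for u x \<tau> \<phi>"
  by (induction \<phi>) auto

end

lemma wt_substt:
  "wt t \<Longrightarrow> wt u \<Longrightarrow> typ_of u = \<tau> \<Longrightarrow> wt (substt x \<tau> u t) \<and> typ_of (substt x \<tau> u t) = typ_of t"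
proof (induction t)
  case (App s t)
  from App.prems(1) show ?case by (rule wt_AppE) (use App.IH App.prems(2,3) in auto)
qed auto

lemma wff_subst: "wff \<phi> \<Longrightarrow> wt u \<Longrightarrow> typ_of u = \<tau> \<Longrightarrow> wff (subst x \<tau> u \<phi>)"
  by (induction \<phi>) (auto simp: wt_substt)

lemma proves_wff: "T \<^bold>\<turnstile> \<phi> \<Longrightarrow> (\<And>\<phi>. \<phi> \<in> T \<Longrightarrow> wff \<phi>) \<Longrightarrow> wff \<phi>"
  by (induction rule: proves.induct) (auto simp: wff_subst)

context struct
begin

text \<open>Axioms are assumed true under every admissible assignment, which makes the unrestricted
  rule \<open>gen\<close> sound; hence the induction keeps the assignment arbitrary.\<close>

lemma sound:
  assumes "T \<^bold>\<turnstile> \<phi>" and T: "\<And>\<phi> \<rho>. \<phi> \<in> T \<Longrightarrow> ok \<rho> \<Longrightarrow> sat \<rho> \<phi>" and "ok \<rho>"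
  shows "sat \<rho> \<phi>"
  using assms(1,3)
proof (induction arbitrary: \<rho> rule: proves.induct)
  case (all_inst \<phi> u \<tau> x)
  then show ?case using sat_subst[of u x \<tau> \<phi> \<rho>] ev_D[of u \<rho>] by auto
next
  case (all_imp \<phi> \<psi> x \<tau>)
  then have "sat (upd \<rho> x \<tau> a) \<phi> = sat \<rho> \<phi>" for a
    by (intro sat_cong) (auto simp: upd_apply')
  then show ?case by auto
qed (use T in auto)

end

lemma wt_lam [simp]: "wt t \<Longrightarrow> wt (lam x \<tau> t)"
  and typ_lam [simp]: "wt t \<Longrightarrow> typ_of (lam x \<tau> t) = (\<tau> \<rightarrow> typ_of t)"
proof -
  have "wt t \<Longrightarrow> wt (lam x \<tau> t) \<and> typ_of (lam x \<tau> t) = (\<tau> \<rightarrow> typ_of t)"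
  proof (induction t)
    case (App s t)
    from App.prems show ?case by (rule wt_AppE) (use App.IH in auto)
  qed auto
  then show "wt t \<Longrightarrow> wt (lam x \<tau> t)" "wt t \<Longrightarrow> typ_of (lam x \<tau> t) = (\<tau> \<rightarrow> typ_of t)"
    by auto
qed

lemma fvt_lam [simp]: "fvt (lam x \<tau> t) = fvt t - {(x, \<tau>)}"
  by (induction t) auto

lemma wt_zero_tm [simp]: "wt (zero_tm \<tau>)" and typ_zero_tm [simp]: "typ_of (zero_tm \<tau>) = \<tau>"
proof -
  have "wt (zero_tm \<tau>) \<and> typ_of (zero_tm \<tau>) = \<tau>" by (induction \<tau>) auto
  then show "wt (zero_tm \<tau>)" "typ_of (zero_tm \<tau>) = \<tau>" by auto
qed

lemma fvt_zero_tm [simp]: "fvt (zero_tm \<tau>) = {}"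
  by (induction \<tau>) auto

context struct
begin

text \<open>Zero terms are closed, so their values under a junk assignment are meaningful. They show
  that all domains are inhabited and give a base assignment in which to evaluate closed
  terms.\<close>

definition dflt :: "'a env" where
  "dflt = (\<lambda>(x, \<tau>). ev (\<lambda>_. undefined) (zero_tm \<tau>))"

lemma ok_dflt [simp]: "ok dflt"
proof -
  have "ev (\<lambda>_. undefined) (zero_tm \<tau>) \<in> D \<tau>" for \<tau>
  proof (induction \<tau>)
    case N
    then show ?case by simp
  next
    case (Fn \<sigma> \<tau>)
    then show ?case using ap_D[OF csts_D(3)] by simp
  next
    case (Star \<tau>)
    then have "cst (KC \<tau> N) \<bullet> ev (\<lambda>_. undefined) (zero_tm \<tau>) \<in> D (N \<rightarrow> \<tau>)"
      using ap_D[OF csts_D(3)] by simp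
    then show ?case using ap_D[OF ap_D[OF csts_D(6) csts_D(1)]] by simp
  qed
  then show ?thesis by (simp add: ok_def dflt_def)
qed

abbreviation clo :: "tm \<Rightarrow> 'a" where "clo t \<equiv> ev dflt t"

lemma ev_closed: "fvt t = {} \<Longrightarrow> ev \<rho> t = clo t"
  by (rule ev_cong) auto

end

locale comb = struct +
  assumes K_eq: "a \<in> D \<sigma> \<Longrightarrow> b \<in> D \<tau> \<Longrightarrow> cst (KC \<sigma> \<tau>) \<bullet> a \<bullet> b = a"
    and S_eq: "a \<in> D (\<delta> \<rightarrow> \<sigma> \<rightarrow> \<tau>) \<Longrightarrow> b \<in> D (\<delta> \<rightarrow> \<sigma>) \<Longrightarrow> c \<in> D \<delta> \<Longrightarrow>
      cst (SC \<delta> \<sigma> \<tau>) \<bullet> a \<bullet> b \<bullet> c = a \<bullet> c \<bullet> (b \<bullet> c)"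
begin

lemma ev_lam [simp]:
  "ok \<rho> \<Longrightarrow> wt t \<Longrightarrow> a \<in> D \<tau> \<Longrightarrow> ev \<rho> (lam x \<tau> t) \<bullet> a = ev (upd \<rho> x \<tau> a) t"
proof (induction t)
  case (Var y \<sigma>)
  have "cst (SC \<tau> (\<tau> \<rightarrow> \<tau>) \<tau>) \<bullet> cst (KC \<tau> (\<tau> \<rightarrow> \<tau>)) \<bullet> cst (KC \<tau> \<tau>) \<bullet> a = a"
    using Var by (simp add: S_eq[OF csts_D(3) csts_D(3)] K_eq[OF _ ap_D[OF csts_D(3)]])
  then show ?case using Var by (simp add: K_eq)
next
  case (App s t)
  from App.prems(2) show ?case
  proof (rule wt_AppE)
    fix \<sigma> \<upsilon> assume st: "wt s" "wt t" "typ_of s = (\<sigma> \<rightarrow> \<upsilon>)" "typ_of t = \<sigma>"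
    then have "ev \<rho> (lam x \<tau> s) \<in> D (\<tau> \<rightarrow> \<sigma> \<rightarrow> \<upsilon>)" "ev \<rho> (lam x \<tau> t) \<in> D (\<tau> \<rightarrow> \<sigma>)"
      using App.prems by (auto intro!: ev_D')
    then show ?case using App.IH App.prems(1,3) st by (simp add: S_eq)
  qed
qed (simp_all add: K_eq)

end

declare lam.simps [simp del]

lemma fvt_arith [simp]: "fvt plusC = {}" "fvt predC = {}" "fvt monusC = {}" "fvt triC = {}"
  "fvt pairC = {}" "fvt codeC = {}"
  by (auto simp: plusC_def predC_def monusC_def triC_def pairC_def codeC_def)

context struct
begin

text \<open>The value of \<^const>\<open>eqF\<close>, independent of the choice of bound variables.\<close>

primrec EQ :: "ty \<Rightarrow> 'a \<Rightarrow> 'a \<Rightarrow> bool" where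
  "EQ N = E"
| "EQ (\<sigma> \<rightarrow> \<tau>) = (\<lambda>a b. \<forall>x\<in>D \<sigma>. EQ \<tau> (a \<bullet> x) (b \<bullet> x))"
| "EQ (Star \<tau>) = (\<lambda>a b. E (cst (LenC \<tau>) \<bullet> a) (cst (LenC \<tau>) \<bullet> b) \<and>
     (\<forall>i\<in>D N. E (ev (\<lambda>_. undefined) monusC \<bullet> (cst SucC \<bullet> i) \<bullet> (cst (LenC \<tau>) \<bullet> a)) (cst ZeroC) \<longrightarrow>
        EQ \<tau> (cst (EntC \<tau>) \<bullet> a \<bullet> i) (cst (EntC \<tau>) \<bullet> b \<bullet> i)))"

lemma length_maxlen: "(x, \<tau>) \<in> fvt t \<Longrightarrow> length x \<le> maxlen t"
  by (induction t) auto

lemma fresh_fvt: "(fresh s t, \<tau>) \<notin> fvt s" "(fresh s t, \<tau>) \<notin> fvt t"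
  using length_maxlen[of "fresh s t" \<tau> s] length_maxlen[of "fresh s t" \<tau> t]
  by (auto simp: fresh_def simp del: replicate_Suc)

lemma sat_eqF: "sat \<rho> (eqF \<tau> s t) = EQ \<tau> (ev \<rho> s) (ev \<rho> t)"
proof (induction \<tau> arbitrary: s t \<rho>)
  case (Fn \<sigma> \<tau>)
  then show ?case by (simp add: Let_def ev_upd_fresh fresh_fvt)
next
  case (Star \<tau> s t \<rho>)
  have mon: "ev \<rho> monusC = ev (\<lambda>_. undefined) monusC" by (rule ev_cong) auto
  show ?case unfolding EQ.simps mon[symmetric] using Star by (simp add: Let_def ev_upd_fresh fresh_fvt)
qed simp

end

section \<open>Completeness\<close>

text \<open>Theorems of \<open>T\<close> enter closed under generalisation, hypotheses from \<Gamma>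
  do not: there is no quantifier rule. This yields the deduction theorem without a side condition on
  free variables.\<close>

inductive ded :: "fm set \<Rightarrow> fm set \<Rightarrow> fm \<Rightarrow> bool" for T \<Gamma> where
  hyp: "\<phi> \<in> \<Gamma> \<Longrightarrow> ded T \<Gamma> \<phi>"
| prv: "T \<^bold>\<turnstile> \<phi> \<Longrightarrow> ded T \<Gamma> \<phi>"
| mp: "ded T \<Gamma> (\<phi> \<^bold>\<longrightarrow> \<psi>) \<Longrightarrow> ded T \<Gamma> \<phi> \<Longrightarrow> ded T \<Gamma> \<psi>"

lemma ded_mono: "ded T \<Gamma> \<phi> \<Longrightarrow> \<Gamma> \<subseteq> \<Delta> \<Longrightarrow> ded T \<Delta> \<phi>"
  by (induction rule: ded.induct) (auto intro: ded.intros)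

lemma ded_empty: "ded T {} \<phi> \<Longrightarrow> T \<^bold>\<turnstile> \<phi>"
  by (induction rule: ded.induct) (auto intro: proves.mp)

lemma ded_chain:
  assumes "ded T (\<Union>n. F n) \<phi>" "\<And>m n::nat. m \<le> n \<Longrightarrow> F m \<subseteq> F n"
  shows "\<exists>n. ded T (F n) \<phi>"
  using assms(1)
proof (induction rule: ded.induct)
  case (mp \<phi> \<psi>)
  then obtain m n where mn: "ded T (F m) (\<phi> \<^bold>\<longrightarrow> \<psi>)" "ded T (F n) \<phi>" by blast
  then have "ded T (F (max m n)) (\<phi> \<^bold>\<longrightarrow> \<psi>)" "ded T (F (max m n)) \<phi>"
    by (meson assms(2) ded_mono max.cobounded1 max.cobounded2)+
  then show ?case by (blast intro: ded.mp)
qed (auto intro: ded.intros)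

lemma imp_refl: "wff \<phi> \<Longrightarrow> T \<^bold>\<turnstile> \<phi> \<^bold>\<longrightarrow> \<phi>"
  using imp_S[of \<phi> "\<phi> \<^bold>\<longrightarrow> \<phi>" \<phi> T] imp_K[of \<phi> "\<phi> \<^bold>\<longrightarrow> \<phi>" T] imp_K[of \<phi> \<phi> T]
  by (auto intro: proves.mp)

lemma substt_id [simp]: "substt x \<tau> (Var x \<tau>) t = t"
  by (induction t) auto

lemma subst_id [simp]: "subst x \<tau> (Var x \<tau>) \<phi> = \<phi>"
  by (induction \<phi>) auto

lemma free_for_id [simp]: "free_for (Var x \<tau>) x \<tau> \<phi>"
  by (induction \<phi>) auto

context
  fixes T :: "fm set"
  assumes T_wff: "\<forall>\<phi>\<in>T. wff \<phi>"
begin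

lemma ded_wff: "ded T \<Gamma> \<phi> \<Longrightarrow> (\<And>\<gamma>. \<gamma> \<in> \<Gamma> \<Longrightarrow> wff \<gamma>) \<Longrightarrow> wff \<phi>"
proof (induction rule: ded.induct)
  case (prv \<phi>)
  then show ?case using proves_wff T_wff by blast
qed auto

lemma deduction:
  assumes "ded T (insert a \<Gamma>) \<phi>" "wff a" "\<And>\<gamma>. \<gamma> \<in> \<Gamma> \<Longrightarrow> wff \<gamma>"
  shows "ded T \<Gamma> (a \<^bold>\<longrightarrow> \<phi>)"
  using assms(1)
proof (induction rule: ded.induct)
  case (hyp \<phi>)
  show ?case
  proof (cases "\<phi> = a")
    case True
    then show ?thesis using imp_refl assms(2) by (auto intro: ded.prv)
  next
    case False
    then have "\<phi> \<in> \<Gamma>" using hyp by simp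
    then show ?thesis using imp_K[of \<phi> a T] assms by (blast intro: ded.intros)
  qed
next
  case (prv \<phi>)
  then have "wff \<phi>" using proves_wff T_wff by blast
  then show ?case using imp_K[of \<phi> a T] assms(2) prv by (blast intro: ded.intros)
next
  case (mp \<phi> \<psi>)
  have "wff (\<phi> \<^bold>\<longrightarrow> \<psi>)" using ded_wff[OF mp.hyps(1)] assms by blast
  then have "T \<^bold>\<turnstile> (a \<^bold>\<longrightarrow> \<phi> \<^bold>\<longrightarrow> \<psi>) \<^bold>\<longrightarrow> (a \<^bold>\<longrightarrow> \<phi>) \<^bold>\<longrightarrow> a \<^bold>\<longrightarrow> \<psi>"
    using imp_S[of a \<phi> \<psi> T] assms(2) by simp
  then show ?case using mp.IH by (blast intro: ded.intros)
qed

lemma ded_contr: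
  assumes "ded T (insert (\<^bold>\<not> \<phi>) \<Gamma>) \<^bold>\<bottom>" "wff \<phi>" "\<And>\<gamma>. \<gamma> \<in> \<Gamma> \<Longrightarrow> wff \<gamma>"
  shows "ded T \<Gamma> \<phi>"
  using deduction[OF assms(1)] assms(2,3) dneg[OF assms(2), of T] by (auto intro: ded.intros)

lemma ded_explode:
  assumes "ded T \<Gamma> \<^bold>\<bottom>" "wff \<phi>" "\<And>\<gamma>. \<gamma> \<in> \<Gamma> \<Longrightarrow> wff \<gamma>"
  shows "ded T \<Gamma> \<phi>"
proof -
  have "ded T (insert (\<^bold>\<not> \<phi>) \<Gamma>) \<^bold>\<bottom>" using ded_mono[OF assms(1)] by blast
  then show ?thesis using ded_contr assms(2,3) by blast
qed

lemma all_dist: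
  assumes "wff \<phi>" "wff \<psi>"
  shows "T \<^bold>\<turnstile> (\<^bold>\<forall>x\<^bold>:\<tau>. \<phi> \<^bold>\<longrightarrow> \<psi>) \<^bold>\<longrightarrow> (\<^bold>\<forall>x\<^bold>:\<tau>. \<phi>) \<^bold>\<longrightarrow> (\<^bold>\<forall>x\<^bold>:\<tau>. \<psi>)"
proof -
  let ?A = "\<^bold>\<forall>x\<^bold>:\<tau>. \<phi> \<^bold>\<longrightarrow> \<psi>" and ?B = "\<^bold>\<forall>x\<^bold>:\<tau>. \<phi>"
  have A: "T \<^bold>\<turnstile> ?A \<^bold>\<longrightarrow> \<phi> \<^bold>\<longrightarrow> \<psi>"
    using all_inst[of "\<phi> \<^bold>\<longrightarrow> \<psi>" "Var x \<tau>" \<tau> x T] assms by simp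
  have B: "T \<^bold>\<turnstile> ?B \<^bold>\<longrightarrow> \<phi>"
    using all_inst[of \<phi> "Var x \<tau>" \<tau> x T] assms by simp
  have "ded T {?B, ?A} \<psi>"
    using A B by (meson ded.intros insertI1 insertI2)
  then have "ded T {?A} (?B \<^bold>\<longrightarrow> \<psi>)"
    by (rule deduction) (use assms in auto)
  then have "ded T {} (?A \<^bold>\<longrightarrow> ?B \<^bold>\<longrightarrow> \<psi>)"
    by (rule deduction) (use assms in auto)
  then have "T \<^bold>\<turnstile> ?A \<^bold>\<longrightarrow> ?B \<^bold>\<longrightarrow> \<psi>" by (rule ded_empty)
  then have "T \<^bold>\<turnstile> (\<^bold>\<forall>x\<^bold>:\<tau>. ?A \<^bold>\<longrightarrow> ?B \<^bold>\<longrightarrow> \<psi>)" by (rule gen)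
  then have 1: "T \<^bold>\<turnstile> ?A \<^bold>\<longrightarrow> (\<^bold>\<forall>x\<^bold>:\<tau>. ?B \<^bold>\<longrightarrow> \<psi>)"
    using all_imp[of ?A "?B \<^bold>\<longrightarrow> \<psi>" x \<tau> T] assms by (auto intro: proves.mp)
  have 2: "T \<^bold>\<turnstile> (\<^bold>\<forall>x\<^bold>:\<tau>. ?B \<^bold>\<longrightarrow> \<psi>) \<^bold>\<longrightarrow> ?B \<^bold>\<longrightarrow> (\<^bold>\<forall>x\<^bold>:\<tau>. \<psi>)"
    using all_imp[of ?B \<psi> x \<tau> T] assms by auto
  have "ded T {?A} (?B \<^bold>\<longrightarrow> (\<^bold>\<forall>x\<^bold>:\<tau>. \<psi>))"
    using 1 2 by (meson ded.intros insertI1)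
  then have "ded T {} (?A \<^bold>\<longrightarrow> ?B \<^bold>\<longrightarrow> (\<^bold>\<forall>x\<^bold>:\<tau>. \<psi>))"
    by (rule deduction) (use assms in auto)
  then show ?thesis by (rule ded_empty)
qed

text \<open>Generalisation is recovered for variables not free in the hypotheses: each hypothesis is
  generalised vacuously by \<open>all_imp\<close>, and applications of \<open>mp\<close> are lifted
  by \<open>all_dist\<close>.\<close>

lemma ded_gen:
  assumes "ded T \<Gamma> \<phi>" "\<And>\<gamma>. \<gamma> \<in> \<Gamma> \<Longrightarrow> wff \<gamma> \<and> (x, \<tau>) \<notin> fv \<gamma>"
  shows "ded T \<Gamma> (\<^bold>\<forall>x\<^bold>:\<tau>. \<phi>)"
  using assms(1)
proof (induction rule: ded.induct)
  case (hyp \<phi>)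
  then have w: "wff \<phi>" "(x, \<tau>) \<notin> fv \<phi>" using assms by auto
  have "T \<^bold>\<turnstile> \<phi> \<^bold>\<longrightarrow> (\<^bold>\<forall>x\<^bold>:\<tau>. \<phi>)"
    using all_imp[of \<phi> \<phi> x \<tau> T] gen[OF imp_refl[of \<phi> T], of x \<tau>] w by (auto intro: proves.mp)
  then show ?case using hyp by (blast intro: ded.intros)
next
  case (prv \<phi>)
  then show ?case by (auto intro: ded.intros proves.gen)
next
  case (mp \<phi> \<psi>)
  have "wff (\<phi> \<^bold>\<longrightarrow> \<psi>)" using ded_wff[OF mp.hyps(1)] assms by blast
  then have "T \<^bold>\<turnstile> (\<^bold>\<forall>x\<^bold>:\<tau>. \<phi> \<^bold>\<longrightarrow> \<psi>) \<^bold>\<longrightarrow> (\<^bold>\<forall>x\<^bold>:\<tau>. \<phi>) \<^bold>\<longrightarrow> (\<^bold>\<forall>x\<^bold>:\<tau>. \<psi>)"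
    using all_dist[of \<phi> \<psi> x \<tau>] by simp
  then show ?case using mp.IH by (blast intro: ded.intros)
qed

end

section \<open>Maximal consistent sets with witnesses\<close>

primrec bn :: "fm \<Rightarrow> string set" where
  "bn (s \<^bold>= t) = {}"
| "bn \<^bold>\<bottom> = {}"
| "bn (\<phi> \<^bold>\<longrightarrow> \<psi>) = bn \<phi> \<union> bn \<psi>"
| "bn (\<^bold>\<forall>x\<^bold>:\<tau>. \<phi>) = insert x (bn \<phi>)"

lemma free_for_bn: "(\<And>y \<sigma>. (y, \<sigma>) \<in> fvt u \<Longrightarrow> y \<notin> bn \<phi>) \<Longrightarrow> free_for u x \<tau> \<phi>"
  by (induction \<phi>) fastforce+

lemma finite_fvt: "finite (fvt t)"
  by (induction t) auto

lemma finite_fv: "finite (fv \<phi>)"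
  by (induction \<phi>) (auto simp: finite_fvt)

lemma finite_bn: "finite (bn \<phi>)"
  by (induction \<phi>) auto

lemma substt_swap: "(y, \<tau>) \<notin> fvt t \<Longrightarrow> substt y \<tau> (Var x \<tau>) (substt x \<tau> (Var y \<tau>) t) = t"
  by (induction t) auto

lemma fvt_substt_Var: "y \<noteq> x \<Longrightarrow> (x, \<tau>) \<notin> fvt (substt x \<tau> (Var y \<tau>) t)"
  by (induction t) auto

lemma subst_fresh: "(x, \<tau>) \<notin> fv \<phi> \<Longrightarrow> subst x \<tau> u \<phi> = \<phi>"
proof -
  have "substt x \<tau> u t = t" if "(x, \<tau>) \<notin> fvt t" for t
    using that by (induction t) auto
  then show "(x, \<tau>) \<notin> fv \<phi> \<Longrightarrow> subst x \<tau> u \<phi> = \<phi>"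
    by (induction \<phi>) auto
qed

lemma subst_swap:
  "y \<notin> bn \<phi> \<Longrightarrow> (y, \<tau>) \<notin> fv \<phi> \<Longrightarrow> subst y \<tau> (Var x \<tau>) (subst x \<tau> (Var y \<tau>) \<phi>) = \<phi>"
  by (induction \<phi>) (auto simp: substt_swap subst_fresh)

lemma fv_subst_Var: "y \<noteq> x \<Longrightarrow> y \<notin> bn \<phi> \<Longrightarrow> (x, \<tau>) \<notin> fv (subst x \<tau> (Var y \<tau>) \<phi>)"
  by (induction \<phi>) (auto simp: fvt_substt_Var)

lemma free_for_swap:
  "y \<notin> bn \<phi> \<Longrightarrow> (y, \<tau>) \<notin> fv \<phi> \<Longrightarrow> free_for (Var x \<tau>) y \<tau> (subst x \<tau> (Var y \<tau>) \<phi>)"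
proof (induction \<phi>)
  case (FAll z \<sigma> \<phi>)
  then show ?case by (cases "z = x \<and> \<sigma> = \<tau>") auto
qed auto

text \<open>Reserved names never occur bound, so that reserved terms can be substituted freely.\<close>

definition rsv :: "string \<Rightarrow> bool" where
  "rsv x \<longleftrightarrow> x \<noteq> [] \<and> hd x = CHR ''#''"

lemma ex_rsv: "finite A \<Longrightarrow> \<exists>y. rsv y \<and> y \<notin> A"
proof -
  assume "finite A"
  moreover have "infinite (range (\<lambda>n. replicate (Suc n) (CHR ''#'')))"
  proof
    assume "finite (range (\<lambda>n. replicate (Suc n) (CHR ''#'')))"
    then have "finite (length ` range (\<lambda>n. replicate (Suc n) (CHR ''#'')))" by (rule finite_imageI)
    moreover have "length ` range (\<lambda>n. replicate (Suc n) (CHR ''#'')) = range Suc"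
      by (auto simp: image_image simp del: replicate_Suc)
    ultimately show False using finite_imageD[of Suc UNIV] by simp
  qed
  ultimately obtain n where "replicate (Suc n) (CHR ''#'') \<notin> A"
    by (metis (no_types, lifting) finite_subset image_subsetI)
  then show ?thesis by (intro exI[of _ "replicate (Suc n) (CHR ''#'')"]) (auto simp: rsv_def)
qed

definition clean :: "fm \<Rightarrow> bool" where
  "clean \<phi> \<longleftrightarrow> (\<forall>x\<in>bn \<phi>. \<not> rsv x)"

instance ty :: countable by countable_datatype
instance tm :: countable by countable_datatype
instance fm :: countable by countable_datatype

definition con :: "fm set \<Rightarrow> fm set \<Rightarrow> bool" where
  "con T \<Gamma> \<longleftrightarrow> \<not> ded T \<Gamma> \<^bold>\<bottom>"

definition wit :: "fm set \<Rightarrow> fm \<Rightarrow> string" where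
  "wit \<Gamma> \<phi> = (SOME y. rsv y \<and> y \<notin> bn \<phi> \<and> (\<forall>\<gamma>\<in>insert \<phi> \<Gamma>. \<forall>\<tau>. (y, \<tau>) \<notin> fv \<gamma>))"

lemma wit:
  assumes "finite \<Gamma>"
  shows "rsv (wit \<Gamma> \<phi>)" "wit \<Gamma> \<phi> \<notin> bn \<phi>" "\<gamma> \<in> insert \<phi> \<Gamma> \<Longrightarrow> (wit \<Gamma> \<phi>, \<tau>) \<notin> fv \<gamma>"
proof -
  have "finite (bn \<phi> \<union> (\<Union>\<gamma>\<in>insert \<phi> \<Gamma>. fst ` fv \<gamma>))"
    using assms by (auto simp: finite_bn finite_fv)
  from ex_rsv[OF this] have "\<exists>y. rsv y \<and> y \<notin> bn \<phi> \<and> (\<forall>\<gamma>\<in>insert \<phi> \<Gamma>. \<forall>\<tau>. (y, \<tau>) \<notin> fv \<gamma>)"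
    by (metis (no_types, lifting) UN_I Un_iff fst_conv image_eqI)
  from someI_ex[OF this, folded wit_def]
  show "rsv (wit \<Gamma> \<phi>)" "wit \<Gamma> \<phi> \<notin> bn \<phi>" "\<gamma> \<in> insert \<phi> \<Gamma> \<Longrightarrow> (wit \<Gamma> \<phi>, \<tau>) \<notin> fv \<gamma>" by blast+
qed

text \<open>A universal formula that cannot be added consistently is refuted on the spot by an
  instance at a fresh reserved variable, so one chain produces maximality and witnesses together.
  The stages stay finite, so fresh names never run out.\<close>

fun hstep :: "fm set \<Rightarrow> fm set \<Rightarrow> fm \<Rightarrow> fm set" where
  "hstep T \<Gamma> (\<^bold>\<forall>x\<^bold>:\<tau>. \<phi>) = (if \<not> wff \<phi> then \<Gamma>
     else if con T (insert (\<^bold>\<forall>x\<^bold>:\<tau>. \<phi>) \<Gamma>) then insert (\<^bold>\<forall>x\<^bold>:\<tau>. \<phi>) \<Gamma>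
     else insert (\<^bold>\<not> subst x \<tau> (Var (wit \<Gamma> (\<^bold>\<forall>x\<^bold>:\<tau>. \<phi>)) \<tau>) \<phi>) \<Gamma>)"
| "hstep T \<Gamma> \<phi> = (if wff \<phi> \<and> con T (insert \<phi> \<Gamma>) then insert \<phi> \<Gamma> else \<Gamma>)"

primrec hchain :: "fm set \<Rightarrow> fm \<Rightarrow> nat \<Rightarrow> fm set" where
  "hchain T g 0 = {\<^bold>\<not> g}"
| "hchain T g (Suc n) = hstep T (hchain T g n) (from_nat n)"

definition hset :: "fm set \<Rightarrow> fm \<Rightarrow> fm set" where
  "hset T g = (\<Union>n. hchain T g n)"

context
  fixes T :: "fm set" and g :: fm
  assumes T_wff: "\<forall>\<phi>\<in>T. wff \<phi>" and g: "wff g" "\<not> (T \<^bold>\<turnstile> g)"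
begin

text \<open>If the counterexample at the fresh variable were inconsistent with \<Gamma>, its
  instance would be derivable; generalising over that variable and renaming it back gives the
  universal formula, which \<Gamma> refutes.\<close>

lemma con_wit:
  assumes fin: "finite \<Gamma>" and w: "\<And>\<gamma>. \<gamma> \<in> \<Gamma> \<Longrightarrow> wff \<gamma>" and con: "con T \<Gamma>" and \<phi>: "wff \<phi>"
    and ncon: "\<not> con T (insert (\<^bold>\<forall>x\<^bold>:\<tau>. \<phi>) \<Gamma>)"
  shows "con T (insert (\<^bold>\<not> subst x \<tau> (Var (wit \<Gamma> (\<^bold>\<forall>x\<^bold>:\<tau>. \<phi>)) \<tau>) \<phi>) \<Gamma>)"
proof (rule ccontr)
  let ?y = "wit \<Gamma> (\<^bold>\<forall>x\<^bold>:\<tau>. \<phi>)"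
  let ?\<psi> = "subst x \<tau> (Var ?y \<tau>) \<phi>"
  note y = wit[OF fin, where \<phi> = "\<^bold>\<forall>x\<^bold>:\<tau>. \<phi>"]
  have yx: "?y \<noteq> x" and yb: "?y \<notin> bn \<phi>" using y(2) by auto
  have yf: "(?y, \<tau>) \<notin> fv \<phi>" using y(3)[of "\<^bold>\<forall>x\<^bold>:\<tau>. \<phi>" \<tau>] yx by auto
  have w\<psi>: "wff ?\<psi>" using \<phi> wff_subst by simp
  assume "\<not> ?thesis"
  then have "ded T (insert (\<^bold>\<not> ?\<psi>) \<Gamma>) \<^bold>\<bottom>" by (simp add: con_def)
  then have "ded T \<Gamma> ?\<psi>" using ded_contr[OF T_wff _ w\<psi>] w by simp
  then have 1: "ded T \<Gamma> (\<^bold>\<forall>?y\<^bold>:\<tau>. ?\<psi>)" by (rule ded_gen[OF T_wff]) (use w y(3) in auto)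
  have "T \<^bold>\<turnstile> (\<^bold>\<forall>?y\<^bold>:\<tau>. ?\<psi>) \<^bold>\<longrightarrow> \<phi>"
    using all_inst[of ?\<psi> "Var x \<tau>" \<tau> ?y T] w\<psi> free_for_swap[OF yb yf] subst_swap[OF yb yf] by simp
  then have "T \<^bold>\<turnstile> (\<^bold>\<forall>x\<^bold>:\<tau>. (\<^bold>\<forall>?y\<^bold>:\<tau>. ?\<psi>) \<^bold>\<longrightarrow> \<phi>)" by (rule gen)
  then have "T \<^bold>\<turnstile> (\<^bold>\<forall>?y\<^bold>:\<tau>. ?\<psi>) \<^bold>\<longrightarrow> (\<^bold>\<forall>x\<^bold>:\<tau>. \<phi>)"
    using all_imp[of "\<^bold>\<forall>?y\<^bold>:\<tau>. ?\<psi>" \<phi> x \<tau> T] w\<psi> \<phi> fv_subst_Var[OF yx yb] by (auto intro: proves.mp)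
  then have 2: "ded T \<Gamma> (\<^bold>\<forall>x\<^bold>:\<tau>. \<phi>)" using 1 by (blast intro: ded.intros)
  have "ded T \<Gamma> (\<^bold>\<not> (\<^bold>\<forall>x\<^bold>:\<tau>. \<phi>))"
    using ncon deduction[OF T_wff] \<phi> w unfolding con_def by auto
  then show False using 2 con unfolding con_def by (blast intro: ded.intros)
qed

lemma hstep_props:
  assumes fin: "finite \<Gamma>" and w: "\<And>\<gamma>. \<gamma> \<in> \<Gamma> \<Longrightarrow> wff \<gamma>" and con: "con T \<Gamma>"
  shows "finite (hstep T \<Gamma> \<phi>)" "\<And>\<gamma>. \<gamma> \<in> hstep T \<Gamma> \<phi> \<Longrightarrow> wff \<gamma>" "con T (hstep T \<Gamma> \<phi>)"
    "\<Gamma> \<subseteq> hstep T \<Gamma> \<phi>"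
    "wff \<phi> \<Longrightarrow> \<phi> \<in> hstep T \<Gamma> \<phi> \<or> \<not> con T (insert \<phi> \<Gamma>)"
  using assms con_wit[OF assms] by (cases \<phi>; auto simp: wff_subst split: if_splits)+

lemma hchain_props:
  "finite (hchain T g n) \<and> (\<forall>\<gamma>\<in>hchain T g n. wff \<gamma>) \<and> con T (hchain T g n)"
proof (induction n)
  case 0
  have "con T {\<^bold>\<not> g}"
    unfolding con_def using ded_contr[OF T_wff, where \<phi> = g and \<Gamma> = "{}"] g ded_empty by auto
  then show ?case using g by simp
next
  case (Suc n)
  then have *: "finite (hchain T g n)" "\<And>\<gamma>. \<gamma> \<in> hchain T g n \<Longrightarrow> wff \<gamma>" "con T (hchain T g n)" by auto
  show ?case
    using hstep_props(1)[OF *, where \<phi> = "from_nat n"] hstep_props(2)[OF *, where \<phi> = "from_nat n"]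
      hstep_props(3)[OF *, where \<phi> = "from_nat n"] by simp
qed

lemma hchain_mono: "m \<le> n \<Longrightarrow> hchain T g m \<subseteq> hchain T g n"
proof (rule lift_Suc_mono_le[of "hchain T g"])
  fix n show "hchain T g n \<subseteq> hchain T g (Suc n)"
    using hstep_props(4)[of "hchain T g n"] hchain_props[of n] by simp
qed

lemma hset_wff: "\<gamma> \<in> hset T g \<Longrightarrow> wff \<gamma>"
  using hchain_props unfolding hset_def by blast

lemma hset_con: "\<not> ded T (hset T g) \<^bold>\<bottom>"
proof
  assume "ded T (hset T g) \<^bold>\<bottom>"
  then obtain n where "ded T (hchain T g n) \<^bold>\<bottom>"
    using ded_chain hchain_mono unfolding hset_def by blast
  then show False using hchain_props con_def by blast
qed

text \<open>Truth is derivability from the limit set rather than membership, so that closure under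
  \<open>mp\<close> is immediate.\<close>

definition HP :: "fm \<Rightarrow> bool" where
  "HP \<phi> = ded T (hset T g) \<phi>"

lemma hchain_hset: "hchain T g n \<subseteq> hset T g"
  unfolding hset_def by blast

lemma HP_or: "wff \<phi> \<Longrightarrow> HP \<phi> \<or> HP (\<^bold>\<not> \<phi>)"
proof -
  assume w: "wff \<phi>"
  obtain n where n: "\<phi> = from_nat n" by (metis from_nat_to_nat)
  show ?thesis
  proof (cases "\<phi> \<in> hchain T g (Suc n)")
    case True
    then show ?thesis using hchain_hset HP_def ded.hyp by blast
  next
    case False
    then have "\<not> con T (insert \<phi> (hchain T g n))"
      using hstep_props(5)[of "hchain T g n" \<phi>] hchain_props[of n] w n by auto
    then have "ded T (hchain T g n) (\<^bold>\<not> \<phi>)"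
      using deduction[OF T_wff] w hchain_props[of n] unfolding con_def by blast
    then show ?thesis using ded_mono hchain_hset HP_def by blast
  qed
qed

lemma HP_bot: "\<not> HP \<^bold>\<bottom>"
  using hset_con HP_def by simp

lemma HP_mp: "HP (\<phi> \<^bold>\<longrightarrow> \<psi>) \<Longrightarrow> HP \<phi> \<Longrightarrow> HP \<psi>"
  unfolding HP_def by (rule ded.mp)

lemma HP_thm: "T \<^bold>\<turnstile> \<phi> \<Longrightarrow> HP \<phi>"
  unfolding HP_def by (rule ded.prv)

lemma HP_not_g: "\<not> HP g"
proof -
  have "HP (\<^bold>\<not> g)" using hchain_hset[of 0] by (auto simp: HP_def intro: ded.hyp)
  then show ?thesis using HP_mp HP_bot by blast
qed

lemma HP_imp: "wff \<phi> \<Longrightarrow> wff \<psi> \<Longrightarrow> HP (\<phi> \<^bold>\<longrightarrow> \<psi>) \<longleftrightarrow> (HP \<phi> \<longrightarrow> HP \<psi>)"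
proof
  assume w: "wff \<phi>" "wff \<psi>" and i: "HP \<phi> \<longrightarrow> HP \<psi>"
  show "HP (\<phi> \<^bold>\<longrightarrow> \<psi>)"
  proof (cases "HP \<phi>")
    case True
    then show ?thesis using i imp_K[of \<psi> \<phi> T] w HP_thm HP_mp by blast
  next
    case False
    then have "HP (\<^bold>\<not> \<phi>)" using HP_or w by blast
    then have "ded T (insert \<phi> (hset T g)) \<^bold>\<bottom>"
      unfolding HP_def by (meson ded.hyp ded.mp ded_mono insertI1 subset_insertI)
    then have "ded T (insert \<phi> (hset T g)) \<psi>"
      using ded_explode[OF T_wff] w hset_wff by blast
    then show ?thesis unfolding HP_def using deduction[OF T_wff] w hset_wff by blast
  qed
qed (use HP_mp in blast)

lemma HP_all_inst:
  "HP (\<^bold>\<forall>x\<^bold>:\<tau>. \<phi>) \<Longrightarrow> wff \<phi> \<Longrightarrow> wt u \<Longrightarrow> typ_of u = \<tau> \<Longrightarrow> free_for u x \<tau> \<phi> \<Longrightarrow> HP (subst x \<tau> u \<phi>)"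
  using all_inst HP_thm HP_mp by blast

text \<open>The formula has an index in the enumeration; at that stage it was not added, so its
  counterexample was.\<close>

lemma HP_witness:
  assumes "\<not> HP (\<^bold>\<forall>x\<^bold>:\<tau>. \<phi>)" "wff \<phi>"
  shows "\<exists>y. rsv y \<and> \<not> HP (subst x \<tau> (Var y \<tau>) \<phi>)"
proof -
  obtain n where n: "(\<^bold>\<forall>x\<^bold>:\<tau>. \<phi>) = from_nat n" by (metis from_nat_to_nat)
  let ?\<Gamma> = "hchain T g n" and ?\<phi> = "\<^bold>\<forall>x\<^bold>:\<tau>. \<phi>"
  have "hchain T g (Suc n) = hstep T ?\<Gamma> ?\<phi>" using n by simp
  moreover have "?\<phi> \<notin> hchain T g (Suc n)" using assms hchain_hset HP_def ded.hyp by blast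
  ultimately have "(\<^bold>\<not> subst x \<tau> (Var (wit ?\<Gamma> ?\<phi>) \<tau>) \<phi>) \<in> hchain T g (Suc n)"
    using assms(2) by (auto split: if_splits)
  then have "HP (\<^bold>\<not> subst x \<tau> (Var (wit ?\<Gamma> ?\<phi>) \<tau>) \<phi>)"
    using hchain_hset HP_def ded.hyp by blast
  then have "\<not> HP (subst x \<tau> (Var (wit ?\<Gamma> ?\<phi>) \<tau>) \<phi>)" using HP_mp HP_bot by blast
  then show ?thesis using wit(1) hchain_props by blast
qed

end

section \<open>The term model\<close>

definition TD :: "ty \<Rightarrow> tm set" where
  "TD \<tau> = {u. wt u \<and> typ_of u = \<tau> \<and> (\<forall>x \<sigma>. (x, \<sigma>) \<in> fvt u \<longrightarrow> rsv x)}"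

primrec sst :: "tm env \<Rightarrow> tm \<Rightarrow> tm" where
  "sst \<rho> (Var x \<tau>) = \<rho> (x, \<tau>)"
| "sst \<rho> ZeroC = ZeroC"
| "sst \<rho> SucC = SucC"
| "sst \<rho> (KC \<sigma> \<tau>) = KC \<sigma> \<tau>"
| "sst \<rho> (SC \<delta> \<sigma> \<tau>) = SC \<delta> \<sigma> \<tau>"
| "sst \<rho> RecC = RecC"
| "sst \<rho> (SeqC \<tau>) = SeqC \<tau>"
| "sst \<rho> (LenC \<tau>) = LenC \<tau>"
| "sst \<rho> (EntC \<tau>) = EntC \<tau>"
| "sst \<rho> (s \<cdot> t) = sst \<rho> s \<cdot> sst \<rho> t"

primrec ssub :: "tm env \<Rightarrow> fm \<Rightarrow> fm" where
  "ssub \<rho> (s \<^bold>= t) = (sst \<rho> s \<^bold>= sst \<rho> t)"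
| "ssub \<rho> \<^bold>\<bottom> = \<^bold>\<bottom>"
| "ssub \<rho> (\<phi> \<^bold>\<longrightarrow> \<psi>) = (ssub \<rho> \<phi> \<^bold>\<longrightarrow> ssub \<rho> \<psi>)"
| "ssub \<rho> (\<^bold>\<forall>x\<^bold>:\<tau>. \<phi>) = (\<^bold>\<forall>x\<^bold>:\<tau>. ssub (upd \<rho> x \<tau> (Var x \<tau>)) \<phi>)"

lemma sst_id: "(\<And>x \<tau>. (x, \<tau>) \<in> fvt t \<Longrightarrow> \<rho> (x, \<tau>) = Var x \<tau>) \<Longrightarrow> sst \<rho> t = t"
  by (induction t) auto

lemma ssub_id: "(\<And>x \<tau>. (x, \<tau>) \<in> fv \<phi> \<Longrightarrow> \<rho> (x, \<tau>) = Var x \<tau>) \<Longrightarrow> ssub \<rho> \<phi> = \<phi>"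
proof (induction \<phi> arbitrary: \<rho>)
  case (Eq0 s t)
  then show ?case using sst_id[of s \<rho>] sst_id[of t \<rho>] by simp
qed auto

lemma bn_ssub: "bn (ssub \<rho> \<phi>) = bn \<phi>"
  by (induction \<phi> arbitrary: \<rho>) auto

definition typed :: "tm env \<Rightarrow> bool" where
  "typed \<rho> \<longleftrightarrow> (\<forall>x \<tau>. wt (\<rho> (x, \<tau>)) \<and> typ_of (\<rho> (x, \<tau>)) = \<tau>)"

lemma typed_upd: "typed \<rho> \<Longrightarrow> wt a \<Longrightarrow> typ_of a = \<tau> \<Longrightarrow> typed (upd \<rho> x \<tau> a)"
  by (simp add: typed_def)

lemma wt_sst:
  assumes "typed \<rho>"
  shows "wt t \<Longrightarrow> wt (sst \<rho> t) \<and> typ_of (sst \<rho> t) = typ_of t"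
proof (induction t)
  case (App s t)
  from App.prems show ?case by (rule wt_AppE) (use App.IH in simp)
qed (use assms in \<open>simp_all add: typed_def\<close>)

lemma wff_ssub: "wff \<phi> \<Longrightarrow> typed \<rho> \<Longrightarrow> wff (ssub \<rho> \<phi>)"
proof (induction \<phi> arbitrary: \<rho>)
  case (FAll x \<tau> \<phi>)
  then show ?case using typed_upd[of \<rho> "Var x \<tau>" \<tau> x] by simp
qed (simp_all add: wt_sst)

lemma substt_sst:
  "\<rho> (x, \<tau>) = Var x \<tau> \<Longrightarrow> (\<And>p. p \<in> fvt t \<Longrightarrow> p \<noteq> (x, \<tau>) \<Longrightarrow> (x, \<tau>) \<notin> fvt (\<rho> p)) \<Longrightarrow>
    substt x \<tau> a (sst \<rho> t) = sst (upd \<rho> x \<tau> a) t"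
proof (induction t)
  case (Var y \<sigma>)
  have "substt x \<tau> a u = u" if "(x, \<tau>) \<notin> fvt u" for u
    using that by (induction u) auto
  with Var show ?case by auto
qed auto

lemma subst_ssub:
  "\<rho> (x, \<tau>) = Var x \<tau> \<Longrightarrow> (\<And>p. p \<in> fv \<phi> \<Longrightarrow> p \<noteq> (x, \<tau>) \<Longrightarrow> (x, \<tau>) \<notin> fvt (\<rho> p)) \<Longrightarrow>
    subst x \<tau> a (ssub \<rho> \<phi>) = ssub (upd \<rho> x \<tau> a) \<phi>"
proof (induction \<phi> arbitrary: \<rho>)
  case (FAll y \<sigma> \<phi>)
  show ?case
  proof (cases "y = x \<and> \<sigma> = \<tau>")
    case False
    have "subst x \<tau> a (ssub (upd \<rho> y \<sigma> (Var y \<sigma>)) \<phi>) = ssub (upd (upd \<rho> y \<sigma> (Var y \<sigma>)) x \<tau> a) \<phi>"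
      by (rule FAll.IH) (use FAll.prems False in \<open>auto simp: upd_apply'\<close>)
    then show ?thesis using False by (auto simp: upd_twist)
  qed simp
qed (auto simp: substt_sst)

primrec aclose :: "(string \<times> ty) list \<Rightarrow> fm \<Rightarrow> fm" where
  "aclose [] \<phi> = \<phi>"
| "aclose (p # ps) \<phi> = FAll (fst p) (snd p) (aclose ps \<phi>)"

lemma fv_aclose: "fv (aclose ps \<phi>) = fv \<phi> - set ps"
  by (induction ps) auto

lemma bn_aclose: "bn (aclose ps \<phi>) = bn \<phi> \<union> fst ` set ps"
  by (induction ps) auto

lemma proves_aclose: "T \<^bold>\<turnstile> \<phi> \<Longrightarrow> T \<^bold>\<turnstile> aclose ps \<phi>"
  by (induction ps) (auto intro: gen)

lemma (in struct) sat_aclose: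
  "(\<And>\<rho>. ok \<rho> \<Longrightarrow> sat \<rho> (aclose ps \<phi>)) \<Longrightarrow> ok \<rho> \<Longrightarrow> sat \<rho> \<phi>"
proof (induction ps arbitrary: \<rho>)
  case (Cons p ps)
  have "sat \<rho> (aclose ps \<phi>)" if "ok \<rho>" for \<rho>
  proof -
    have "sat (upd \<rho> (fst p) (snd p) (\<rho> p)) (aclose ps \<phi>)"
      using Cons.prems(1)[OF that] that ok_D[OF that, of "fst p" "snd p"] by simp
    moreover have "upd \<rho> (fst p) (snd p) (\<rho> p) = \<rho>" by (auto simp: upd_def)
    ultimately show ?thesis by simp
  qed
  then show ?case using Cons by blast
qed simp

lemma struct_TD: "struct TD (\<cdot>) (\<lambda>c. c)"
proof
  fix a b \<sigma> \<tau> assume "a \<in> TD (\<sigma> \<rightarrow> \<tau>)" "b \<in> TD \<sigma>"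
  then show "a \<cdot> b \<in> TD \<tau>" by (auto simp: TD_def)
next
  fix c assume "is_cst c"
  then show "c \<in> TD (typ_of c)" by (cases c) (auto simp: TD_def)
qed

text \<open>Domain elements contain only reserved variables, while the bound names of a clean
  formula are unreserved; hence substituting them never captures. \<open>E\<close> is equality
  derivable from the limit set.\<close>

lemma henkin:
  assumes T_wff: "\<forall>\<phi>\<in>T. wff \<phi>" and g: "wff g" "fv g = {}" "clean g" "\<not> (T \<^bold>\<turnstile> g)"
  obtains E where "\<And>\<rho>. struct.ok TD \<rho> \<Longrightarrow> \<not> struct.sat TD (\<cdot>) (\<lambda>c. c) E \<rho> g"
    and "\<And>\<phi> \<rho>. T \<^bold>\<turnstile> \<phi> \<Longrightarrow> clean \<phi> \<Longrightarrow> (\<And>x \<tau>. (x, \<tau>) \<in> fv \<phi> \<Longrightarrow> \<not> rsv x) \<Longrightarrow> struct.ok TD \<rho> \<Longrightarrow>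
      struct.sat TD (\<cdot>) (\<lambda>c. c) E \<rho> \<phi>"
proof -
  note P = HP_bot[OF T_wff g(1,4)] HP_imp[OF T_wff g(1,4)]
    HP_all_inst[OF T_wff g(1,4)] HP_witness[OF T_wff g(1,4)]
    HP_thm[OF T_wff g(1,4)] HP_not_g[OF T_wff g(1,4)]
  define P where "P = HP T g"
  define E where "E = (\<lambda>s t. P (s \<^bold>= t))"
  interpret struct TD "(\<cdot>)" "\<lambda>c. c" E by (rule struct_TD)
  have ev: "ev \<rho> t = sst \<rho> t" for \<rho> t by (induction t) auto
  have okt: "typed \<rho>" if "ok \<rho>" for \<rho>
    using ok_D[OF that] by (auto simp: TD_def typed_def)
  \<comment> \<open>The truth lemma: with \<rho> read as a simultaneous substitution, truth is
    derivability of the substituted formula.\<close>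
  have truth: "sat \<rho> \<phi> \<longleftrightarrow> P (ssub \<rho> \<phi>)" if "ok \<rho>" "wff \<phi>" "clean \<phi>" for \<rho> \<phi>
    using that
  proof (induction \<phi> arbitrary: \<rho>)
    case (Eq0 s t \<rho>)
    have "sat \<rho> (s \<^bold>= t) = E (sst \<rho> s) (sst \<rho> t)" by (simp add: ev)
    then show ?case by (simp add: E_def)
  next
    case Fls
    then show ?case using P(1) P_def by simp
  next
    case (FImp \<phi> \<psi> \<rho>)
    then have w: "wff (ssub \<rho> \<phi>)" "wff (ssub \<rho> \<psi>)" using wff_ssub[OF _ okt[OF FImp.prems(1)]] by auto
    have "clean \<phi>" "clean \<psi>" using FImp.prems by (auto simp: clean_def)
    then have "sat \<rho> \<phi> = P (ssub \<rho> \<phi>)" "sat \<rho> \<psi> = P (ssub \<rho> \<psi>)" using FImp by auto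
    then show ?case using P(2)[OF w] by (simp add: P_def)
  next
    case (FAll x \<tau> \<phi> \<rho>)
    let ?\<psi> = "ssub (upd \<rho> x \<tau> (Var x \<tau>)) \<phi>"
    have x: "\<not> rsv x" and cl: "clean \<phi>" using FAll.prems by (auto simp: clean_def)
    have w: "wff ?\<psi>" using FAll.prems(2) okt[OF FAll.prems(1)] by (intro wff_ssub typed_upd) auto
    have sub: "subst x \<tau> a ?\<psi> = ssub (upd \<rho> x \<tau> a) \<phi>" for a
    proof -
      have "(x, \<tau>) \<notin> fvt (upd \<rho> x \<tau> (Var x \<tau>) p)" if "p \<noteq> (x, \<tau>)" for p
        using that ok_D[OF FAll.prems(1), of "fst p" "snd p"] x by (auto simp: upd_apply' TD_def)
      then show ?thesis by (subst subst_ssub) auto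
    qed
    have "sat \<rho> (\<^bold>\<forall>x\<^bold>:\<tau>. \<phi>) \<longleftrightarrow> (\<forall>a\<in>TD \<tau>. P (subst x \<tau> a ?\<psi>))"
      using FAll.IH[OF _ _ cl] FAll.prems by (simp add: sub)
    also have "\<dots> \<longleftrightarrow> P (\<^bold>\<forall>x\<^bold>:\<tau>. ?\<psi>)"
    proof
      assume all: "P (\<^bold>\<forall>x\<^bold>:\<tau>. ?\<psi>)"
      show "\<forall>a\<in>TD \<tau>. P (subst x \<tau> a ?\<psi>)"
      proof
        fix a assume a: "a \<in> TD \<tau>"
        have "free_for a x \<tau> ?\<psi>"
          by (rule free_for_bn) (use a cl in \<open>auto simp: TD_def bn_ssub clean_def\<close>)
        then show "P (subst x \<tau> a ?\<psi>)" using P(3) a all w by (auto simp: TD_def P_def)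
      qed
    next
      assume all: "\<forall>a\<in>TD \<tau>. P (subst x \<tau> a ?\<psi>)"
      show "P (\<^bold>\<forall>x\<^bold>:\<tau>. ?\<psi>)"
      proof (rule ccontr)
        assume "\<not> P (\<^bold>\<forall>x\<^bold>:\<tau>. ?\<psi>)"
        then obtain y where "rsv y" "\<not> P (subst x \<tau> (Var y \<tau>) ?\<psi>)" using P(4) w P_def by blast
        moreover have "Var y \<tau> \<in> TD \<tau>" using \<open>rsv y\<close> by (auto simp: TD_def)
        ultimately show False using all by blast
      qed
    qed
    finally show ?case by simp
  qed
  show thesis
  proof
    fix \<rho> assume "ok \<rho>"
    then show "\<not> sat \<rho> g" using truth[of \<rho> g] g P(6) ssub_id[of g \<rho>] P_def by simp
  next
    fix \<phi> \<rho> assume \<phi>: "T \<^bold>\<turnstile> \<phi>" "clean \<phi>" "\<And>x \<tau>. (x, \<tau>) \<in> fv \<phi> \<Longrightarrow> \<not> rsv x" and \<rho>: "ok \<rho>"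
    \<comment> \<open>The truth lemma evaluates free variables by \<rho>, whereas a theorem with
      free variables speaks of the variables themselves; the universal closure reconciles the
      two.\<close>
    obtain ps where ps: "set ps = fv \<phi>" using finite_list[OF finite_fv[of \<phi>]] by blast
    have "T \<^bold>\<turnstile> aclose ps \<phi>" by (rule proves_aclose) fact
    then have "P (aclose ps \<phi>)" "wff (aclose ps \<phi>)" using P(5) P_def proves_wff[of T] T_wff by blast+
    moreover have "clean (aclose ps \<phi>)" "fv (aclose ps \<phi>) = {}"
      using \<phi> ps by (auto simp: clean_def bn_aclose fv_aclose)
    ultimately have "sat \<rho> (aclose ps \<phi>)" if "ok \<rho>" for \<rho>
      using truth[of \<rho> "aclose ps \<phi>"] ssub_id[of "aclose ps \<phi>" \<rho>] that by simp
    then show "sat \<rho> \<phi>" using sat_aclose \<rho> by blast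
  qed
qed

lemma wff_eqF: "wt s \<Longrightarrow> wt t \<Longrightarrow> typ_of s = \<tau> \<Longrightarrow> typ_of t = \<tau> \<Longrightarrow> wff (eqF \<tau> s t)"
proof -
  have "wt monusC" "typ_of monusC = (N \<rightarrow> N \<rightarrow> N)"
    by (simp_all add: monusC_def predC_def)
  then show "wt s \<Longrightarrow> wt t \<Longrightarrow> typ_of s = \<tau> \<Longrightarrow> typ_of t = \<tau> \<Longrightarrow> wff (eqF \<tau> s t)"
    by (induction \<tau> arbitrary: s t) (auto simp: Let_def)
qed

section \<open>Quotients by extensional equality\<close>

text \<open>\<open>tyof\<close> makes the domains disjoint, so that a representative can be chosen
  from an element alone. \<open>EQ_ext\<close> is the extensionality axiom.\<close>

locale quot = struct +
  fixes tyof :: "'a \<Rightarrow> ty"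
  assumes tyof: "a \<in> D \<tau> \<Longrightarrow> tyof a = \<tau>"
    and E_refl: "a \<in> D N \<Longrightarrow> E a a"
    and E_eucl: "a \<in> D N \<Longrightarrow> b \<in> D N \<Longrightarrow> c \<in> D N \<Longrightarrow> E a b \<Longrightarrow> E a c \<Longrightarrow> E b c"
    and EQ_ext: "f \<in> D (\<sigma> \<rightarrow> \<tau>) \<Longrightarrow> a \<in> D \<sigma> \<Longrightarrow> b \<in> D \<sigma> \<Longrightarrow> EQ \<sigma> a b \<Longrightarrow> EQ \<tau> (f \<bullet> a) (f \<bullet> b)"
    and mon_D: "ev (\<lambda>_. undefined) monusC \<in> D (N \<rightarrow> N \<rightarrow> N)"
begin

lemma E_sym: "a \<in> D N \<Longrightarrow> b \<in> D N \<Longrightarrow> E a b \<Longrightarrow> E b a"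
  using E_eucl[of a b a] E_refl by blast

lemma E_trans: "a \<in> D N \<Longrightarrow> b \<in> D N \<Longrightarrow> c \<in> D N \<Longrightarrow> E a b \<Longrightarrow> E b c \<Longrightarrow> E a c"
  using E_eucl[of b a c] E_sym by blast

definition mon0 :: "'a \<Rightarrow> 'a \<Rightarrow> 'a" where
  "mon0 a b = ev (\<lambda>_. undefined) monusC \<bullet> a \<bullet> b"

lemma mon0_D: "a \<in> D N \<Longrightarrow> b \<in> D N \<Longrightarrow> mon0 a b \<in> D N"
  unfolding mon0_def using ap_D[OF ap_D[OF mon_D]] by simp

text \<open>Equality of sequences tests an index against the length of its left argument only;
  symmetry and transitivity at type \<open>Star \<tau>\<close> need this test moved to an equal
  length.\<close>

lemma mon0_cong:
  assumes "a \<in> D N" "b \<in> D N" "b' \<in> D N" "E b b'" "E (mon0 a b) (cst ZeroC)"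
  shows "E (mon0 a b') (cst ZeroC)"
proof -
  have "ev (\<lambda>_. undefined) monusC \<bullet> a \<in> D (N \<rightarrow> N)" using ap_D[OF mon_D assms(1)] .
  then have "E (mon0 a b) (mon0 a b')" using EQ_ext[of _ N N b b'] assms by (simp add: mon0_def)
  then show ?thesis using E_eucl[of "mon0 a b" "mon0 a b'" "cst ZeroC"] assms mon0_D by simp
qed

lemma seq_D: "s \<in> D (Star \<tau>) \<Longrightarrow> cst (LenC \<tau>) \<bullet> s \<in> D N"
  "s \<in> D (Star \<tau>) \<Longrightarrow> i \<in> D N \<Longrightarrow> cst (EntC \<tau>) \<bullet> s \<bullet> i \<in> D \<tau>"
  "i \<in> D N \<Longrightarrow> cst SucC \<bullet> i \<in> D N"
  using ap_D[OF csts_D(7)] ap_D[OF ap_D[OF csts_D(8)]] ap_D[OF csts_D(2)] by simp_all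

lemma EQ_Star: "EQ (Star \<tau>) a b \<longleftrightarrow> E (cst (LenC \<tau>) \<bullet> a) (cst (LenC \<tau>) \<bullet> b) \<and>
     (\<forall>i\<in>D N. E (mon0 (cst SucC \<bullet> i) (cst (LenC \<tau>) \<bullet> a)) (cst ZeroC) \<longrightarrow>
        EQ \<tau> (cst (EntC \<tau>) \<bullet> a \<bullet> i) (cst (EntC \<tau>) \<bullet> b \<bullet> i))"
  by (simp add: mon0_def)

declare EQ.simps(3) [simp del]

lemma EQ_refl: "a \<in> D \<tau> \<Longrightarrow> EQ \<tau> a a"
proof (induction \<tau> arbitrary: a)
  case (Fn \<sigma> \<tau>)
  then show ?case using ap_D by auto
next
  case (Star \<tau>)
  then show ?case using seq_D E_refl by (auto simp: EQ_Star)
qed (simp add: E_refl)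

lemma EQ_sym: "a \<in> D \<tau> \<Longrightarrow> b \<in> D \<tau> \<Longrightarrow> EQ \<tau> a b \<Longrightarrow> EQ \<tau> b a"
proof (induction \<tau> arbitrary: a b)
  case (Fn \<sigma> \<tau>)
  then show ?case using ap_D by auto
next
  case (Star \<tau>)
  then have l: "E (cst (LenC \<tau>) \<bullet> b) (cst (LenC \<tau>) \<bullet> a)" using seq_D E_sym by (auto simp: EQ_Star)
  show ?case unfolding EQ_Star
  proof (intro conjI ballI impI l)
    fix i assume "i \<in> D N" "E (mon0 (cst SucC \<bullet> i) (cst (LenC \<tau>) \<bullet> b)) (cst ZeroC)"
    then have "E (mon0 (cst SucC \<bullet> i) (cst (LenC \<tau>) \<bullet> a)) (cst ZeroC)"
      using mon0_cong[OF _ _ _ l] Star.prems seq_D by blast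
    then show "EQ \<tau> (cst (EntC \<tau>) \<bullet> b \<bullet> i) (cst (EntC \<tau>) \<bullet> a \<bullet> i)"
      using Star seq_D \<open>i \<in> D N\<close> by (auto simp: EQ_Star)
  qed
qed (simp add: E_sym)

lemma EQ_trans: "a \<in> D \<tau> \<Longrightarrow> b \<in> D \<tau> \<Longrightarrow> c \<in> D \<tau> \<Longrightarrow> EQ \<tau> a b \<Longrightarrow> EQ \<tau> b c \<Longrightarrow> EQ \<tau> a c"
proof (induction \<tau> arbitrary: a b c)
  case (N a b c)
  then show ?case using E_trans[of a b c] by simp
next
  case (Fn \<sigma> \<tau> a b c)
  show ?case unfolding EQ.simps
  proof
    fix x assume x: "x \<in> D \<sigma>"
    show "EQ \<tau> (a \<bullet> x) (c \<bullet> x)"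
      by (rule Fn.IH(2)[of _ "b \<bullet> x"]) (use Fn.prems x ap_D in auto)
  qed
next
  case (Star \<tau> a b c)
  then have l: "E (cst (LenC \<tau>) \<bullet> a) (cst (LenC \<tau>) \<bullet> b)" "E (cst (LenC \<tau>) \<bullet> b) (cst (LenC \<tau>) \<bullet> c)"
    by (auto simp: EQ_Star)
  then have l': "E (cst (LenC \<tau>) \<bullet> a) (cst (LenC \<tau>) \<bullet> c)"
    using E_trans[OF _ _ _ l] Star.prems seq_D(1) by simp
  show ?case unfolding EQ_Star
  proof (intro conjI ballI impI l')
    fix i assume i: "i \<in> D N" "E (mon0 (cst SucC \<bullet> i) (cst (LenC \<tau>) \<bullet> a)) (cst ZeroC)"
    then have "E (mon0 (cst SucC \<bullet> i) (cst (LenC \<tau>) \<bullet> b)) (cst ZeroC)"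
      using mon0_cong[OF _ _ _ l(1)] Star.prems seq_D by blast
    then have "EQ \<tau> (cst (EntC \<tau>) \<bullet> a \<bullet> i) (cst (EntC \<tau>) \<bullet> b \<bullet> i)"
      "EQ \<tau> (cst (EntC \<tau>) \<bullet> b \<bullet> i) (cst (EntC \<tau>) \<bullet> c \<bullet> i)"
      using i Star.prems(4,5) by (auto simp: EQ_Star)
    then show "EQ \<tau> (cst (EntC \<tau>) \<bullet> a \<bullet> i) (cst (EntC \<tau>) \<bullet> c \<bullet> i)"
      using Star.IH Star.prems seq_D(2) i(1) by blast
  qed
qed

lemma EQ_ap:
  assumes "f \<in> D (\<sigma> \<rightarrow> \<tau>)" "g \<in> D (\<sigma> \<rightarrow> \<tau>)" "a \<in> D \<sigma>" "b \<in> D \<sigma>" "EQ (\<sigma> \<rightarrow> \<tau>) f g" "EQ \<sigma> a b"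
  shows "EQ \<tau> (f \<bullet> a) (g \<bullet> b)"
proof (rule EQ_trans)
  show "EQ \<tau> (f \<bullet> a) (g \<bullet> a)" using assms by simp
  show "EQ \<tau> (g \<bullet> a) (g \<bullet> b)" using EQ_ext assms by blast
qed (use assms ap_D[of f \<sigma> \<tau> a] ap_D[of g \<sigma> \<tau> a] ap_D[of g \<sigma> \<tau> b] in simp_all)

text \<open>A chosen representative in place of the class keeps the quotient inside the same type of
  elements. Equivalent elements yield the same predicate under \<open>SOME\<close>, hence the same
  representative.\<close>

definition rep :: "'a \<Rightarrow> 'a" where
  "rep a = (SOME b. b \<in> D (tyof a) \<and> EQ (tyof a) a b)"

lemma rep: assumes "a \<in> D \<tau>" shows "rep a \<in> D \<tau>" "EQ \<tau> a (rep a)"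
  using someI[of "\<lambda>b. b \<in> D (tyof a) \<and> EQ (tyof a) a b" a] assms EQ_refl[OF assms] tyof[OF assms]
  by (auto simp: rep_def)

lemma rep_eq: assumes "a \<in> D \<tau>" "b \<in> D \<tau>" shows "rep a = rep b \<longleftrightarrow> EQ \<tau> a b"
proof
  assume "rep a = rep b"
  then show "EQ \<tau> a b" using rep[OF assms(1)] rep[OF assms(2)] EQ_trans EQ_sym assms by metis
next
  assume "EQ \<tau> a b"
  then have "(\<lambda>c. c \<in> D \<tau> \<and> EQ \<tau> a c) = (\<lambda>c. c \<in> D \<tau> \<and> EQ \<tau> b c)"
    using EQ_trans[OF assms] EQ_trans[OF assms(2,1)] EQ_sym[OF assms] by blast
  then show "rep a = rep b" using tyof assms by (simp add: rep_def)
qed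

lemma rep_rep: "a \<in> D \<tau> \<Longrightarrow> rep (rep a) = rep a"
  using rep_eq[of "rep a" \<tau> a] rep[of a \<tau>] EQ_sym by blast

definition QD :: "ty \<Rightarrow> 'a set" where "QD \<tau> = rep ` D \<tau>"
definition qap :: "'a \<Rightarrow> 'a \<Rightarrow> 'a" where "qap a b = rep (a \<bullet> b)"
definition qcst :: "tm \<Rightarrow> 'a" where "qcst c = rep (cst c)"

lemma QD_D: "a \<in> QD \<tau> \<Longrightarrow> a \<in> D \<tau>" and QD_rep: "a \<in> QD \<tau> \<Longrightarrow> rep a = a"
  using rep rep_rep by (auto simp: QD_def)

lemma qap_rep:
  assumes "f \<in> D (\<sigma> \<rightarrow> \<tau>)" "a \<in> D \<sigma>"
  shows "qap (rep f) (rep a) = rep (f \<bullet> a)"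
proof -
  have "EQ \<tau> (rep f \<bullet> rep a) (f \<bullet> a)"
    by (rule EQ_ap[of _ \<sigma>]) (use assms rep[OF assms(1)] rep[OF assms(2)] EQ_sym in blast)+
  then show ?thesis unfolding qap_def
    using rep_eq[of "rep f \<bullet> rep a" \<tau> "f \<bullet> a"] ap_D[of "rep f" \<sigma> \<tau> "rep a"] ap_D[of f \<sigma> \<tau> a]
      assms rep by simp
qed

sublocale Q: struct QD qap qcst "(=)"
proof
  fix a b \<sigma> \<tau> assume "a \<in> QD (\<sigma> \<rightarrow> \<tau>)" "b \<in> QD \<sigma>"
  then have "a \<bullet> b \<in> D \<tau>" using QD_D ap_D by blast
  then show "qap a b \<in> QD \<tau>" by (simp add: qap_def QD_def)
next
  fix c assume "is_cst c"
  then show "qcst c \<in> QD (typ_of c)" using cst_D by (auto simp: qcst_def QD_def)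
qed

lemma Q_ok: "Q.ok \<rho> \<Longrightarrow> ok \<rho>"
  using QD_D by (auto simp: Q.ok_def ok_def QD_def)

lemma Q_ev: "ok \<rho> \<Longrightarrow> wt t \<Longrightarrow> Q.ev (\<lambda>p. rep (\<rho> p)) t = rep (ev \<rho> t)"
proof (induction t)
  case (App s t)
  from App.prems(2) show ?case
  proof (rule wt_AppE)
    fix \<sigma> \<tau> assume st: "wt s" "wt t" "typ_of s = (\<sigma> \<rightarrow> \<tau>)" "typ_of t = \<sigma>"
    then have "ev \<rho> s \<in> D (\<sigma> \<rightarrow> \<tau>)" "ev \<rho> t \<in> D \<sigma>" using App.prems(1) ev_D' by auto
    then show ?thesis using App.IH App.prems(1) st by (simp add: qap_rep)
  qed
qed (auto simp: qcst_def)

lemma Q_sat_rep: "ok \<rho> \<Longrightarrow> wff \<phi> \<Longrightarrow> Q.sat (\<lambda>p. rep (\<rho> p)) \<phi> = sat \<rho> \<phi>"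
proof (induction \<phi> arbitrary: \<rho>)
  case (Eq0 s t \<rho>)
  then have "ev \<rho> s \<in> D N" "ev \<rho> t \<in> D N" using ev_D' by auto
  then show ?case using Eq0 rep_eq[of _ N] by (simp add: Q_ev)
next
  case (FAll x \<tau> \<phi> \<rho>)
  have "Q.sat (upd (\<lambda>p. rep (\<rho> p)) x \<tau> (rep a)) \<phi> = sat (upd \<rho> x \<tau> a) \<phi>" if "a \<in> D \<tau>" for a
  proof -
    have "(\<lambda>p. rep (upd \<rho> x \<tau> a p)) = upd (\<lambda>p. rep (\<rho> p)) x \<tau> (rep a)" by (auto simp: upd_def)
    then show ?thesis using FAll.IH[of "upd \<rho> x \<tau> a"] FAll.prems that by simp
  qed
  moreover have "(\<forall>a\<in>QD \<tau>. R a) = (\<forall>a\<in>D \<tau>. R (rep a))" for R by (auto simp: QD_def)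
  ultimately show ?case by simp
qed auto

lemma Q_sat:
  assumes "Q.ok \<rho>" "wff \<phi>"
  shows "Q.sat \<rho> \<phi> = sat \<rho> \<phi>"
proof -
  have "(\<lambda>p. rep (\<rho> p)) = \<rho>" using QD_rep[OF Q.ok_D[OF assms(1)]] by auto
  then show ?thesis using Q_sat_rep[OF Q_ok[OF assms(1)] assms(2)] by simp
qed

text \<open>Both versions of \<open>EQ\<close> are truth values of the formula \<open>eqF\<close>;
  the transfer of formulas thus turns extensional equality in the quotient into equivalence below,
  and equivalent representatives coincide.\<close>

lemma Q_EQ:
  assumes "a \<in> QD \<tau>" "b \<in> QD \<tau>" "Q.EQ \<tau> a b"
  shows "a = b"
proof -
  let ?\<rho> = "upd (upd Q.dflt ''x'' \<tau> a) ''y'' \<tau> b"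
  let ?\<phi> = "eqF \<tau> (Var ''x'' \<tau>) (Var ''y'' \<tau>)"
  have "Q.sat ?\<rho> ?\<phi> = sat ?\<rho> ?\<phi>"
    by (rule Q_sat) (use assms Q.ok_dflt in \<open>simp_all add: wff_eqF\<close>)
  then have "EQ \<tau> a b" using assms(3) by (simp add: Q.sat_eqF sat_eqF)
  then show ?thesis using rep_eq[of a \<tau> b] QD_D QD_rep assms by metis
qed

end

lemma bn_eqF: "x \<in> bn (eqF \<tau> s t) \<Longrightarrow> \<not> rsv x"
  by (induction \<tau> arbitrary: s t) (auto simp: Let_def fresh_def rsv_def)

lemma clean_eqF: "clean (eqF \<tau> s t)"
  using bn_eqF by (auto simp: clean_def)

lemma fv_eqF: "fv (eqF \<tau> s t) \<subseteq> fvt s \<union> fvt t"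
proof (induction \<tau> arbitrary: s t)
  case (Fn \<sigma> \<tau> s t)
  have "fv (eqF \<tau> (s \<cdot> Var v \<sigma>) (t \<cdot> Var v \<sigma>)) \<subseteq> fvt s \<union> fvt t \<union> {(v, \<sigma>)}" for v
    using Fn.IH(2)[of "s \<cdot> Var v \<sigma>" "t \<cdot> Var v \<sigma>"] by auto
  then show ?case by (auto simp: Let_def)
next
  case (Star \<tau> s t)
  have "fv (eqF \<tau> (EntC \<tau> \<cdot> s \<cdot> Var v N) (EntC \<tau> \<cdot> t \<cdot> Var v N)) \<subseteq> fvt s \<union> fvt t \<union> {(v, N)}" for v
    using Star.IH[of "EntC \<tau> \<cdot> s \<cdot> Var v N" "EntC \<tau> \<cdot> t \<cdot> Var v N"] by auto
  then show ?case by (auto simp: Let_def)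
qed auto

lemma wt_arith [simp]: "wt plusC" "wt predC" "wt monusC" "wt triC" "wt pairC" "wt codeC"
  "typ_of plusC = (N \<rightarrow> N \<rightarrow> N)" "typ_of predC = (N \<rightarrow> N)" "typ_of monusC = (N \<rightarrow> N \<rightarrow> N)"
  "typ_of triC = (N \<rightarrow> N)" "typ_of pairC = (N \<rightarrow> N \<rightarrow> N)" "typ_of codeC = (Star N \<rightarrow> N)"
  by (simp_all add: plusC_def predC_def monusC_def triC_def pairC_def codeC_def)

lemma RCA0_wff: "\<phi> \<in> RCA0_omega \<Longrightarrow> wff \<phi>"
proof -
  have "\<phi> \<in> E_PRA_omega \<Longrightarrow> wff \<phi>"
    by (induction rule: E_PRA_omega.induct) (auto intro!: wff_eqF wff_subst)
  moreover have "\<phi> \<in> QF_AC_1_0 \<Longrightarrow> wff \<phi>"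
    by (induction rule: QF_AC_1_0.induct) (auto intro!: wff_subst)
  ultimately show "\<phi> \<in> RCA0_omega \<Longrightarrow> wff \<phi>" by (auto simp: RCA0_omega_def)
qed

text \<open>Over \<^const>\<open>E_PRA_omega\<close>, equality may be taken to be true equality in all types.\<close>

lemma completeness:
  fixes T :: "fm set"
  assumes T: "\<forall>\<phi>\<in>T. wff \<phi>" "E_PRA_omega \<subseteq> T" and g: "wff g" "fv g = {}" "clean g" "\<not> (T \<^bold>\<turnstile> g)"
  obtains D :: "ty \<Rightarrow> tm set" and ap cst where "struct D ap cst"
    and "\<And>a b \<tau>. a \<in> D \<tau> \<Longrightarrow> b \<in> D \<tau> \<Longrightarrow> struct.EQ D ap cst (=) \<tau> a b \<Longrightarrow> a = b"
    and "\<And>\<rho>. struct.ok D \<rho> \<Longrightarrow> \<not> struct.sat D ap cst (=) \<rho> g"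
    and "\<And>\<phi> \<rho>. T \<^bold>\<turnstile> \<phi> \<Longrightarrow> clean \<phi> \<Longrightarrow> (\<And>x \<tau>. (x, \<tau>) \<in> fv \<phi> \<Longrightarrow> \<not> rsv x) \<Longrightarrow> struct.ok D \<rho> \<Longrightarrow>
      struct.sat D ap cst (=) \<rho> \<phi>"
proof -
  obtain E where E: "\<And>\<rho>. struct.ok TD \<rho> \<Longrightarrow> \<not> struct.sat TD (\<cdot>) (\<lambda>c. c) E \<rho> g"
    "\<And>\<phi> \<rho>. T \<^bold>\<turnstile> \<phi> \<Longrightarrow> clean \<phi> \<Longrightarrow> (\<And>x \<tau>. (x, \<tau>) \<in> fv \<phi> \<Longrightarrow> \<not> rsv x) \<Longrightarrow> struct.ok TD \<rho> \<Longrightarrow>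
      struct.sat TD (\<cdot>) (\<lambda>c. c) E \<rho> \<phi>"
    using henkin[OF T(1) g] by blast
  interpret M: struct TD "(\<cdot>)" "\<lambda>c. c" E by (rule struct_TD)
  let ?z = "\<lambda>p::string \<times> ty. zero_tm (snd p)"
  have okz: "M.ok ?z" by (auto simp: M.ok_def TD_def)
  have ax: "M.sat \<rho> \<phi>" if "\<phi> \<in> E_PRA_omega" "clean \<phi>" "\<And>x \<tau>. (x, \<tau>) \<in> fv \<phi> \<Longrightarrow> \<not> rsv x" "M.ok \<rho>" for \<phi> \<rho>
    using E(2)[OF axiom] that T(2) by blast
  have "quot TD (\<cdot>) (\<lambda>c. c) E typ_of"
  proof
    fix a \<tau> assume "a \<in> TD \<tau>" then show "typ_of a = \<tau>" by (simp add: TD_def)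
  next
    fix a assume "a \<in> TD N"
    then show "E a a"
      using ax[OF eq_refl, of "upd ?z ''x'' N a"] okz by (simp add: clean_def rsv_def)
  next
    fix a b c assume "a \<in> TD N" "b \<in> TD N" "c \<in> TD N" "E a b" "E a c"
    moreover from this have "M.sat (upd (upd (upd ?z ''x'' N a) ''y'' N b) ''z'' N c)
      (n0 ''x'' \<^bold>= n0 ''y'' \<^bold>\<longrightarrow> n0 ''x'' \<^bold>= n0 ''z'' \<^bold>\<longrightarrow> n0 ''y'' \<^bold>= n0 ''z'')"
      using okz by (intro ax[OF eq_eucl]) (auto simp: clean_def rsv_def)
    ultimately show "E b c" by simp
  next
    fix f a b \<sigma> \<tau> assume *: "f \<in> TD (\<sigma> \<rightarrow> \<tau>)" "a \<in> TD \<sigma>" "b \<in> TD \<sigma>" "M.EQ \<sigma> a b"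
    have "M.sat (upd (upd (upd ?z ''x'' \<sigma> a) ''y'' \<sigma> b) ''z'' (\<sigma> \<rightarrow> \<tau>) f)
      (eqF \<sigma> (Var ''x'' \<sigma>) (Var ''y'' \<sigma>) \<^bold>\<longrightarrow>
      eqF \<tau> (Var ''z'' (\<sigma> \<rightarrow> \<tau>) \<cdot> Var ''x'' \<sigma>) (Var ''z'' (\<sigma> \<rightarrow> \<tau>) \<cdot> Var ''y'' \<sigma>))"
    proof (rule ax[OF ext])
      show "clean (eqF \<sigma> (Var ''x'' \<sigma>) (Var ''y'' \<sigma>) \<^bold>\<longrightarrow>
        eqF \<tau> (Var ''z'' (\<sigma> \<rightarrow> \<tau>) \<cdot> Var ''x'' \<sigma>) (Var ''z'' (\<sigma> \<rightarrow> \<tau>) \<cdot> Var ''y'' \<sigma>))"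
        using clean_eqF by (auto simp: clean_def)
    next
      fix x \<upsilon> assume "(x, \<upsilon>) \<in> fv (eqF \<sigma> (Var ''x'' \<sigma>) (Var ''y'' \<sigma>) \<^bold>\<longrightarrow>
        eqF \<tau> (Var ''z'' (\<sigma> \<rightarrow> \<tau>) \<cdot> Var ''x'' \<sigma>) (Var ''z'' (\<sigma> \<rightarrow> \<tau>) \<cdot> Var ''y'' \<sigma>))"
      then have "x \<in> {''x'', ''y'', ''z''}"
        using fv_eqF[of \<sigma> "Var ''x'' \<sigma>" "Var ''y'' \<sigma>"]
          fv_eqF[of \<tau> "Var ''z'' (\<sigma> \<rightarrow> \<tau>) \<cdot> Var ''x'' \<sigma>" "Var ''z'' (\<sigma> \<rightarrow> \<tau>) \<cdot> Var ''y'' \<sigma>"] by auto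
      then show "\<not> rsv x" by (auto simp: rsv_def)
    next
      show "M.ok (upd (upd (upd ?z ''x'' \<sigma> a) ''y'' \<sigma> b) ''z'' (\<sigma> \<rightarrow> \<tau>) f)"
        using okz * by simp
    qed
    then show "M.EQ \<tau> (f \<cdot> a) (f \<cdot> b)" using *(4) by (simp add: M.sat_eqF)
  next
    have "M.ev (\<lambda>_. undefined) monusC = M.ev ?z monusC" by (rule M.ev_cong) simp
    then show "M.ev (\<lambda>_. undefined) monusC \<in> TD (N \<rightarrow> N \<rightarrow> N)"
      using M.ev_D'[of monusC ?z] okz by simp
  qed
  then interpret M: quot TD "(\<cdot>)" "\<lambda>c. c" E typ_of .
  show thesis
  proof
    show "struct M.QD M.qap M.qcst" by (rule M.Q.struct_axioms)
    fix a b \<tau> assume "a \<in> M.QD \<tau>" "b \<in> M.QD \<tau>" "M.Q.EQ \<tau> a b"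
    then show "a = b" by (rule M.Q_EQ)
  next
    fix \<rho> assume "M.Q.ok \<rho>"
    then show "\<not> M.Q.sat \<rho> g" using M.Q_sat E(1) M.Q_ok g(1) by blast
  next
    fix \<phi> \<rho> assume *: "T \<^bold>\<turnstile> \<phi>" "clean \<phi>" "\<And>x \<tau>. (x, \<tau>) \<in> fv \<phi> \<Longrightarrow> \<not> rsv x" "M.Q.ok \<rho>"
    then have "wff \<phi>" using proves_wff T(1) by blast
    then show "M.Q.sat \<rho> \<phi>" using M.Q_sat E(2) M.Q_ok * by blast
  qed
qed

section \<open>Arithmetic in models\<close>

text \<open>Numbers may be nonstandard, so all arithmetic below rests on \<open>induct\<close>, with
  parameters placed in \<rho> and the induction variable always named \<open>''x''\<close>.\<close>

locale arith = comb D ap cst "(=)" for D :: "ty \<Rightarrow> 'a set" and ap (infixl "\<bullet>" 100) and cst +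
  assumes suc_inj: "a \<in> D N \<Longrightarrow> b \<in> D N \<Longrightarrow> cst SucC \<bullet> a = cst SucC \<bullet> b \<Longrightarrow> a = b"
    and suc_nonzero: "a \<in> D N \<Longrightarrow> cst SucC \<bullet> a \<noteq> cst ZeroC"
    and rec_zero: "b \<in> D N \<Longrightarrow> g \<in> D (N \<rightarrow> N \<rightarrow> N) \<Longrightarrow> cst RecC \<bullet> cst ZeroC \<bullet> b \<bullet> g = b"
    and rec_suc: "a \<in> D N \<Longrightarrow> b \<in> D N \<Longrightarrow> g \<in> D (N \<rightarrow> N \<rightarrow> N) \<Longrightarrow>
      cst RecC \<bullet> (cst SucC \<bullet> a) \<bullet> b \<bullet> g = g \<bullet> (cst RecC \<bullet> a \<bullet> b \<bullet> g) \<bullet> a"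
    and induct: "qf \<phi> \<Longrightarrow> wff \<phi> \<Longrightarrow> ok \<rho> \<Longrightarrow> sat (upd \<rho> ''x'' N (cst ZeroC)) \<phi> \<Longrightarrow>
      (\<And>a. a \<in> D N \<Longrightarrow> sat (upd \<rho> ''x'' N a) \<phi> \<Longrightarrow> sat (upd \<rho> ''x'' N (cst SucC \<bullet> a)) \<phi>) \<Longrightarrow>
      a \<in> D N \<Longrightarrow> sat (upd \<rho> ''x'' N a) \<phi>"
begin

abbreviation Z :: 'a where "Z \<equiv> cst ZeroC"
abbreviation S :: "'a \<Rightarrow> 'a" where "S a \<equiv> cst SucC \<bullet> a"

definition "cplus = clo plusC"
definition "cpred = clo predC"
definition "cmon = clo monusC"
definition "ctri = clo triC"
definition "cpair = clo pairC"
definition "ccode = clo codeC"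

abbreviation pl where "pl a b \<equiv> cplus \<bullet> a \<bullet> b"
abbreviation mn where "mn a b \<equiv> cmon \<bullet> a \<bullet> b"
abbreviation le where "le a b \<equiv> cmon \<bullet> a \<bullet> b = cst ZeroC"
abbreviation pr where "pr a b \<equiv> cpair \<bullet> a \<bullet> b"

lemma ev_arith [simp]: "ev \<rho> plusC = cplus" "ev \<rho> predC = cpred" "ev \<rho> monusC = cmon"
  "ev \<rho> triC = ctri" "ev \<rho> pairC = cpair" "ev \<rho> codeC = ccode"
  unfolding cplus_def cpred_def cmon_def ctri_def cpair_def ccode_def by (rule ev_closed, simp)+

declare ev_D' [simp]

lemma carith_D [simp]: "cplus \<in> D (N \<rightarrow> N \<rightarrow> N)" "cpred \<in> D (N \<rightarrow> N)" "cmon \<in> D (N \<rightarrow> N \<rightarrow> N)"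
  "ctri \<in> D (N \<rightarrow> N)" "cpair \<in> D (N \<rightarrow> N \<rightarrow> N)" "ccode \<in> D (Star N \<rightarrow> N)"
  unfolding cplus_def cpred_def cmon_def ctri_def cpair_def ccode_def by (rule ev_D', simp, simp, simp)+

lemma ap1_D [simp]: "f \<in> D (N \<rightarrow> N) \<Longrightarrow> a \<in> D N \<Longrightarrow> f \<bullet> a \<in> D N"
  by (rule ap_D)

lemma ap2_D [simp]: "f \<in> D (N \<rightarrow> N \<rightarrow> N) \<Longrightarrow> a \<in> D N \<Longrightarrow> f \<bullet> a \<in> D (N \<rightarrow> N)"
  by (rule ap_D)

lemma rec_D [simp]: "a \<in> D N \<Longrightarrow> b \<in> D N \<Longrightarrow> g \<in> D (N \<rightarrow> N \<rightarrow> N) \<Longrightarrow> cst RecC \<bullet> a \<bullet> b \<bullet> g \<in> D N"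
  using ap_D[OF ap_D[OF ap_D[OF csts_D(5)]]] by blast

lemma pl_Z [simp]: "a \<in> D N \<Longrightarrow> pl Z a = a"
  and pl_S [simp]: "a \<in> D N \<Longrightarrow> b \<in> D N \<Longrightarrow> pl (S a) b = S (pl a b)"
  by (simp_all add: cplus_def[unfolded plusC_def] rec_zero rec_suc ev_upd_fresh)

lemma pd_Z [simp]: "cpred \<bullet> Z = Z"
  and pd_S [simp]: "a \<in> D N \<Longrightarrow> cpred \<bullet> (S a) = a"
  by (simp_all add: cpred_def[unfolded predC_def] rec_zero rec_suc ev_upd_fresh)

lemma mn_Z [simp]: "a \<in> D N \<Longrightarrow> mn a Z = a"
  and mn_S: "a \<in> D N \<Longrightarrow> b \<in> D N \<Longrightarrow> mn a (S b) = cpred \<bullet> (mn a b)"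
  by (simp_all add: cmon_def[unfolded monusC_def] rec_zero rec_suc ev_upd_fresh)

lemma tri_Z [simp]: "ctri \<bullet> Z = Z"
  and tri_S [simp]: "a \<in> D N \<Longrightarrow> ctri \<bullet> (S a) = pl (ctri \<bullet> a) (S a)"
  by (simp_all add: ctri_def[unfolded triC_def] rec_zero rec_suc ev_upd_fresh)

lemma pair_eq: "a \<in> D N \<Longrightarrow> b \<in> D N \<Longrightarrow> pr a b = pl (ctri \<bullet> (pl a b)) a"
  by (simp add: cpair_def[unfolded pairC_def])

lemma pl_Zr [simp]: assumes "a \<in> D N" shows "pl a Z = a"
proof -
  have "sat (upd dflt ''x'' N a) (plusC \<cdot> n0 ''x'' \<cdot> ZeroC \<^bold>= n0 ''x'')"
    by (rule induct) (use assms in auto)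
  then show ?thesis by simp
qed

lemma pl_Sr [simp]: assumes "a \<in> D N" "b \<in> D N" shows "pl a (S b) = S (pl a b)"
proof -
  have "sat (upd (upd dflt ''b'' N b) ''x'' N a)
    (plusC \<cdot> n0 ''x'' \<cdot> Succ (n0 ''b'') \<^bold>= Succ (plusC \<cdot> n0 ''x'' \<cdot> n0 ''b''))"
    by (rule induct) (use assms in auto)
  then show ?thesis by simp
qed

lemma pl_assoc: assumes "a \<in> D N" "b \<in> D N" "c \<in> D N" shows "pl (pl a b) c = pl a (pl b c)"
proof -
  have "sat (upd (upd (upd dflt ''b'' N b) ''c'' N c) ''x'' N a)
    (plusC \<cdot> (plusC \<cdot> n0 ''x'' \<cdot> n0 ''b'') \<cdot> n0 ''c'' \<^bold>= plusC \<cdot> n0 ''x'' \<cdot> (plusC \<cdot> n0 ''b'' \<cdot> n0 ''c''))"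
    by (rule induct) (use assms in auto)
  then show ?thesis by simp
qed

lemma pl_cancel:
  assumes "a \<in> D N" "b \<in> D N" "c \<in> D N" "pl a b = pl a c" shows "b = c"
proof -
  have "sat (upd (upd (upd dflt ''b'' N b) ''c'' N c) ''x'' N a)
    (plusC \<cdot> n0 ''x'' \<cdot> n0 ''b'' \<^bold>= plusC \<cdot> n0 ''x'' \<cdot> n0 ''c'' \<^bold>\<longrightarrow> n0 ''b'' \<^bold>= n0 ''c'')"
    by (rule induct) (use assms in \<open>auto dest: suc_inj[rotated 2]\<close>)
  then show ?thesis using assms by simp
qed

text \<open>The predecessor term replaces the existential quantifier, which quantifier-free
  induction could not handle.\<close>

lemma N_cases:
  assumes "a \<in> D N" obtains "a = Z" | b where "b \<in> D N" "a = S b"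
proof -
  have "sat (upd dflt ''x'' N a) (\<^bold>\<not> n0 ''x'' \<^bold>= ZeroC \<^bold>\<longrightarrow> n0 ''x'' \<^bold>= Succ (predC \<cdot> n0 ''x''))"
    by (rule induct) (use assms in auto)
  then have "a = Z \<or> a = S (cpred \<bullet> a)" by auto
  then show thesis using that(1) that(2)[OF ap1_D[OF carith_D(2) assms]] by blast
qed

lemma mn_SS [simp]: assumes "a \<in> D N" "b \<in> D N" shows "mn (S a) (S b) = mn a b"
proof -
  have "sat (upd (upd dflt ''a'' N a) ''x'' N b)
    (monusC \<cdot> Succ (n0 ''a'') \<cdot> Succ (n0 ''x'') \<^bold>= monusC \<cdot> n0 ''a'' \<cdot> n0 ''x'')"
    by (rule induct) (use assms in \<open>auto simp: mn_S\<close>)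
  then show ?thesis by simp
qed

lemma mn_Zl [simp]: assumes "a \<in> D N" shows "mn Z a = Z"
proof -
  have "sat (upd dflt ''x'' N a) (monusC \<cdot> ZeroC \<cdot> n0 ''x'' \<^bold>= ZeroC)"
    by (rule induct) (use assms in \<open>auto simp: mn_S\<close>)
  then show ?thesis by simp
qed

lemma mn_pl [simp]: assumes "a \<in> D N" "b \<in> D N" shows "mn (pl a b) a = b"
proof -
  have "sat (upd (upd dflt ''b'' N b) ''x'' N a)
    (monusC \<cdot> (plusC \<cdot> n0 ''x'' \<cdot> n0 ''b'') \<cdot> n0 ''x'' \<^bold>= n0 ''b'')"
    by (rule induct) (use assms in auto)
  then show ?thesis by simp
qed

lemma le_pl [simp]: assumes "a \<in> D N" "b \<in> D N" shows "le a (pl a b)"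
proof -
  have "sat (upd (upd dflt ''b'' N b) ''x'' N a) (n0 ''x'' \<^bold>\<le> (plusC \<cdot> n0 ''x'' \<cdot> n0 ''b''))"
    by (rule induct) (use assms in auto)
  then show ?thesis by simp
qed

lemma pl_mn: assumes "a \<in> D N" "b \<in> D N" "\<not> le a b" shows "pl b (mn a b) = a"
proof -
  have "sat (upd (upd dflt ''a'' N a) ''x'' N b)
    (\<^bold>\<not> n0 ''a'' \<^bold>\<le> n0 ''x'' \<^bold>\<longrightarrow> plusC \<cdot> n0 ''x'' \<cdot> (monusC \<cdot> n0 ''a'' \<cdot> n0 ''x'') \<^bold>= n0 ''a'')"
  proof (rule induct)
    fix b assume b: "b \<in> D N" and IH: "sat (upd (upd dflt ''a'' N a) ''x'' N b)
      (\<^bold>\<not> n0 ''a'' \<^bold>\<le> n0 ''x'' \<^bold>\<longrightarrow> plusC \<cdot> n0 ''x'' \<cdot> (monusC \<cdot> n0 ''a'' \<cdot> n0 ''x'') \<^bold>= n0 ''a'')"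
    have "mn a b \<in> D N" using assms b by simp
    then show "sat (upd (upd dflt ''a'' N a) ''x'' N (S b))
      (\<^bold>\<not> n0 ''a'' \<^bold>\<le> n0 ''x'' \<^bold>\<longrightarrow> plusC \<cdot> n0 ''x'' \<cdot> (monusC \<cdot> n0 ''a'' \<cdot> n0 ''x'') \<^bold>= n0 ''a'')"
    proof (cases rule: N_cases)
      case (2 c)
      then have "S (pl b c) = a" using IH assms b suc_nonzero by auto
      then show ?thesis using 2 assms b by (simp add: mn_S)
    qed (use assms b in \<open>simp add: mn_S\<close>)
  qed (use assms in auto)
  then show ?thesis using assms by simp
qed

lemma le_mn: assumes "a \<in> D N" "b \<in> D N" "le a b" shows "pl a (mn b a) = b"
proof -
  have "sat (upd (upd dflt ''a'' N a) ''x'' N b)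
    (n0 ''a'' \<^bold>\<le> n0 ''x'' \<^bold>\<longrightarrow> plusC \<cdot> n0 ''a'' \<cdot> (monusC \<cdot> n0 ''x'' \<cdot> n0 ''a'') \<^bold>= n0 ''x'')"
  proof (rule induct)
    fix b assume b: "b \<in> D N" and IH: "sat (upd (upd dflt ''a'' N a) ''x'' N b)
      (n0 ''a'' \<^bold>\<le> n0 ''x'' \<^bold>\<longrightarrow> plusC \<cdot> n0 ''a'' \<cdot> (monusC \<cdot> n0 ''x'' \<cdot> n0 ''a'') \<^bold>= n0 ''x'')"
    have "mn a b \<in> D N" using assms b by simp
    then show "sat (upd (upd dflt ''a'' N a) ''x'' N (S b))
      (n0 ''a'' \<^bold>\<le> n0 ''x'' \<^bold>\<longrightarrow> plusC \<cdot> n0 ''a'' \<cdot> (monusC \<cdot> n0 ''x'' \<cdot> n0 ''a'') \<^bold>= n0 ''x'')"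
    proof (cases rule: N_cases)
      case 1
      then have e: "pl a (mn b a) = b" using IH by simp
      define c where "c = mn b a"
      have c: "c \<in> D N" "b = pl a c" using e assms b by (simp_all add: c_def)
      have "S b = pl a (S c)" using c assms by simp
      then have "mn (S b) a = S c" using mn_pl[of a "S c"] assms c by simp
      then show ?thesis using c assms by simp
    next
      case (2 c)
      then have ab: "pl b (S c) = a" using pl_mn[of a b] assms b suc_nonzero by auto
      show ?thesis
      proof (cases "c = Z")
        case True
        then have "a = S b" using ab b by simp
        moreover have "mn (S b) (S b) = Z" using mn_pl[of "S b" Z] b by simp
        ultimately show ?thesis using b by simp
      next
        case False
        then show ?thesis using 2 assms b by (simp add: mn_S)
      qed
    qed
  next
    show "sat (upd (upd dflt ''a'' N a) ''x'' N Z)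
      (n0 ''a'' \<^bold>\<le> n0 ''x'' \<^bold>\<longrightarrow> plusC \<cdot> n0 ''a'' \<cdot> (monusC \<cdot> n0 ''x'' \<cdot> n0 ''a'') \<^bold>= n0 ''x'')"
      using assms by simp
  qed (use assms in auto)
  then show ?thesis using assms by simp
qed

lemma le_iff: "a \<in> D N \<Longrightarrow> b \<in> D N \<Longrightarrow> le a b \<longleftrightarrow> (\<exists>c\<in>D N. b = pl a c)"
  using le_mn[of a b] by (metis ap1_D ap2_D carith_D(3) le_pl)

lemma le_refl [simp]: "a \<in> D N \<Longrightarrow> le a a"
  using le_pl[of a Z] by simp

lemma le_trans: "a \<in> D N \<Longrightarrow> b \<in> D N \<Longrightarrow> c \<in> D N \<Longrightarrow> le a b \<Longrightarrow> le b c \<Longrightarrow> le a c"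
proof -
  assume N: "a \<in> D N" "b \<in> D N" "c \<in> D N" and "le a b" "le b c"
  then obtain d e where "d \<in> D N" "e \<in> D N" "b = pl a d" "c = pl b e" using le_iff by meson
  then have "c = pl a (pl d e)" using N pl_assoc by simp
  then show "le a c" using N \<open>d \<in> D N\<close> \<open>e \<in> D N\<close> by simp
qed

lemma not_S_le: "a \<in> D N \<Longrightarrow> \<not> le (S a) a"
proof
  assume a: "a \<in> D N" and "le (S a) a"
  then obtain c where c: "c \<in> D N" "a = pl (S a) c" using le_iff[of "S a" a] by auto
  then have "pl a (S c) = pl a Z" using a by simp
  then show False using pl_cancel[of a "S c" Z] a c suc_nonzero by auto
qed

lemma le_linear: "a \<in> D N \<Longrightarrow> b \<in> D N \<Longrightarrow> le a b \<or> le (S b) a"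
proof -
  assume N: "a \<in> D N" "b \<in> D N"
  then have m: "mn a b \<in> D N" by simp
  show ?thesis
    using m
  proof (cases rule: N_cases)
    case (2 c)
    then have "pl (S b) c = a" using pl_mn[of a b] N suc_nonzero by auto
    then show ?thesis using le_pl[of "S b" c] N 2 by auto
  qed simp
qed

lemma le_antisym: "a \<in> D N \<Longrightarrow> b \<in> D N \<Longrightarrow> le a b \<Longrightarrow> le b a \<Longrightarrow> a = b"
proof -
  assume N: "a \<in> D N" "b \<in> D N" and l: "le a b" "le b a"
  obtain c where c: "c \<in> D N" "b = pl a c" using l le_iff N by blast
  show "a = b"
    using c(1)
  proof (cases rule: N_cases)
    case (2 d)
    then have "b = pl (S a) d" using c N by simp
    then have "le (S a) b" using N 2 by simp
    then have "le (S a) a" using le_trans[of "S a" b a] N l by simp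
    then show ?thesis using not_S_le N by blast
  qed (use c N in auto)
qed

lemma le_S_iff: "a \<in> D N \<Longrightarrow> b \<in> D N \<Longrightarrow> le a (S b) \<longleftrightarrow> le a b \<or> a = S b"
  using le_linear[of a b] le_antisym[of a "S b"] le_trans[of a b "S b"] le_pl[of b "S Z"] by auto

text \<open>Truth value of a quantifier-free formula, with zero for truth.\<close>

primrec chr :: "fm \<Rightarrow> tm" where
  "chr (s \<^bold>= t) = monusC \<cdot> One \<cdot> (monusC \<cdot> One \<cdot> (plusC \<cdot> (monusC \<cdot> s \<cdot> t) \<cdot> (monusC \<cdot> t \<cdot> s)))"
| "chr \<^bold>\<bottom> = One"
| "chr (\<phi> \<^bold>\<longrightarrow> \<psi>) = monusC \<cdot> chr \<psi> \<cdot> chr \<phi>"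
| "chr (\<^bold>\<forall>x\<^bold>:\<tau>. \<phi>) = ZeroC"

lemma wt_chr [simp]: "qf \<phi> \<Longrightarrow> wff \<phi> \<Longrightarrow> wt (chr \<phi>) \<and> typ_of (chr \<phi>) = N"
  by (induction \<phi>) auto

lemma fvt_chr: "fvt (chr \<phi>) \<subseteq> fv \<phi>"
  by (induction \<phi>) auto

lemma S_Z_neq [simp]: "S Z \<noteq> Z" using suc_nonzero by simp

lemma mn_one: "a \<in> D N \<Longrightarrow> mn (S Z) a = (if a = Z then S Z else Z)"
  by (erule N_cases) (auto simp: suc_nonzero)

lemma pl_eq_Z: "a \<in> D N \<Longrightarrow> b \<in> D N \<Longrightarrow> pl a b = Z \<longleftrightarrow> a = Z \<and> b = Z"
  by (erule N_cases) (auto simp: suc_nonzero)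

lemma ev_chr [simp]: "qf \<phi> \<Longrightarrow> wff \<phi> \<Longrightarrow> ok \<rho> \<Longrightarrow> ev \<rho> (chr \<phi>) = (if sat \<rho> \<phi> then Z else S Z)"
proof (induction \<phi>)
  case (Eq0 s t)
  then have "ev \<rho> s \<in> D N" "ev \<rho> t \<in> D N" by auto
  moreover from this have "pl (mn (ev \<rho> s) (ev \<rho> t)) (mn (ev \<rho> t) (ev \<rho> s)) = Z \<longleftrightarrow> ev \<rho> s = ev \<rho> t"
    using le_antisym by (auto simp: pl_eq_Z)
  ultimately show ?case by (simp add: mn_one)
qed (auto simp: mn_one)

section \<open>Inverses of the pairing function\<close>

definition rootC :: tm where
  "rootC = lam ''a'' N (RecC \<cdot> n0 ''a'' \<cdot> ZeroC \<cdot> lam ''y'' N (lam ''x'' N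
     (plusC \<cdot> n0 ''y'' \<cdot> (monusC \<cdot> One \<cdot> chr (triC \<cdot> Succ (n0 ''y'') \<^bold>\<le> Succ (n0 ''x''))))))"

definition fstC :: tm where
  "fstC = lam ''a'' N (monusC \<cdot> n0 ''a'' \<cdot> (triC \<cdot> (rootC \<cdot> n0 ''a'')))"

definition sndC :: tm where
  "sndC = lam ''a'' N (monusC \<cdot> (rootC \<cdot> n0 ''a'') \<cdot> (fstC \<cdot> n0 ''a''))"

lemma wt_unpair [simp]: "wt rootC" "wt fstC" "wt sndC"
  "typ_of rootC = (N \<rightarrow> N)" "typ_of fstC = (N \<rightarrow> N)" "typ_of sndC = (N \<rightarrow> N)"
  by (simp_all add: rootC_def fstC_def sndC_def)

lemma fvt_unpair [simp]: "fvt rootC = {}" "fvt fstC = {}" "fvt sndC = {}"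
  by (auto simp: rootC_def fstC_def sndC_def)

definition "croot = clo rootC"
definition "cfst = clo fstC"
definition "csnd = clo sndC"

lemma ev_unpair [simp]: "ev \<rho> rootC = croot" "ev \<rho> fstC = cfst" "ev \<rho> sndC = csnd"
  unfolding croot_def cfst_def csnd_def by (rule ev_closed, simp)+

lemma cunpair_D [simp]: "croot \<in> D (N \<rightarrow> N)" "cfst \<in> D (N \<rightarrow> N)" "csnd \<in> D (N \<rightarrow> N)"
  unfolding croot_def cfst_def csnd_def by (rule ev_D', simp, simp, simp)+

lemma root_Z: "croot \<bullet> Z = Z"
  and root_S: "a \<in> D N \<Longrightarrow> croot \<bullet> S a =
    (if le (ctri \<bullet> S (croot \<bullet> a)) (S a) then S (croot \<bullet> a) else croot \<bullet> a)"
  by (simp_all add: croot_def[unfolded rootC_def] rec_zero rec_suc ev_upd_fresh mn_one del: tri_S)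

lemma fst_eq: "a \<in> D N \<Longrightarrow> cfst \<bullet> a = mn a (ctri \<bullet> (croot \<bullet> a))"
  by (simp add: cfst_def[unfolded fstC_def])

lemma snd_eq: "a \<in> D N \<Longrightarrow> csnd \<bullet> a = mn (croot \<bullet> a) (cfst \<bullet> a)"
  by (simp add: csnd_def[unfolded sndC_def])

lemma le_S_trans: "a \<in> D N \<Longrightarrow> b \<in> D N \<Longrightarrow> le a b \<Longrightarrow> le a (S b)"
  by (simp add: le_S_iff)

text \<open>\<open>croot\<close> finds the largest number whose triangular number is at most
  \<open>p\<close>: along the recursion on \<open>p\<close> it grows by one exactly when
  \<open>p\<close> reaches the next triangular number.\<close>

lemma root_bounds:
  assumes "p \<in> D N"
  shows "le (ctri \<bullet> (croot \<bullet> p)) p" "le (S p) (ctri \<bullet> S (croot \<bullet> p))"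
proof -
  let ?\<phi> = "triC \<cdot> (rootC \<cdot> n0 ''x'') \<^bold>\<le> n0 ''x'' \<^bold>\<and> n0 ''x'' \<^bold>< triC \<cdot> Succ (rootC \<cdot> n0 ''x'')"
  have "sat (upd dflt ''x'' N p) ?\<phi>"
  proof (rule induct)
    fix p assume p: "p \<in> D N" and "sat (upd dflt ''x'' N p) ?\<phi>"
    then have IH: "le (ctri \<bullet> (croot \<bullet> p)) p" "le (S p) (ctri \<bullet> S (croot \<bullet> p))" by simp_all
    define r where "r = croot \<bullet> p"
    have r: "r \<in> D N" using p by (simp add: r_def)
    have "le (ctri \<bullet> (croot \<bullet> S p)) (S p) \<and> le (S (S p)) (ctri \<bullet> S (croot \<bullet> S p))"
    proof (cases "le (ctri \<bullet> S r) (S p)")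
      case True
      \<comment> \<open>The next triangular number was above \<open>p\<close> and is at most
        \<open>S p\<close>, so it is hit exactly and a single increment suffices.\<close>
      have "ctri \<bullet> S r = S p" using True IH le_antisym[of "ctri \<bullet> S r" "S p"] p r by (simp add: r_def)
      moreover have "ctri \<bullet> S (S r) = pl (S (ctri \<bullet> S r)) (S r)" using r by simp
      ultimately have "le (S (S p)) (ctri \<bullet> S (S r))"
        using le_pl[of "S (ctri \<bullet> S r)" "S r"] r p by (simp del: tri_S pl_Sr pl_S)
      then show ?thesis using True p by (simp add: root_S r_def del: tri_S)
    next
      case False
      then have "le (S (S p)) (ctri \<bullet> S r)" using le_linear[of "ctri \<bullet> S r" "S p"] p r by simp
      then show ?thesis using False p IH le_S_trans by (simp add: root_S r_def del: tri_S)
    qed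
    then show "sat (upd dflt ''x'' N (S p)) ?\<phi>" by simp
  qed (use assms in \<open>auto simp: root_Z\<close>)
  then show "le (ctri \<bullet> (croot \<bullet> p)) p" "le (S p) (ctri \<bullet> S (croot \<bullet> p))" by simp_all
qed

lemma tri_mono:
  assumes "a \<in> D N" "b \<in> D N" "le a b" shows "le (ctri \<bullet> a) (ctri \<bullet> b)"
proof -
  obtain c where c: "c \<in> D N" "b = pl a c" using assms le_iff by blast
  have "sat (upd (upd dflt ''a'' N a) ''x'' N c)
    (triC \<cdot> n0 ''a'' \<^bold>\<le> triC \<cdot> (plusC \<cdot> n0 ''a'' \<cdot> n0 ''x''))"
  proof (rule induct)
    fix c assume c: "c \<in> D N" and "sat (upd (upd dflt ''a'' N a) ''x'' N c)
      (triC \<cdot> n0 ''a'' \<^bold>\<le> triC \<cdot> (plusC \<cdot> n0 ''a'' \<cdot> n0 ''x''))"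
    then have "le (ctri \<bullet> a) (ctri \<bullet> (pl a c))" by simp
    moreover have "le (ctri \<bullet> (pl a c)) (ctri \<bullet> S (pl a c))" using c assms le_pl by (simp del: pl_Sr)
    ultimately have "le (ctri \<bullet> a) (ctri \<bullet> S (pl a c))"
      using le_trans[of "ctri \<bullet> a" "ctri \<bullet> (pl a c)" "ctri \<bullet> S (pl a c)"] assms c by (simp del: tri_S)
    then show "sat (upd (upd dflt ''a'' N a) ''x'' N (S c))
      (triC \<cdot> n0 ''a'' \<^bold>\<le> triC \<cdot> (plusC \<cdot> n0 ''a'' \<cdot> n0 ''x''))" using c assms by (simp del: tri_S)
  qed (use assms c in auto)
  then show ?thesis using c by simp
qed

text \<open>The offset of \<open>p\<close> above its triangular number is at most the root, since
  otherwise the next triangular number would be at most \<open>p\<close>; so the offset and its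
  complement to the root are the components.\<close>

lemma pair_fst_snd:
  assumes "p \<in> D N" shows "pr (cfst \<bullet> p) (csnd \<bullet> p) = p"
proof -
  define r f where "r = croot \<bullet> p" and "f = cfst \<bullet> p"
  have D: "r \<in> D N" "f \<in> D N" using assms by (simp_all add: r_def f_def)
  note b = root_bounds[OF assms, folded r_def]
  have p: "pl (ctri \<bullet> r) f = p"
    using le_mn[OF _ assms b(1)] D assms by (simp add: f_def fst_eq r_def)
  have "le f r"
  proof (rule ccontr)
    assume "\<not> le f r"
    then obtain d where d: "d \<in> D N" "f = pl (S r) d" using le_linear[of f r] D le_iff[of "S r" f] by auto
    have "p = pl (ctri \<bullet> r) (pl (S r) d)" using p d by simp
    also have "\<dots> = pl (ctri \<bullet> S r) d" using D d pl_assoc[of "ctri \<bullet> r" "S r" d] by simp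
    finally have "le (ctri \<bullet> S r) p" using D d le_pl[of "ctri \<bullet> S r" d] by (simp del: tri_S)
    then have "le (S p) p" using b(2) le_trans[of "S p" "ctri \<bullet> S r" p] D assms by (simp del: tri_S)
    then show False using not_S_le assms by blast
  qed
  then have "pl f (csnd \<bullet> p) = r" using le_mn[of f r] D assms by (simp add: snd_eq f_def r_def)
  then show ?thesis using p assms by (simp add: pair_eq f_def)
qed

text \<open>\<open>pl a b\<close> satisfies the bounds of \<open>root_bounds\<close> for the pair,
  and monotonicity of \<open>ctri\<close> allows only one such number.\<close>

lemma root_pair:
  assumes "a \<in> D N" "b \<in> D N" shows "croot \<bullet> (pr a b) = pl a b"
proof -
  define s p r where "s = pl a b" and "p = pr a b" and "r = croot \<bullet> p"
  have D: "s \<in> D N" "p \<in> D N" "r \<in> D N" using assms by (simp_all add: s_def p_def r_def)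
  have p: "p = pl (ctri \<bullet> s) a" using assms by (simp add: p_def pair_eq s_def)
  have s1: "le (ctri \<bullet> s) p" using p D assms by simp
  have "ctri \<bullet> S s = S (pl (ctri \<bullet> s) (pl a b))" using D by (simp add: s_def)
  also have "\<dots> = pl (S p) b" using p D assms pl_assoc[of "ctri \<bullet> s" a b] by simp
  finally have s2: "le (S p) (ctri \<bullet> S s)" using D assms le_pl[of "S p" b] by simp
  note b = root_bounds[OF D(2), folded r_def]
  have key: "\<not> le (S u) v" if "u \<in> D N" "v \<in> D N" "le (S p) (ctri \<bullet> S u)" "le (ctri \<bullet> v) p" for u v
  proof
    assume "le (S u) v"
    then have "le (ctri \<bullet> S u) (ctri \<bullet> v)" using tri_mono[of "S u" v] that by (simp del: tri_S)
    then have "le (S p) p"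
      using le_trans[of "S p" "ctri \<bullet> S u" "ctri \<bullet> v"] le_trans[of "S p" "ctri \<bullet> v" p] that D
      by (simp del: tri_S)
    then show False using not_S_le D by blast
  qed
  have "\<not> le (S r) s" "\<not> le (S s) r" using key s1 s2 b D by blast+
  then have "r = s" using le_linear le_antisym D by blast
  then show ?thesis by (simp add: r_def p_def s_def)
qed

lemma fst_pair [simp]: "a \<in> D N \<Longrightarrow> b \<in> D N \<Longrightarrow> cfst \<bullet> (pr a b) = a"
  by (simp add: fst_eq root_pair) (simp add: pair_eq)

lemma snd_pair [simp]: "a \<in> D N \<Longrightarrow> b \<in> D N \<Longrightarrow> csnd \<bullet> (pr a b) = b"
  by (simp add: snd_eq root_pair)

end

section \<open>The equivalence in a model\<close>

context struct
begin

lemma sat_connectives [simp]: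
  "sat \<rho> (\<phi> \<^bold>\<and> \<psi>) \<longleftrightarrow> sat \<rho> \<phi> \<and> sat \<rho> \<psi>"
  "sat \<rho> (\<phi> \<^bold>\<or> \<psi>) \<longleftrightarrow> sat \<rho> \<phi> \<or> sat \<rho> \<psi>"
  "sat \<rho> (\<phi> \<^bold>\<longleftrightarrow> \<psi>) \<longleftrightarrow> (sat \<rho> \<phi> \<longleftrightarrow> sat \<rho> \<psi>)"
  "sat \<rho> (\<^bold>\<exists>x\<^bold>:\<tau>. \<phi>) \<longleftrightarrow> (\<exists>a\<in>D \<tau>. sat (upd \<rho> x \<tau> a) \<phi>)"
  by auto

end

context arith
begin

section \<open>Semantic forms of the principles\<close>

definition LOs :: "'a \<Rightarrow> bool" where
  "LOs X \<longleftrightarrow> (\<forall>i\<in>D N. le (X \<bullet> i) (S Z))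
     \<and> (\<forall>i\<in>D N. \<forall>j\<in>D N. X \<bullet> pr i j = S Z \<longrightarrow> X \<bullet> pr i i = S Z \<and> X \<bullet> pr j j = S Z)
     \<and> (\<forall>i\<in>D N. \<forall>j\<in>D N. \<forall>k\<in>D N. X \<bullet> pr i j = S Z \<and> X \<bullet> pr j k = S Z \<longrightarrow> X \<bullet> pr i k = S Z)
     \<and> (\<forall>i\<in>D N. \<forall>j\<in>D N. X \<bullet> pr i j = S Z \<and> X \<bullet> pr j i = S Z \<longrightarrow> i = j)
     \<and> (\<forall>i\<in>D N. \<forall>j\<in>D N. X \<bullet> pr i i = S Z \<and> X \<bullet> pr j j = S Z \<longrightarrow> X \<bullet> pr i j = S Z \<or> X \<bullet> pr j i = S Z)"

definition WOs :: "'a \<Rightarrow> bool" where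
  "WOs X \<longleftrightarrow> LOs X \<and> \<not> (\<exists>h\<in>D T1. \<forall>n\<in>D N. X \<bullet> pr (h \<bullet> n) (h \<bullet> n) = S Z \<and>
     X \<bullet> pr (h \<bullet> S n) (h \<bullet> n) = S Z \<and> X \<bullet> pr (h \<bullet> n) (h \<bullet> S n) \<noteq> S Z)"

definition restrs :: "'a \<Rightarrow> 'a \<Rightarrow> 'a \<Rightarrow> 'a \<Rightarrow> bool" where
  "restrs X Y j W \<longleftrightarrow> (\<forall>l\<in>D N. le (W \<bullet> l) (S Z)) \<and> (\<forall>l\<in>D N. W \<bullet> l = S Z \<longleftrightarrow>
     (\<exists>m\<in>D N. \<exists>i\<in>D N. l = pr m i \<and> Y \<bullet> l = S Z \<and> X \<bullet> pr i j = S Z \<and> X \<bullet> pr j i \<noteq> S Z))"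

definition thetas :: "'a \<Rightarrow> 'a \<Rightarrow> 'a \<Rightarrow> bool" where
  "thetas f n W \<longleftrightarrow> (\<exists>m\<in>D N. f \<bullet> pr n (pr m (ccode \<bullet> (cst (SeqC N) \<bullet> m \<bullet> W))) = Z)"

definition Hs :: "'a \<Rightarrow> 'a \<Rightarrow> 'a \<Rightarrow> bool" where
  "Hs f X Y \<longleftrightarrow> (\<forall>k\<in>D N. le (Y \<bullet> k) (S Z)) \<and> (\<forall>k\<in>D N. Y \<bullet> k = S Z \<longleftrightarrow>
     (\<exists>n\<in>D N. \<exists>j\<in>D N. k = pr n j \<and> X \<bullet> pr j j = S Z \<and>
       (\<exists>W\<in>D T1. restrs X Y j W \<and> thetas f n W)))"

lemma sat_WO: "sat \<rho> (WO (n1 ''X'')) \<longleftrightarrow> WOs (\<rho> (''X'', T1))"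
  unfolding WO_def LO_def WOs_def LOs_def sat_connectives(1)
  by (intro arg_cong2[where f = "(\<and>)"])
    (simp_all add: less_in_def le_in_def in_field_def mem_def is_set_def le1_one_def, blast+)

lemma sat_restr: "sat \<rho> (is_restr (n1 ''X'') t (n0 ''j'') (n1 ''Z'')) \<longleftrightarrow>
    restrs (\<rho> (''X'', T1)) (ev \<rho> t) (\<rho> (''j'', N)) (\<rho> (''Z'', T1))"
  if "fvt t \<inter> {(''l'', N), (''m'', N), (''i'', N), (''p'', N)} = {}"
proof -
  have ev: "ev (upd (upd (upd \<rho> ''l'' N a) ''m'' N b) ''i'' N c) t = ev \<rho> t" for a b c
    using that by (simp add: ev_upd_fresh)
  show ?thesis
    unfolding is_restr_def is_set_def le1_one_def sat_connectives(1)
    unfolding sat.simps(4)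
    unfolding sat_connectives(3) restrs_def
    unfolding sat_connectives(4)
    by (intro arg_cong2[where f = "(\<and>)"] arg_cong2[where f = "(=)"] ball_cong bex_cong refl)
      (auto simp: ev mem_def less_in_def)
qed

lemma sat_H: "sat \<rho> (H (n1 ''f'') (n1 ''X'') t) \<longleftrightarrow> Hs (\<rho> (''f'', T1)) (\<rho> (''X'', T1)) (ev \<rho> t)"
  if "fvt t \<inter> {(''l'', N), (''m'', N), (''i'', N), (''p'', N), (''k'', N), (''n'', N), (''j'', N), (''Z'', T1)} = {}"
proof -
  have ev: "ev (upd (upd (upd (upd \<rho> ''k'' N a) ''n'' N b) ''j'' N c) ''Z'' T1 d) t = ev \<rho> t"
    "ev (upd \<rho> ''k'' N a) t = ev \<rho> t" "ev (upd \<rho> ''p'' N a) t = ev \<rho> t" for a b c d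
    using that by (simp_all add: ev_upd_fresh)
  have fr: "fvt t \<inter> {(''l'', N), (''m'', N), (''i'', N), (''p'', N)} = {}" using that by auto
  show ?thesis
    unfolding H_def is_set_def le1_one_def sat_connectives(1)
    unfolding sat.simps(4)
    unfolding sat_connectives(3) Hs_def
    unfolding sat_connectives(4) theta_of_def thetas_def
    by (intro arg_cong2[where f = "(\<and>)"] arg_cong2[where f = "(=)"] ball_cong bex_cong refl)
      (simp_all add: ev sat_restr[OF fr] mem_def in_field_def)
qed

lemma sat_UATR: "sat \<rho> UATR \<longleftrightarrow> (\<exists>\<Phi>\<in>D (T1 \<rightarrow> T1 \<rightarrow> T1). \<forall>X\<in>D T1. \<forall>f\<in>D T1. WOs X \<longrightarrow> Hs f X (\<Phi> \<bullet> X \<bullet> f))"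
  by (simp add: UATR_def sat_WO sat_H)

lemma sat_mu2: "sat \<rho> mu2 \<longleftrightarrow> (\<exists>m\<in>D T2. \<forall>f\<in>D T1. (\<exists>n\<in>D N. f \<bullet> n = Z) \<longrightarrow> f \<bullet> (m \<bullet> f) = Z)"
  by (auto simp: mu2_def)

text \<open>Quantifier-free comprehension by a term. \<open>chr\<close> uses zero for truth and a
  set uses one for membership, whence the subtraction.\<close>

definition setof :: "string \<Rightarrow> fm \<Rightarrow> tm" where
  "setof x \<phi> = lam x N (monusC \<cdot> One \<cdot> chr \<phi>)"

lemma wt_setof [simp]: "qf \<phi> \<Longrightarrow> wff \<phi> \<Longrightarrow> wt (setof x \<phi>) \<and> typ_of (setof x \<phi>) = (N \<rightarrow> N)"
  by (simp add: setof_def)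

lemma ev_setof [simp]: "qf \<phi> \<Longrightarrow> wff \<phi> \<Longrightarrow> ok \<rho> \<Longrightarrow> a \<in> D N \<Longrightarrow>
    ev \<rho> (setof x \<phi>) \<bullet> a = (if sat (upd \<rho> x N a) \<phi> then S Z else Z)"
  by (simp add: setof_def mn_one)

lemma fvt_setof: "fvt (setof x \<phi>) \<subseteq> fv \<phi> - {(x, N)}"
  using fvt_chr[of \<phi>] by (auto simp: setof_def)

lemma ap_T2 [simp]: "F \<in> D T2 \<Longrightarrow> f \<in> D T1 \<Longrightarrow> F \<bullet> f \<in> D N"
  by (rule ap_D)

lemma seqN_D [simp]: "m \<in> D N \<Longrightarrow> W \<in> D T1 \<Longrightarrow> cst (SeqC N) \<bullet> m \<bullet> W \<in> D (Star N)"
  using ap_D[OF ap_D[OF csts_D(6)]] by blast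

lemma ent_D [simp]: "w \<in> D (Star \<tau>) \<Longrightarrow> i \<in> D N \<Longrightarrow> cst (EntC \<tau>) \<bullet> w \<bullet> i \<in> D \<tau>"
  using ap_D[OF ap_D[OF csts_D(8)]] by blast

lemma len_D [simp]: "w \<in> D (Star \<tau>) \<Longrightarrow> cst (LenC \<tau>) \<bullet> w \<in> D N"
  by (rule ap_D[OF csts_D(7)])

lemma code_D [simp]: "w \<in> D (Star N) \<Longrightarrow> ccode \<bullet> w \<in> D N"
  by (rule ap_D[OF carith_D(6)])

text \<open>The converse direction needs no comprehension: recursion along a one-point order decides an
  existential formula, and \<open>QF-AC\<close> then provides the witnesses.\<close>

lemma uatr_mu2:
  assumes uatr: "sat dflt UATR"
    and qfac: "\<And>\<phi> \<rho>. qf \<phi> \<Longrightarrow> wff \<phi> \<Longrightarrow> (''mu'', T2) \<notin> fv \<phi> \<Longrightarrow> fst ` fv \<phi> \<subseteq> {''f'', ''n'', ''Phi''} \<Longrightarrow> ok \<rho> \<Longrightarrow>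
      \<forall>a\<in>D T1. \<exists>b\<in>D N. sat (upd (upd \<rho> ''f'' T1 a) ''n'' N b) \<phi> \<Longrightarrow>
      \<exists>F\<in>D T2. \<forall>a\<in>D T1. sat (upd (upd \<rho> ''f'' T1 a) ''n'' N (F \<bullet> a)) \<phi>"
  shows "sat dflt mu2"
proof -
  obtain \<Phi> where \<Phi>: "\<Phi> \<in> D (T1 \<rightarrow> T1 \<rightarrow> T1)"
    and H: "\<And>X f. X \<in> D T1 \<Longrightarrow> f \<in> D T1 \<Longrightarrow> WOs X \<Longrightarrow> Hs f X (\<Phi> \<bullet> X \<bullet> f)"
    using uatr unfolding sat_UATR by blast
  \<comment> \<open>The order whose only pair is (0,0), with field {0}.\<close>
  let ?X = "setof ''l'' (n0 ''l'' \<^bold>= Pair0 ZeroC ZeroC)"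
  \<comment> \<open>The argument codes \<open>n\<close>, \<open>m\<close> and an initial segment;
    extracting \<open>m\<close> makes the existential quantifier of \<open>theta_of\<close> say that
    \<open>f\<close> has a zero.\<close>
  let ?f = "lam ''l'' N (n1 ''f'' \<cdot> (fstC \<cdot> (sndC \<cdot> n0 ''l'')))"
  define X where "X = clo ?X"
  have X_D: "X \<in> D T1" by (simp add: X_def)
  have X: "X \<bullet> a = (if a = pr Z Z then S Z else Z)" if "a \<in> D N" for a
    using that by (simp add: X_def)
  have inj: "pr i j = pr Z Z \<longleftrightarrow> i = Z \<and> j = Z" if "i \<in> D N" "j \<in> D N" for i j
    using fst_pair[OF that] snd_pair[OF that] by fastforce
  have "LOs X" unfolding LOs_def by (auto simp: X inj S_Z_neq[symmetric])
  moreover have "\<not> (X \<bullet> pr (h \<bullet> S Z) (h \<bullet> Z) = S Z \<and> X \<bullet> pr (h \<bullet> Z) (h \<bullet> S Z) \<noteq> S Z)" if "h \<in> D T1" for h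
    using that by (auto simp: X inj S_Z_neq[symmetric])
  ultimately have WO: "WOs X" unfolding WOs_def using csts_D(1) by blast
  have key: "\<Phi> \<bullet> X \<bullet> g \<bullet> pr Z Z = S Z \<longleftrightarrow> (\<exists>m\<in>D N. f \<bullet> m = Z)"
    if f: "f \<in> D T1" "g \<in> D T1" "\<And>a. a \<in> D N \<Longrightarrow> g \<bullet> a = f \<bullet> (cfst \<bullet> (csnd \<bullet> a))" for f g
  proof -
    let ?Y = "\<Phi> \<bullet> X \<bullet> g"
    \<comment> \<open>Nothing lies below the only column, so its restriction is the empty
      set.\<close>
    have z: "clo (lam ''l'' N ZeroC) \<in> D T1" "\<And>a. a \<in> D N \<Longrightarrow> clo (lam ''l'' N ZeroC) \<bullet> a = Z"
      by simp_all
    have "?Y \<bullet> pr Z Z = S Z \<longleftrightarrow> (\<exists>n\<in>D N. \<exists>j\<in>D N. pr Z Z = pr n j \<and> X \<bullet> pr j j = S Z \<and>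
       (\<exists>W\<in>D T1. restrs X ?Y j W \<and> thetas g n W))"
      using H[OF X_D f(2) WO] by (auto simp: Hs_def)
    also have "\<dots> \<longleftrightarrow> (\<exists>W\<in>D T1. restrs X ?Y Z W \<and> thetas g Z W)"
    proof -
      have "n = Z \<and> j = Z" if "n \<in> D N" "j \<in> D N" "pr Z Z = pr n j" for n j
        using inj[OF that(1,2)] that(3) by simp
      moreover have "X \<bullet> pr Z Z = S Z" using X by simp
      ultimately show ?thesis using csts_D(1) by blast
    qed
    also have "\<dots> \<longleftrightarrow> (\<exists>m\<in>D N. f \<bullet> m = Z)"
    proof -
      have "thetas g Z W \<longleftrightarrow> (\<exists>m\<in>D N. f \<bullet> m = Z)" if "W \<in> D T1" for W
        using that f by (simp add: thetas_def)
      moreover have "restrs X ?Y Z (clo (lam ''l'' N ZeroC))"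
        using z by (auto simp: restrs_def X inj S_Z_neq[symmetric])
      ultimately show ?thesis using z(1) by blast
    qed
    finally show ?thesis .
  qed
  \<comment> \<open>The value of the hierarchy at (0,0) stands for the existence of a zero, so the
    formula is quantifier-free; where there is no zero, any number satisfies it.\<close>
  let ?\<phi> = "Var ''Phi'' (T1 \<rightarrow> T1 \<rightarrow> T1) \<cdot> ?X \<cdot> ?f \<cdot> Pair0 ZeroC ZeroC \<^bold>= One \<^bold>\<longrightarrow> n1 ''f'' \<cdot> n0 ''n'' \<^bold>= ZeroC"
  let ?\<rho> = "upd dflt ''Phi'' (T1 \<rightarrow> T1 \<rightarrow> T1) \<Phi>"
  have evX: "ev \<rho> ?X = X" for \<rho>
    unfolding X_def by (rule ev_closed) (use fvt_setof[of "''l''" "n0 ''l'' \<^bold>= Pair0 ZeroC ZeroC"] in auto)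
  have sat: "sat (upd (upd ?\<rho> ''f'' T1 f) ''n'' N b) ?\<phi> \<longleftrightarrow> ((\<exists>m\<in>D N. f \<bullet> m = Z) \<longrightarrow> f \<bullet> b = Z)"
    if f: "f \<in> D T1" "b \<in> D N" for f b
  proof -
    have "\<Phi> \<bullet> X \<bullet> ev (upd (upd ?\<rho> ''f'' T1 f) ''n'' N b) ?f \<bullet> pr Z Z = S Z \<longleftrightarrow> (\<exists>m\<in>D N. f \<bullet> m = Z)"
      by (rule key) (use f \<Phi> in auto)
    then show ?thesis by (simp add: evX)
  qed
  have "fvt ?X = {}" using fvt_setof[of "''l''" "n0 ''l'' \<^bold>= Pair0 ZeroC ZeroC"] by auto
  moreover have "\<exists>b\<in>D N. (\<exists>m\<in>D N. f \<bullet> m = Z) \<longrightarrow> f \<bullet> b = Z" for f using csts_D(1) by blast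
  ultimately have "\<exists>F\<in>D T2. \<forall>a\<in>D T1. sat (upd (upd ?\<rho> ''f'' T1 a) ''n'' N (F \<bullet> a)) ?\<phi>"
    by (intro qfac) (use sat \<Phi> in \<open>auto simp del: sat.simps\<close>)
  then show ?thesis unfolding sat_mu2 using sat by (metis ap_T2)
qed

end

section \<open>Eliminating number quantifiers by \<open>mu\<close>\<close>

locale muarith = arith D ap cst for D :: "ty \<Rightarrow> 'a set" and ap (infixl "\<bullet>" 100) and cst +
  fixes mu :: 'a
  assumes mu_D [simp]: "mu \<in> D T2"
    and mu_spec: "f \<in> D T1 \<Longrightarrow> n \<in> D N \<Longrightarrow> f \<bullet> n = cst ZeroC \<Longrightarrow> f \<bullet> (mu \<bullet> f) = cst ZeroC"
begin

text \<open>Existence in quantifier-free form: the matrix is tested at the number that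
  \<open>mu\<close> proposes. This is correct only under assignments giving \<open>''mu''\<close>
  the value \<open>mu\<close>. It can be nested, so arithmetical formulas become available to
  \<open>chr\<close>, \<open>setof\<close> and \<open>induct\<close>.\<close>

definition exq :: "string \<Rightarrow> fm \<Rightarrow> fm" where
  "exq x \<phi> = (lam x N (chr \<phi>) \<cdot> (Var ''mu'' T2 \<cdot> lam x N (chr \<phi>)) \<^bold>= ZeroC)"

lemma qf_exq [simp]: "qf (exq x \<phi>)"
  by (simp add: exq_def)

lemma wff_exq [simp]: "qf \<phi> \<Longrightarrow> wff \<phi> \<Longrightarrow> wff (exq x \<phi>)"
  by (simp add: exq_def)

lemma mu_least:
  assumes "qf \<phi>" "wff \<phi>" "ok \<rho>" "\<exists>a\<in>D N. sat (upd \<rho> x N a) \<phi>"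
  shows "sat (upd \<rho> x N (mu \<bullet> ev \<rho> (lam x N (chr \<phi>)))) \<phi>"
proof -
  let ?t = "ev \<rho> (lam x N (chr \<phi>))"
  have t: "?t \<in> D T1" using assms by simp
  have v: "?t \<bullet> a = (if sat (upd \<rho> x N a) \<phi> then Z else S Z)" if "a \<in> D N" for a
    using assms that by simp
  obtain a where "a \<in> D N" "?t \<bullet> a = Z" using v assms(4) by auto
  then have "?t \<bullet> (mu \<bullet> ?t) = Z" using mu_spec t by blast
  then show ?thesis using v[of "mu \<bullet> ?t"] t by (auto split: if_splits)
qed

lemma sat_exq [simp]:
  assumes "qf \<phi>" "wff \<phi>" "ok \<rho>" "\<rho> (''mu'', T2) = mu"
  shows "sat \<rho> (exq x \<phi>) \<longleftrightarrow> (\<exists>a\<in>D N. sat (upd \<rho> x N a) \<phi>)"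
proof -
  let ?t = "ev \<rho> (lam x N (chr \<phi>))"
  have "?t \<in> D T1" using assms by simp
  then have "sat \<rho> (exq x \<phi>) \<longleftrightarrow> sat (upd \<rho> x N (mu \<bullet> ?t)) \<phi>" "mu \<bullet> ?t \<in> D N"
    using assms by (simp_all add: exq_def)
  then show ?thesis using mu_least[of \<phi> \<rho> x] assms by blast
qed

end

section \<open>Correct hierarchies from the special fan functional\<close>

locale thetarith = muarith D ap cst mu for D :: "ty \<Rightarrow> 'a set" and ap (infixl "\<bullet>" 100) and cst mu +
  fixes Theta :: 'a
  assumes Theta_D: "Theta \<in> D (T2 \<rightarrow> Star T1)"
    and ext1: "f \<in> D T1 \<Longrightarrow> g \<in> D T1 \<Longrightarrow> (\<And>n. n \<in> D N \<Longrightarrow> f \<bullet> n = g \<bullet> n) \<Longrightarrow> f = g"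
    and sff: "G \<in> D T2 \<Longrightarrow> f \<in> D T1 \<Longrightarrow> (\<And>p. p \<in> D N \<Longrightarrow> cmon \<bullet> (f \<bullet> p) \<bullet> (cst SucC \<bullet> cst ZeroC) = cst ZeroC) \<Longrightarrow>
      \<exists>i\<in>D N. cmon \<bullet> (cst SucC \<bullet> i) \<bullet> (cst (LenC T1) \<bullet> (Theta \<bullet> G)) = cst ZeroC \<and>
        (\<forall>n\<in>D N. cmon \<bullet> (cst SucC \<bullet> n) \<bullet> (G \<bullet> (cst (EntC T1) \<bullet> (Theta \<bullet> G) \<bullet> i)) = cst ZeroC \<longrightarrow>
          f \<bullet> n = cst (EntC T1) \<bullet> (Theta \<bullet> G) \<bullet> i \<bullet> n)"
begin

definition restrT :: "tm \<Rightarrow> tm \<Rightarrow> tm" where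
  "restrT t u = setof ''l'' (t \<cdot> n0 ''l'' \<^bold>= One \<^bold>\<and> less_in (n1 ''X'') (sndC \<cdot> n0 ''l'') u)"

text \<open>The value that the recursion prescribes at a pair \<open>u\<close> when the earlier
  columns are those of the candidate \<open>t\<close> itself, right or wrong. Errors in this sense
  are arithmetical, hence quantifier-free by \<open>exq\<close>.\<close>

definition VF :: "tm \<Rightarrow> tm \<Rightarrow> fm" where
  "VF t u = (n1 ''X'' \<cdot> Pair0 (sndC \<cdot> u) (sndC \<cdot> u) \<^bold>= One \<^bold>\<and>
     exq ''m'' (n1 ''f'' \<cdot> Pair0 (fstC \<cdot> u) (Pair0 (n0 ''m'') (Code (Bar (restrT t (sndC \<cdot> u)) (n0 ''m'')))) \<^bold>= ZeroC))"

definition errF :: "tm \<Rightarrow> tm \<Rightarrow> fm" where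
  "errF t u = (\<^bold>\<not> (t \<cdot> u \<^bold>= monusC \<cdot> One \<cdot> chr (VF t u)))"

definition minF :: "tm \<Rightarrow> tm \<Rightarrow> fm" where
  "minF t u = (errF t u \<^bold>\<and>
     \<^bold>\<not> exq ''q'' (errF t (n0 ''q'') \<^bold>\<and> less_in (n1 ''X'') (sndC \<cdot> n0 ''q'') (sndC \<cdot> u)))"

abbreviation less where "less X i j \<equiv> X \<bullet> pr i j = S Z \<and> X \<bullet> pr j i \<noteq> S Z"

definition rs :: "'a \<Rightarrow> 'a \<Rightarrow> 'a \<Rightarrow> 'a" where
  "rs X Y j = ev (upd (upd (upd dflt ''X'' T1 X) ''Y'' T1 Y) ''j'' N j) (restrT (n1 ''Y'') (n0 ''j''))"

definition Vs :: "'a \<Rightarrow> 'a \<Rightarrow> 'a \<Rightarrow> 'a \<Rightarrow> bool" where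
  "Vs X f Y k \<longleftrightarrow> X \<bullet> pr (csnd \<bullet> k) (csnd \<bullet> k) = S Z \<and> thetas f (cfst \<bullet> k) (rs X Y (csnd \<bullet> k))"

definition Err :: "'a \<Rightarrow> 'a \<Rightarrow> 'a \<Rightarrow> 'a \<Rightarrow> bool" where
  "Err X f Y k \<longleftrightarrow> Y \<bullet> k \<noteq> (if Vs X f Y k then S Z else Z)"

definition Min :: "'a \<Rightarrow> 'a \<Rightarrow> 'a \<Rightarrow> 'a \<Rightarrow> bool" where
  "Min X f Y k \<longleftrightarrow> Err X f Y k \<and> \<not> (\<exists>q\<in>D N. Err X f Y q \<and> less X (csnd \<bullet> q) (csnd \<bullet> k))"

text \<open>The excluded names are those bound inside \<open>VF\<close>, \<open>errF\<close> and
  \<open>minF\<close>.\<close>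

definition trm :: "ty \<Rightarrow> tm \<Rightarrow> bool" where
  "trm \<tau> t \<longleftrightarrow> wt t \<and> typ_of t = \<tau> \<and> fvt t \<inter> {(''l'', N), (''m'', N), (''q'', N)} = {}"

lemma qf_less_in [simp]: "qf (less_in s t u)"
  "trm T1 s \<Longrightarrow> wt t \<Longrightarrow> typ_of t = N \<Longrightarrow> wt u \<Longrightarrow> typ_of u = N \<Longrightarrow> wff (less_in s t u)"
  by (simp_all add: less_in_def mem_def trm_def)

lemma wt_restrT [simp]: "wt t \<Longrightarrow> typ_of t = T1 \<Longrightarrow> wt u \<Longrightarrow> typ_of u = N \<Longrightarrow>
    wt (restrT t u) \<and> typ_of (restrT t u) = T1"
  unfolding restrT_def by (rule wt_setof) (simp_all add: less_in_def mem_def)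

lemma rs_D [simp]: "X \<in> D T1 \<Longrightarrow> Y \<in> D T1 \<Longrightarrow> j \<in> D N \<Longrightarrow> rs X Y j \<in> D T1"
  unfolding rs_def by (rule ev_D') simp_all

lemma rs_ap: "X \<in> D T1 \<Longrightarrow> Y \<in> D T1 \<Longrightarrow> j \<in> D N \<Longrightarrow> l \<in> D N \<Longrightarrow>
    rs X Y j \<bullet> l = (if Y \<bullet> l = S Z \<and> less X (csnd \<bullet> l) j then S Z else Z)"
  unfolding rs_def restrT_def by (subst ev_setof) (simp_all add: less_in_def mem_def)

lemma ev_restrT:
  assumes "ok \<rho>" "wt t" "typ_of t = T1" "wt u" "typ_of u = N" "(''l'', N) \<notin> fvt t" "(''l'', N) \<notin> fvt u"
  shows "ev \<rho> (restrT t u) = rs (\<rho> (''X'', T1)) (ev \<rho> t) (ev \<rho> u)"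
proof (rule ext1)
  fix n assume n: "n \<in> D N"
  have X: "\<rho> (''X'', T1) \<in> D T1" "ev \<rho> t \<in> D T1" "ev \<rho> u \<in> D N" using assms by simp_all
  have "ev \<rho> (restrT t u) \<bullet> n =
    (if ev \<rho> t \<bullet> n = S Z \<and> less (\<rho> (''X'', T1)) (csnd \<bullet> n) (ev \<rho> u) then S Z else Z)"
    unfolding restrT_def using assms n by (subst ev_setof) (simp_all add: less_in_def mem_def ev_upd_fresh)
  then show "ev \<rho> (restrT t u) \<bullet> n = rs (\<rho> (''X'', T1)) (ev \<rho> t) (ev \<rho> u) \<bullet> n"
    using rs_ap[OF X n] by simp
qed (use assms in simp_all)

lemma qf_VF [simp]: "qf (VF t u)" "trm T1 t \<Longrightarrow> trm N u \<Longrightarrow> wff (VF t u)"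
  unfolding VF_def trm_def by simp_all

lemma qf_errF [simp]: "qf (errF t u)" "trm T1 t \<Longrightarrow> trm N u \<Longrightarrow> wff (errF t u)"
  unfolding errF_def using wt_chr[of "VF t u"] by (simp_all add: trm_def)

lemma trm_Var [simp]: "trm \<tau> (Var x \<tau>) \<longleftrightarrow> (x, \<tau>) \<notin> {(''l'', N), (''m'', N), (''q'', N)}"
  by (auto simp: trm_def)

lemma sat_VF:
  assumes "ok \<rho>" "\<rho> (''mu'', T2) = mu" "wt t" "typ_of t = T1" "wt u" "typ_of u = N"
    "fvt t \<inter> {(''l'', N), (''m'', N)} = {}" "fvt u \<inter> {(''l'', N), (''m'', N)} = {}"
  shows "sat \<rho> (VF t u) \<longleftrightarrow> Vs (\<rho> (''X'', T1)) (\<rho> (''f'', T1)) (ev \<rho> t) (ev \<rho> u)"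
proof -
  have e: "ev (upd \<rho> ''m'' N a) t = ev \<rho> t" "ev (upd \<rho> ''m'' N a) u = ev \<rho> u" for a
    using assms by (simp_all add: ev_upd_fresh)
  show ?thesis
    using assms unfolding VF_def Vs_def thetas_def sat_connectives(1)
    by (subst sat_exq) (simp_all add: ev_restrT e)
qed

lemma sat_errF:
  assumes "ok \<rho>" "\<rho> (''mu'', T2) = mu" "wt t" "typ_of t = T1" "wt u" "typ_of u = N"
    "fvt t \<inter> {(''l'', N), (''m'', N)} = {}" "fvt u \<inter> {(''l'', N), (''m'', N)} = {}"
  shows "sat \<rho> (errF t u) \<longleftrightarrow> Err (\<rho> (''X'', T1)) (\<rho> (''f'', T1)) (ev \<rho> t) (ev \<rho> u)"
proof -
  have "wff (VF t u)" using assms by (simp add: VF_def)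
  then show ?thesis
    using sat_VF[OF assms] assms by (simp add: errF_def Err_def mn_one)
qed

lemma wff_minF: "trm T1 t \<Longrightarrow> trm N u \<Longrightarrow> wff (minF t u)" and qf_minF [simp]: "qf (minF t u)"
proof -
  have "wff (errF t (n0 ''q''))" if "trm T1 t"
    using that wt_chr[of "VF t (n0 ''q'')"] by (simp add: errF_def VF_def trm_def)
  then show "trm T1 t \<Longrightarrow> trm N u \<Longrightarrow> wff (minF t u)"
    unfolding minF_def by (simp add: less_in_def mem_def trm_def)
  show "qf (minF t u)" unfolding minF_def by (simp add: less_in_def mem_def)
qed

lemma sat_minF:
  assumes "ok \<rho>" "\<rho> (''mu'', T2) = mu" "trm T1 t" "trm N u"
  shows "sat \<rho> (minF t u) \<longleftrightarrow> Min (\<rho> (''X'', T1)) (\<rho> (''f'', T1)) (ev \<rho> t) (ev \<rho> u)"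
proof -
  have e: "ev (upd \<rho> ''q'' N a) t = ev \<rho> t" "ev (upd \<rho> ''q'' N a) u = ev \<rho> u" for a
    using assms by (simp_all add: ev_upd_fresh trm_def)
  have w: "wff (errF t (n0 ''q''))"
    using assms wt_chr[of "VF t (n0 ''q'')"] by (simp add: errF_def VF_def trm_def)
  have "sat (upd \<rho> ''q'' N a) (errF t (n0 ''q'')) \<longleftrightarrow> Err (\<rho> (''X'', T1)) (\<rho> (''f'', T1)) (ev \<rho> t) a"
    if "a \<in> D N" for a
    using assms that by (subst sat_errF) (simp_all add: e trm_def)
  then have "sat \<rho> (exq ''q'' (errF t (n0 ''q'') \<^bold>\<and> less_in (n1 ''X'') (sndC \<cdot> n0 ''q'') (sndC \<cdot> u))) \<longleftrightarrow>
    (\<exists>q\<in>D N. Err (\<rho> (''X'', T1)) (\<rho> (''f'', T1)) (ev \<rho> t) q \<and>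
      less (\<rho> (''X'', T1)) (csnd \<bullet> q) (csnd \<bullet> ev \<rho> u))"
    using assms w by (subst sat_exq) (simp_all add: e less_in_def mem_def trm_def)
  moreover have "sat \<rho> (errF t u) \<longleftrightarrow> Err (\<rho> (''X'', T1)) (\<rho> (''f'', T1)) (ev \<rho> t) (ev \<rho> u)"
    using assms by (intro sat_errF) (auto simp: trm_def)
  ultimately show ?thesis
    by (simp only: minF_def Min_def sat_connectives(1) sat.simps(2,3) simp_thms) blast
qed

lemma ex_pair:
  assumes "k \<in> D N"
  shows "(\<exists>n\<in>D N. \<exists>j\<in>D N. k = pr n j \<and> P n j) \<longleftrightarrow> P (cfst \<bullet> k) (csnd \<bullet> k)"
  using pair_fst_snd[OF assms] assms by (metis ap1_D cunpair_D(2,3) fst_pair snd_pair)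

text \<open>The set quantifier in \<open>Hs\<close> disappears because a restriction exists as
  \<open>rs\<close> and is unique by \<open>ext1\<close>; what is left says that no place is in
  error.\<close>

lemma Hs_iff:
  assumes "X \<in> D T1" "f \<in> D T1" "Y \<in> D T1"
  shows "Hs f X Y \<longleftrightarrow> (\<forall>k\<in>D N. \<not> Err X f Y k)"
proof -
  have restr: "restrs X Y j W \<longleftrightarrow> W = rs X Y j" if "j \<in> D N" "W \<in> D T1" for j W
  proof
    assume W: "restrs X Y j W"
    show "W = rs X Y j"
    proof (rule ext1)
      fix l assume l: "l \<in> D N"
      have "(\<exists>m\<in>D N. \<exists>i\<in>D N. l = pr m i \<and> Y \<bullet> l = S Z \<and> less X i j) \<longleftrightarrow>
        Y \<bullet> l = S Z \<and> less X (csnd \<bullet> l) j"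
        by (rule ex_pair[OF l])
      then have "W \<bullet> l = S Z \<longleftrightarrow> Y \<bullet> l = S Z \<and> less X (csnd \<bullet> l) j"
        using W l unfolding restrs_def by simp
      moreover have "le (W \<bullet> l) (S Z)" using W l by (simp add: restrs_def)
      then have "W \<bullet> l = Z \<or> W \<bullet> l = S Z" using le_S_iff[of "W \<bullet> l" Z] that l by simp
      ultimately show "W \<bullet> l = rs X Y j \<bullet> l" using rs_ap assms that l by auto
    qed (use assms that in simp_all)
  next
    assume "W = rs X Y j"
    moreover have "(\<exists>m\<in>D N. \<exists>i\<in>D N. l = pr m i \<and> Y \<bullet> l = S Z \<and> less X i j) \<longleftrightarrow>
      Y \<bullet> l = S Z \<and> less X (csnd \<bullet> l) j" if "l \<in> D N" for l
      by (rule ex_pair[OF that])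
    ultimately show "restrs X Y j W"
      unfolding restrs_def using rs_ap[OF assms(1,3) that(1)] by (auto simp: S_Z_neq[symmetric])
  qed
  have V: "(\<exists>n\<in>D N. \<exists>j\<in>D N. k = pr n j \<and> X \<bullet> pr j j = S Z \<and>
       (\<exists>W\<in>D T1. restrs X Y j W \<and> thetas f n W)) \<longleftrightarrow> Vs X f Y k" if k: "k \<in> D N" for k
  proof -
    have "(\<exists>W\<in>D T1. restrs X Y j W \<and> thetas f n W) \<longleftrightarrow> thetas f n (rs X Y j)" if "j \<in> D N" for j n
      using restr[OF that] rs_D[OF assms(1,3) that] by blast
    then have "(\<exists>n\<in>D N. \<exists>j\<in>D N. k = pr n j \<and> X \<bullet> pr j j = S Z \<and>
       (\<exists>W\<in>D T1. restrs X Y j W \<and> thetas f n W)) \<longleftrightarrow>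
      (\<exists>n\<in>D N. \<exists>j\<in>D N. k = pr n j \<and> X \<bullet> pr j j = S Z \<and> thetas f n (rs X Y j))" by blast
    then show ?thesis unfolding Vs_def ex_pair[OF k] .
  qed
  have "le (Y \<bullet> k) (S Z) \<and> (Y \<bullet> k = S Z \<longleftrightarrow> Vs X f Y k) \<longleftrightarrow> \<not> Err X f Y k" if "k \<in> D N" for k
    using le_S_iff[of "Y \<bullet> k" Z] assms that by (auto simp: Err_def S_Z_neq[symmetric])
  then show ?thesis unfolding Hs_def using V by (simp add: ball_conj_distrib[symmetric]) 
qed

lemma LO_field: "LOs X \<Longrightarrow> i \<in> D N \<Longrightarrow> j \<in> D N \<Longrightarrow> less X i j \<Longrightarrow> X \<bullet> pr i i = S Z \<and> X \<bullet> pr j j = S Z"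
  unfolding LOs_def by blast

lemma LO_total: "LOs X \<Longrightarrow> i \<in> D N \<Longrightarrow> j \<in> D N \<Longrightarrow> X \<bullet> pr i i = S Z \<Longrightarrow> X \<bullet> pr j j = S Z \<Longrightarrow>
    X \<bullet> pr i j = S Z \<or> X \<bullet> pr j i = S Z"
  unfolding LOs_def by blast

lemma LO_trans: "LOs X \<Longrightarrow> i \<in> D N \<Longrightarrow> j \<in> D N \<Longrightarrow> k \<in> D N \<Longrightarrow> X \<bullet> pr i j = S Z \<Longrightarrow> X \<bullet> pr j k = S Z \<Longrightarrow>
    X \<bullet> pr i k = S Z"
  unfolding LOs_def by blast

lemma less_le_trans: "LOs X \<Longrightarrow> i \<in> D N \<Longrightarrow> j \<in> D N \<Longrightarrow> k \<in> D N \<Longrightarrow> less X i j \<Longrightarrow> X \<bullet> pr j k = S Z \<Longrightarrow> less X i k"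
  using LO_trans by blast

text \<open>Dependent choice through \<open>mu\<close>: were there no minimal column,
  \<open>mu\<close> would select for each zero of \<open>d\<close> another one in an earlier column,
  and iterating this by \<open>RecC\<close> would give a descending sequence.\<close>

lemma wo_min:
  assumes X: "X \<in> D T1" "WOs X" and d: "d \<in> D T1" and k0: "k0 \<in> D N" "d \<bullet> k0 = Z"
  shows "\<exists>k\<in>D N. d \<bullet> k = Z \<and> \<not> (\<exists>q\<in>D N. d \<bullet> q = Z \<and> less X (csnd \<bullet> q) (csnd \<bullet> k))"
proof (rule ccontr)
  assume no: "\<not> ?thesis"
  let ?\<phi> = "n1 ''d'' \<cdot> n0 ''q'' \<^bold>= ZeroC \<^bold>\<and> less_in (n1 ''X'') (sndC \<cdot> n0 ''q'') (sndC \<cdot> n0 ''k'')"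
  let ?\<rho> = "upd (upd (upd dflt ''mu'' T2 mu) ''X'' T1 X) ''d'' T1 d"
  define st where "st = ev ?\<rho> (lam ''k'' N (Var ''mu'' T2 \<cdot> lam ''q'' N (chr ?\<phi>)))"
  have q: "qf ?\<phi>" "wff ?\<phi>" by simp_all
  have st_D: "st \<in> D T1" unfolding st_def using X d q by simp
  have st: "d \<bullet> (st \<bullet> k) = Z \<and> less X (csnd \<bullet> (st \<bullet> k)) (csnd \<bullet> k)" if k: "k \<in> D N" "d \<bullet> k = Z" for k
  proof -
    let ?m = "mu \<bullet> ev (upd ?\<rho> ''k'' N k) (lam ''q'' N (chr ?\<phi>))"
    have s: "st \<bullet> k = ?m" unfolding st_def using X d q k by simp
    have "sat (upd (upd ?\<rho> ''k'' N k) ''q'' N ?m) ?\<phi>"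
      by (rule mu_least[OF q]) (use no X d k in \<open>auto simp: less_in_def mem_def\<close>)
    then show ?thesis unfolding s by (simp add: less_in_def mem_def)
  qed
  define it where "it = ev (upd (upd dflt ''s'' T1 st) ''k'' N k0)
    (lam ''n'' N (RecC \<cdot> n0 ''n'' \<cdot> n0 ''k'' \<cdot> lam ''y'' N (lam ''x'' N (n1 ''s'' \<cdot> n0 ''y''))))"
  have it_D: "it \<in> D T1" unfolding it_def using st_D k0 by simp
  have it: "it \<bullet> Z = k0" "\<And>n. n \<in> D N \<Longrightarrow> it \<bullet> S n = st \<bullet> (it \<bullet> n)"
    unfolding it_def using st_D k0 by (simp_all add: rec_zero rec_suc ev_upd_fresh)
  have dit: "d \<bullet> (it \<bullet> n) = Z" if "n \<in> D N" for n
  proof -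
    have "sat (upd (upd (upd dflt ''d'' T1 d) ''i'' T1 it) ''x'' N n) (n1 ''d'' \<cdot> (n1 ''i'' \<cdot> n0 ''x'') \<^bold>= ZeroC)"
      by (rule induct) (use that d it_D it st k0 in simp_all)
    then show ?thesis by simp
  qed
  define h where "h = ev (upd dflt ''i'' T1 it) (lam ''n'' N (sndC \<cdot> (n1 ''i'' \<cdot> n0 ''n'')))"
  have h: "h \<in> D T1" "\<And>n. n \<in> D N \<Longrightarrow> h \<bullet> n = csnd \<bullet> (it \<bullet> n)"
    unfolding h_def using it_D by simp_all
  have desc: "less X (h \<bullet> S n) (h \<bullet> n)" if "n \<in> D N" for n
    using st[OF _ dit[OF that]] that it it_D h by simp
  have "X \<bullet> pr (h \<bullet> n) (h \<bullet> n) = S Z" if "n \<in> D N" for n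
    using LO_field[of X "h \<bullet> S n" "h \<bullet> n"] desc[OF that] X that h(1) unfolding WOs_def by simp
  then show False using X(2) desc h(1) unfolding WOs_def by blast
qed

text \<open>By uniqueness of the hierarchy, two candidates without errors below \<open>j\<close> agree below \<open>j\<close>.\<close>

lemma agree:
  assumes X: "X \<in> D T1" "WOs X" and f: "f \<in> D T1" and Y: "Y \<in> D T1" "Y' \<in> D T1" and j: "j \<in> D N"
    and ok: "\<And>l. l \<in> D N \<Longrightarrow> less X (csnd \<bullet> l) j \<Longrightarrow> \<not> Err X f Y l \<and> \<not> Err X f Y' l"
  shows "rs X Y j = rs X Y' j"
proof -
  have "Y \<bullet> l = Y' \<bullet> l" if l: "l \<in> D N" "less X (csnd \<bullet> l) j" for l
  proof (rule ccontr)
    assume neq: "Y \<bullet> l \<noteq> Y' \<bullet> l"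
    let ?\<phi> = "\<^bold>\<not> (n1 ''Y'' \<cdot> n0 ''k'' \<^bold>= n1 ''U'' \<cdot> n0 ''k'') \<^bold>\<and> less_in (n1 ''X'') (sndC \<cdot> n0 ''k'') (n0 ''j'')"
    let ?\<rho> = "upd (upd (upd (upd dflt ''X'' T1 X) ''Y'' T1 Y) ''U'' T1 Y') ''j'' N j"
    define d where "d = ev ?\<rho> (lam ''k'' N (chr ?\<phi>))"
    have q: "qf ?\<phi>" "wff ?\<phi>" by simp_all
    have d_D: "d \<in> D T1" unfolding d_def using X Y j q by simp
    have d: "d \<bullet> k = Z \<longleftrightarrow> Y \<bullet> k \<noteq> Y' \<bullet> k \<and> less X (csnd \<bullet> k) j" if "k \<in> D N" for k
    proof -
      have "d \<bullet> k = ev (upd ?\<rho> ''k'' N k) (chr ?\<phi>)" unfolding d_def using X Y j q that by simp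
      moreover have "ev (upd ?\<rho> ''k'' N k) (chr ?\<phi>) = Z \<longleftrightarrow> sat (upd ?\<rho> ''k'' N k) ?\<phi>"
        using ev_chr[OF q, of "upd ?\<rho> ''k'' N k"] X Y j that by simp
      moreover have "sat (upd ?\<rho> ''k'' N k) ?\<phi> \<longleftrightarrow> Y \<bullet> k \<noteq> Y' \<bullet> k \<and> less X (csnd \<bullet> k) j"
        by (simp add: less_in_def mem_def)
      ultimately show ?thesis by simp
    qed
    \<comment> \<open>A first disagreement: below its column the candidates coincide, so they
      prescribe the same value there, and neither is in error.\<close>
    obtain k where k: "k \<in> D N" "Y \<bullet> k \<noteq> Y' \<bullet> k" "less X (csnd \<bullet> k) j"
      and mn: "\<And>q. q \<in> D N \<Longrightarrow> less X (csnd \<bullet> q) (csnd \<bullet> k) \<Longrightarrow> d \<bullet> q \<noteq> Z"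
      using wo_min[OF X d_D l(1)] d neq l by auto
    have "rs X Y (csnd \<bullet> k) = rs X Y' (csnd \<bullet> k)"
    proof (rule ext1)
      fix n assume n: "n \<in> D N"
      have "Y \<bullet> n = Y' \<bullet> n" if "less X (csnd \<bullet> n) (csnd \<bullet> k)"
        using mn[OF n that] d[OF n] less_le_trans[of X "csnd \<bullet> n" "csnd \<bullet> k" j] X that k n j
        unfolding WOs_def by simp
      then show "rs X Y (csnd \<bullet> k) \<bullet> n = rs X Y' (csnd \<bullet> k) \<bullet> n"
        using rs_ap X Y k n by auto
    qed (use X Y k in simp_all)
    then have "Vs X f Y k = Vs X f Y' k" by (simp add: Vs_def)
    then show False using ok[OF k(1,3)] k(2) by (simp add: Err_def)
  qed
  then have "rs X Y j \<bullet> l = rs X Y' j \<bullet> l" if "l \<in> D N" for l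
    using rs_ap[OF X(1) Y(1) j that] rs_ap[OF X(1) Y(2) j that] that by auto
  then show ?thesis by (rule ext1[OF rs_D[OF X(1) Y(1) j] rs_D[OF X(1) Y(2) j]])
qed

lemma le_iff_S: "a \<in> D N \<Longrightarrow> b \<in> D N \<Longrightarrow> le a b \<longleftrightarrow> le (S a) b \<or> a = b"
  using le_S_iff[of a b] le_S_iff[of "S a" b] suc_inj[of a b] by auto

text \<open>The length \<open>n\<close> may be nonstandard, so a maximum has to be found by internal
  induction; \<open>exq\<close> makes the statement quantifier-free.\<close>

lemma field_max:
  assumes X: "X \<in> D T1" "LOs X" and J: "J \<in> D T1" and n: "n \<in> D N"
    and ex: "i \<in> D N" "le (S i) n" "X \<bullet> pr (J \<bullet> i) (J \<bullet> i) = S Z"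
  shows "\<exists>s\<in>D N. le (S s) n \<and> X \<bullet> pr (J \<bullet> s) (J \<bullet> s) = S Z \<and>
    (\<forall>i\<in>D N. le (S i) n \<and> X \<bullet> pr (J \<bullet> i) (J \<bullet> i) = S Z \<longrightarrow> X \<bullet> pr (J \<bullet> i) (J \<bullet> s) = S Z)"
proof -
  define F where "F i = (X \<bullet> pr (J \<bullet> i) (J \<bullet> i) = S Z)" for i
  define L where "L i s = (X \<bullet> pr (J \<bullet> i) (J \<bullet> s) = S Z)" for i s
  define P where "P n = ((\<exists>i\<in>D N. le (S i) n \<and> F i) \<longrightarrow> (\<exists>s\<in>D N. le (S s) n \<and> F s \<and>
    \<not> (\<exists>i\<in>D N. le (S i) n \<and> F i \<and> \<not> L i s)))" for n
  let ?F = "\<lambda>i. n1 ''X'' \<cdot> Pair0 (n1 ''J'' \<cdot> n0 i) (n1 ''J'' \<cdot> n0 i) \<^bold>= One"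
  let ?\<phi>1 = "n0 ''i'' \<^bold>< n0 ''x'' \<^bold>\<and> ?F ''i''"
  let ?\<phi>2 = "n0 ''i'' \<^bold>< n0 ''x'' \<^bold>\<and> ?F ''i'' \<^bold>\<and> \<^bold>\<not> (n1 ''X'' \<cdot> Pair0 (n1 ''J'' \<cdot> n0 ''i'') (n1 ''J'' \<cdot> n0 ''s'') \<^bold>= One)"
  let ?\<phi>3 = "n0 ''s'' \<^bold>< n0 ''x'' \<^bold>\<and> ?F ''s'' \<^bold>\<and> \<^bold>\<not> exq ''i'' ?\<phi>2"
  let ?\<rho> = "upd (upd (upd dflt ''mu'' T2 mu) ''X'' T1 X) ''J'' T1 J"
  let ?\<phi> = "exq ''i'' ?\<phi>1 \<^bold>\<longrightarrow> exq ''s'' ?\<phi>3"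
  have q: "qf ?\<phi>1" "wff ?\<phi>1" "qf ?\<phi>2" "wff ?\<phi>2" "qf ?\<phi>3" "wff ?\<phi>3" by simp_all
  have sat: "sat (upd ?\<rho> ''x'' N n) ?\<phi> \<longleftrightarrow> P n" if "n \<in> D N" for n
  proof -
    have 1: "sat (upd ?\<rho> ''x'' N n) (exq ''i'' ?\<phi>1) \<longleftrightarrow> (\<exists>i\<in>D N. le (S i) n \<and> F i)"
      using that X J by (subst sat_exq[OF q(1,2)]) (simp_all add: F_def)
    have 2: "sat (upd (upd ?\<rho> ''x'' N n) ''s'' N s) (exq ''i'' ?\<phi>2) \<longleftrightarrow> (\<exists>i\<in>D N. le (S i) n \<and> F i \<and> \<not> L i s)"
      if "s \<in> D N" for s
      using that \<open>n \<in> D N\<close> X J by (subst sat_exq[OF q(3,4)]) (simp_all add: F_def L_def)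
    have 3: "sat (upd ?\<rho> ''x'' N n) (exq ''s'' ?\<phi>3) \<longleftrightarrow> (\<exists>s\<in>D N. sat (upd (upd ?\<rho> ''x'' N n) ''s'' N s) ?\<phi>3)"
      using that X J by (subst sat_exq[OF q(5,6)]) simp_all
    have 4: "sat (upd (upd ?\<rho> ''x'' N n) ''s'' N s) ?\<phi>3 \<longleftrightarrow> le (S s) n \<and> F s \<and>
      \<not> (\<exists>i\<in>D N. le (S i) n \<and> F i \<and> \<not> L i s)" if "s \<in> D N" for s
      unfolding 2[OF that, symmetric] by (simp add: F_def del: sat_exq)
    have 5: "(\<exists>s\<in>D N. sat (upd (upd ?\<rho> ''x'' N n) ''s'' N s) ?\<phi>3) \<longleftrightarrow>
      (\<exists>s\<in>D N. le (S s) n \<and> F s \<and> \<not> (\<exists>i\<in>D N. le (S i) n \<and> F i \<and> \<not> L i s))"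
      by (rule bex_cong[OF refl 4])
    have "sat (upd ?\<rho> ''x'' N n) ?\<phi> \<longleftrightarrow>
      (sat (upd ?\<rho> ''x'' N n) (exq ''i'' ?\<phi>1) \<longrightarrow> sat (upd ?\<rho> ''x'' N n) (exq ''s'' ?\<phi>3))"
      by (rule sat.simps(3))
    then show ?thesis unfolding P_def 1 3 5 .
  qed
  have "sat (upd ?\<rho> ''x'' N n) ?\<phi>"
  proof (rule induct)
    show "sat (upd ?\<rho> ''x'' N Z) ?\<phi>"
      unfolding sat[OF csts_D(1)] P_def using suc_nonzero by auto
  next
    fix n assume n: "n \<in> D N" and "sat (upd ?\<rho> ''x'' N n) ?\<phi>"
    then have IH: "P n" using sat by blast
    have lt: "le (S i) (S n) \<longleftrightarrow> le (S i) n \<or> i = n" if "i \<in> D N" for i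
      using that n le_iff_S[of i n] by simp
    have L_tr: "L i k" if "L i j" "L j k" "i \<in> D N" "j \<in> D N" "k \<in> D N" for i j k
      using that X(2) J LO_trans[of X "J \<bullet> i" "J \<bullet> j" "J \<bullet> k"] by (simp add: L_def)
    have L_tot: "L i j \<or> L j i" if "F i" "F j" "i \<in> D N" "j \<in> D N" for i j
      using that J LO_total[OF X(2), of "J \<bullet> i" "J \<bullet> j"] by (simp add: F_def L_def)
    have "P (S n)"
      unfolding P_def
    proof
      assume "\<exists>i\<in>D N. le (S i) (S n) \<and> F i"
      show "\<exists>s\<in>D N. le (S s) (S n) \<and> F s \<and> \<not> (\<exists>i\<in>D N. le (S i) (S n) \<and> F i \<and> \<not> L i s)"
      proof (cases "\<exists>i\<in>D N. le (S i) n \<and> F i")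
        case True
        then obtain s where s: "s \<in> D N" "le (S s) n" "F s"
          "\<And>i. i \<in> D N \<Longrightarrow> le (S i) n \<Longrightarrow> F i \<Longrightarrow> L i s"
          using IH unfolding P_def by blast
        show ?thesis
        proof (cases "F n \<and> \<not> L n s")
          case True
          then have "L s n" "L n n" using L_tot s n by blast+
          then have "L i n" if "i \<in> D N" "le (S i) (S n)" "F i" for i
            using lt[OF that(1)] that s L_tr[of i s n] n by blast
          then show ?thesis using True n lt[OF n] by blast
        next
          case False
          then show ?thesis using s lt by blast
        qed
      next
        case False
        then have "F n" using \<open>\<exists>i\<in>D N. le (S i) (S n) \<and> F i\<close> lt by blast
        then have "L n n" using L_tot n by blast
        then show ?thesis using False \<open>F n\<close> n lt by blast
      qed
    qed
    then show "sat (upd ?\<rho> ''x'' N (S n)) ?\<phi>" using sat n by simp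
  qed (use X J n q in simp_all)
  then have "P n" using sat n by blast
  then show ?thesis using ex unfolding P_def F_def L_def by blast
qed

text \<open>The successor is essential: a neighbourhood fixes the values at places strictly below
  \<open>G(Y)\<close>, and the erroneous place itself has to be among them.\<close>

definition GT :: tm where
  "GT = lam ''Y'' T1 (Succ (Var ''mu'' T2 \<cdot> lam ''k'' N (chr (minF (n1 ''Y'') (n0 ''k'')))))"

lemma wt_GT [simp]: "wt GT" "typ_of GT = T2"
  using wff_minF[of "n1 ''Y''" "n0 ''k''"] by (simp_all add: GT_def)

lemma G_spec:
  assumes \<rho>: "ok \<rho>" "\<rho> (''mu'', T2) = mu" "\<rho> (''X'', T1) = X" "\<rho> (''f'', T1) = f" and X: "WOs X"
    and Y: "Y \<in> D T1" and err: "q \<in> D N" "Err X f Y q"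
  shows "\<exists>k\<in>D N. Min X f Y k \<and> ev \<rho> GT \<bullet> Y = S k"
proof -
  have D: "X \<in> D T1" "f \<in> D T1" using \<rho> ok_D by blast+
  let ?\<rho> = "upd \<rho> ''Y'' T1 Y"
  define d where "d = ev ?\<rho> (lam ''k'' N (chr (errF (n1 ''Y'') (n0 ''k''))))"
  have d_D: "d \<in> D T1" unfolding d_def using \<rho> Y by simp
  have d: "d \<bullet> k = Z \<longleftrightarrow> Err X f Y k" if "k \<in> D N" for k
  proof -
    have "d \<bullet> k = Z \<longleftrightarrow> sat (upd ?\<rho> ''k'' N k) (errF (n1 ''Y'') (n0 ''k''))"
      unfolding d_def using \<rho> Y that by simp
    also have "\<dots> \<longleftrightarrow> Err X f Y k" using \<rho> Y that by (subst sat_errF) simp_all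
    finally show ?thesis .
  qed
  let ?m = "mu \<bullet> ev ?\<rho> (lam ''k'' N (chr (minF (n1 ''Y'') (n0 ''k''))))"
  have w: "wff (minF (n1 ''Y'') (n0 ''k''))" by (rule wff_minF) simp_all
  have m: "sat (upd ?\<rho> ''k'' N k) (minF (n1 ''Y'') (n0 ''k'')) \<longleftrightarrow> Min X f Y k" if "k \<in> D N" for k
    using \<rho> Y that by (subst sat_minF) simp_all
  have "\<exists>k\<in>D N. Min X f Y k"
    using wo_min[OF D(1) X d_D err(1)] d err unfolding Min_def by blast
  then have "sat (upd ?\<rho> ''k'' N ?m) (minF (n1 ''Y'') (n0 ''k''))"
    using m \<rho> Y by (intro mu_least w) auto
  moreover have mD: "?m \<in> D N" using \<rho> Y w by simp
  ultimately have "Min X f Y ?m" using m by blast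
  moreover have "ev \<rho> GT \<bullet> Y = S ?m" unfolding GT_def using \<rho> Y w by simp
  ultimately show ?thesis using mD by blast
qed

lemma ex_correct:
  assumes \<rho>: "ok \<rho>" "\<rho> (''mu'', T2) = mu" "\<rho> (''X'', T1) = X" "\<rho> (''f'', T1) = f" and X: "WOs X"
  defines "w \<equiv> Theta \<bullet> ev \<rho> GT"
  shows "\<exists>i\<in>D N. le (S i) (cst (LenC T1) \<bullet> w) \<and> (\<forall>k\<in>D N. \<not> Err X f (cst (EntC T1) \<bullet> w \<bullet> i) k)"
proof (rule ccontr)
  assume no: "\<not> ?thesis"
  have D: "X \<in> D T1" "f \<in> D T1" using \<rho> ok_D by blast+
  define G where "G = ev \<rho> GT"
  have G_D: "G \<in> D T2" unfolding G_def using \<rho> by simp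
  have w_D: "w \<in> D (Star T1)" unfolding w_def using ap_D[OF Theta_D] \<rho> by simp
  define g where "g i = cst (EntC T1) \<bullet> w \<bullet> i" for i
  define len where "len = cst (LenC T1) \<bullet> w"
  have len_D: "len \<in> D N" using w_D by (simp add: len_def)
  have g_D: "g i \<in> D T1" if "i \<in> D N" for i using w_D that by (simp add: g_def)
  define K where "K i = cpred \<bullet> (G \<bullet> g i)" for i
  have K: "K i \<in> D N" "G \<bullet> g i = S (K i)" "Min X f (g i) (K i)" if i: "i \<in> D N" "le (S i) len" for i
  proof -
    obtain q where "q \<in> D N" "Err X f (g i) q" using no i unfolding g_def len_def by blast
    then obtain k where "k \<in> D N" "Min X f (g i) k" "G \<bullet> g i = S k"
      using G_spec[OF \<rho> X g_D[OF i(1)]] unfolding G_def by blast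
    then show "K i \<in> D N" "G \<bullet> g i = S (K i)" "Min X f (g i) (K i)" by (simp_all add: K_def)
  qed
  define J where "J = ev (upd (upd dflt ''w'' (Star T1) w) ''G'' T2 G)
    (lam ''i'' N (sndC \<cdot> (predC \<cdot> (Var ''G'' T2 \<cdot> (EntC T1 \<cdot> Var ''w'' (Star T1) \<cdot> n0 ''i'')))))"
  have J: "J \<in> D T1" "\<And>i. i \<in> D N \<Longrightarrow> J \<bullet> i = csnd \<bullet> K i"
    unfolding J_def K_def g_def using w_D G_D by simp_all
  have LO: "LOs X" using X WOs_def by blast
  \<comment> \<open>\<open>W\<close> is to differ from each entry at the place \<open>K i\<close> of
    its error, a place that the neighbourhood of that entry fixes.\<close>
  have "\<exists>W\<in>D T1. (\<forall>l\<in>D N. le (W \<bullet> l) (S Z)) \<and> (\<forall>i\<in>D N. le (S i) len \<longrightarrow> W \<bullet> K i \<noteq> g i \<bullet> K i)"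
  proof (cases "\<exists>i\<in>D N. le (S i) len \<and> X \<bullet> pr (J \<bullet> i) (J \<bullet> i) = S Z")
    \<comment> \<open>None of the errors lies in a column of the field, so the prescribed value is 0
      at each of them and the empty set avoids all entries.\<close>
    case False
    let ?W = "clo (lam ''l'' N ZeroC)"
    have W: "?W \<in> D T1" "\<And>l. l \<in> D N \<Longrightarrow> ?W \<bullet> l = Z" by simp_all
    have "?W \<bullet> K i \<noteq> g i \<bullet> K i" if i: "i \<in> D N" "le (S i) len" for i
    proof -
      have "\<not> Vs X f (g i) (K i)" using False i J by (simp add: Vs_def)
      then show ?thesis using K(3)[OF i] W(2)[OF K(1)[OF i]] by (auto simp: Min_def Err_def)
    qed
    then show ?thesis using W by (intro bexI[of _ ?W]) simp_all
  next
    case True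
    then obtain s where s: "s \<in> D N" "le (S s) len" "X \<bullet> pr (J \<bullet> s) (J \<bullet> s) = S Z"
      and mx: "\<And>i. i \<in> D N \<Longrightarrow> le (S i) len \<Longrightarrow> X \<bullet> pr (J \<bullet> i) (J \<bullet> i) = S Z \<Longrightarrow> X \<bullet> pr (J \<bullet> i) (J \<bullet> s) = S Z"
      using field_max[OF D(1) LO J(1) len_D] by blast
    have Js: "J \<bullet> s \<in> D N" using s J(1) by simp
    let ?\<rho> = "upd (upd \<rho> ''Y'' T1 (g s)) ''j'' N (J \<bullet> s)"
    let ?\<phi> = "n1 ''X'' \<cdot> Pair0 (sndC \<cdot> n0 ''k'') (n0 ''j'') \<^bold>= One \<^bold>\<and> VF (n1 ''Y'') (n0 ''k'')"
    \<comment> \<open>The values prescribed by the entry \<open>g s\<close> in the columns up to the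
      maximal one, and nothing beyond.\<close>
    define W where "W = ev ?\<rho> (setof ''k'' ?\<phi>)"
    have q: "qf ?\<phi>" "wff ?\<phi>" by simp_all
    have W_D: "W \<in> D T1" unfolding W_def using \<rho> g_D s Js wt_setof[OF q] by simp
    have W: "W \<bullet> k = (if X \<bullet> pr (csnd \<bullet> k) (J \<bullet> s) = S Z \<and> Vs X f (g s) k then S Z else Z)"
      if k: "k \<in> D N" for k
    proof -
      have "sat (upd ?\<rho> ''k'' N k) (VF (n1 ''Y'') (n0 ''k'')) \<longleftrightarrow> Vs X f (g s) k"
        using \<rho> g_D s Js k by (subst sat_VF) simp_all
      then show ?thesis
        unfolding W_def using \<rho> g_D s Js k by (subst ev_setof[OF q]) simp_all
    qed
    have "W \<bullet> K i \<noteq> g i \<bullet> K i" if i: "i \<in> D N" "le (S i) len" for i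
    proof (cases "X \<bullet> pr (J \<bullet> i) (J \<bullet> i) = S Z")
      case True
      have Ji: "J \<bullet> i \<in> D N" using i J(1) by simp
      have le: "X \<bullet> pr (J \<bullet> i) (J \<bullet> s) = S Z" using mx i True by blast
      \<comment> \<open>The errors of \<open>g i\<close> and \<open>g s\<close> are minimal and
        \<open>J i\<close> is at most \<open>J s\<close>, so neither entry has an error below
        \<open>J i\<close>. Hence both prescribe the same value at \<open>K i\<close>, where
        \<open>g i\<close> is wrong.\<close>
      have "rs X (g s) (J \<bullet> i) = rs X (g i) (J \<bullet> i)"
      proof (rule agree[OF D(1) X D(2) g_D[OF s(1)] g_D[OF i(1)] Ji])
        fix l assume l: "l \<in> D N" "less X (csnd \<bullet> l) (J \<bullet> i)"
        then have "less X (csnd \<bullet> l) (J \<bullet> s)"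
          using less_le_trans[OF LO _ Ji Js _ le, of "csnd \<bullet> l"] by simp
        then show "\<not> Err X f (g s) l \<and> \<not> Err X f (g i) l"
          using K(3)[OF i] K(3)[OF s(1,2)] l J(2) i s unfolding Min_def by auto
      qed
      then have "Vs X f (g s) (K i) = Vs X f (g i) (K i)" using J(2) i by (simp add: Vs_def)
      then have "W \<bullet> K i = (if Vs X f (g i) (K i) then S Z else Z)"
        using W[OF K(1)[OF i]] le J(2) i by simp
      then show ?thesis using K(3)[OF i] by (auto simp: Min_def Err_def)
    next
      case False
      \<comment> \<open>Outside the field the prescribed value is 0, and \<open>W\<close> has this
        value too.\<close>
      then have "\<not> Vs X f (g i) (K i)" "\<not> Vs X f (g s) (K i)" using i J by (simp_all add: Vs_def)
      then show ?thesis using K(3)[OF i] W[OF K(1)[OF i]] by (auto simp: Min_def Err_def)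
    qed
    moreover have "le (W \<bullet> l) (S Z)" if "l \<in> D N" for l using W[OF that] by simp
    ultimately show ?thesis using W_D by blast
  qed
  then obtain W where W: "W \<in> D T1" "\<And>l. l \<in> D N \<Longrightarrow> le (W \<bullet> l) (S Z)"
    "\<And>i. i \<in> D N \<Longrightarrow> le (S i) len \<Longrightarrow> W \<bullet> K i \<noteq> g i \<bullet> K i" by blast
  obtain i where i: "i \<in> D N" "le (S i) len" "\<And>n. n \<in> D N \<Longrightarrow> le (S n) (G \<bullet> g i) \<Longrightarrow> W \<bullet> n = g i \<bullet> n"
    using sff[OF G_D W(1,2)] unfolding w_def[folded G_def, symmetric] g_def len_def by blast
  have "le (S (K i)) (G \<bullet> g i)" using K[OF i(1,2)] by simp
  then show False using i W(3) K(1) by blast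
qed

text \<open>Freedom from errors is arithmetical, so \<open>mu\<close> can search the entries for a
  correct one, uniformly in \<open>X\<close> and \<open>f\<close>.\<close>

definition PhiT :: tm where
  "PhiT = lam ''X'' T1 (lam ''f'' T1 (lam ''w'' (Star T1) (EntC T1 \<cdot> Var ''w'' (Star T1) \<cdot>
     (Var ''mu'' T2 \<cdot> lam ''i'' N (chr (n0 ''i'' \<^bold>< LenC T1 \<cdot> Var ''w'' (Star T1) \<^bold>\<and>
        \<^bold>\<not> exq ''k'' (errF (EntC T1 \<cdot> Var ''w'' (Star T1) \<cdot> n0 ''i'') (n0 ''k'')))))) \<cdot>
     (Var ''Theta'' (T2 \<rightarrow> Star T1) \<cdot> GT)))"

lemma mu2_uatr: "sat dflt UATR"
proof -
  let ?\<sigma> = "upd (upd dflt ''mu'' T2 mu) ''Theta'' (T2 \<rightarrow> Star T1) Theta"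
  let ?t = "EntC T1 \<cdot> Var ''w'' (Star T1) \<cdot> n0 ''i''"
  let ?\<phi> = "n0 ''i'' \<^bold>< LenC T1 \<cdot> Var ''w'' (Star T1) \<^bold>\<and> \<^bold>\<not> exq ''k'' (errF ?t (n0 ''k''))"
  have e: "qf (errF ?t (n0 ''k''))" "wff (errF ?t (n0 ''k''))" by (simp, rule qf_errF) (simp_all add: trm_def)
  have q: "qf ?\<phi>" "wff ?\<phi>" using e by simp_all
  have Phi_D: "ev ?\<sigma> PhiT \<in> D (T1 \<rightarrow> T1 \<rightarrow> T1)"
    unfolding PhiT_def using q Theta_D by simp
  have "Hs f X (ev ?\<sigma> PhiT \<bullet> X \<bullet> f)" if X: "X \<in> D T1" and f: "f \<in> D T1" and WO: "WOs X" for X f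
  proof -
  let ?\<rho> = "upd (upd ?\<sigma> ''X'' T1 X) ''f'' T1 f"
  have \<rho>: "ok ?\<rho>" "?\<rho> (''mu'', T2) = mu" "?\<rho> (''X'', T1) = X" "?\<rho> (''f'', T1) = f"
    using X f Theta_D by simp_all
  define w where "w = Theta \<bullet> ev ?\<rho> GT"
  have w_D: "w \<in> D (Star T1)" unfolding w_def using ap_D[OF Theta_D] \<rho> by simp
  let ?m = "mu \<bullet> ev (upd ?\<rho> ''w'' (Star T1) w) (lam ''i'' N (chr ?\<phi>))"
  have m_D: "?m \<in> D N" using \<rho> w_D q by simp
  have sat: "sat (upd (upd ?\<rho> ''w'' (Star T1) w) ''i'' N i) ?\<phi> \<longleftrightarrow>
    le (S i) (cst (LenC T1) \<bullet> w) \<and> (\<forall>k\<in>D N. \<not> Err X f (cst (EntC T1) \<bullet> w \<bullet> i) k)" if i: "i \<in> D N" for i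
  proof -
    let ?\<rho>i = "upd (upd ?\<rho> ''w'' (Star T1) w) ''i'' N i"
    have "sat (upd ?\<rho>i ''k'' N k) (errF ?t (n0 ''k'')) \<longleftrightarrow> Err X f (cst (EntC T1) \<bullet> w \<bullet> i) k" if "k \<in> D N" for k
      using \<rho>(1) w_D i that by (subst sat_errF) simp_all
    then have "sat ?\<rho>i (exq ''k'' (errF ?t (n0 ''k''))) \<longleftrightarrow> (\<exists>k\<in>D N. Err X f (cst (EntC T1) \<bullet> w \<bullet> i) k)"
      using \<rho>(1) w_D i by (subst sat_exq[OF e]) simp_all
    then show ?thesis by (simp del: sat_exq)
  qed
  have "sat (upd (upd ?\<rho> ''w'' (Star T1) w) ''i'' N ?m) ?\<phi>"
    by (rule mu_least[OF q]) (use ex_correct[OF \<rho> WO] sat \<rho>(1) w_D in \<open>auto simp: w_def\<close>)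
  then have "\<forall>k\<in>D N. \<not> Err X f (cst (EntC T1) \<bullet> w \<bullet> ?m) k" using sat[OF m_D] by blast
  then have "Hs f X (cst (EntC T1) \<bullet> w \<bullet> ?m)" using Hs_iff X f w_D m_D by simp
  moreover have "ev ?\<sigma> PhiT \<bullet> X \<bullet> f = cst (EntC T1) \<bullet> w \<bullet> ?m"
    unfolding PhiT_def using X f Theta_D q w_D by (simp add: w_def)
  ultimately show "Hs f X (ev ?\<sigma> PhiT \<bullet> X \<bullet> f)" by simp
  qed
  then show ?thesis unfolding sat_UATR using Phi_D by blast
qed

end

section \<open>The equivalence is provable\<close>

definition clean2 :: "fm \<Rightarrow> bool" where
  "clean2 \<phi> \<longleftrightarrow> clean \<phi> \<and> (\<forall>x \<tau>. (x, \<tau>) \<in> fv \<phi> \<longrightarrow> \<not> rsv x)"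

lemma clean2_simps [simp]:
  "clean2 (s \<^bold>= t) \<longleftrightarrow> (\<forall>p\<in>fvt s \<union> fvt t. \<not> rsv (fst p))"
  "clean2 \<^bold>\<bottom>"
  "clean2 (\<phi> \<^bold>\<longrightarrow> \<psi>) \<longleftrightarrow> clean2 \<phi> \<and> clean2 \<psi>"
  by (auto simp: clean2_def clean_def) force+

lemma clean2_all [simp]: "\<not> rsv x \<Longrightarrow> clean2 \<phi> \<Longrightarrow> clean2 (\<^bold>\<forall>x\<^bold>:\<tau>. \<phi>)"
  by (auto simp: clean2_def clean_def)

lemma clean2_eqF [simp]:
  assumes "\<forall>p\<in>fvt s \<union> fvt t. \<not> rsv (fst p)"
  shows "clean2 (eqF \<tau> s t)"
proof -
  have "\<not> rsv x" if "(x, \<sigma>) \<in> fv (eqF \<tau> s t)" for x \<sigma>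
    using fv_eqF[of \<tau> s t] assms that by (metis fst_conv subsetD)
  then show ?thesis unfolding clean2_def using clean_eqF by blast
qed

lemma clean2_qf: "qf \<phi> \<Longrightarrow> (\<And>x \<tau>. (x, \<tau>) \<in> fv \<phi> \<Longrightarrow> \<not> rsv x) \<Longrightarrow> clean2 \<phi>"
  by (induction \<phi>) (auto, blast+)

lemma fvt_substt_subset: "fvt (substt x \<tau> u t) \<subseteq> fvt t \<union> fvt u"
  by (induction t) auto

lemma clean2_subst:
  "qf \<phi> \<Longrightarrow> clean2 \<phi> \<Longrightarrow> \<forall>p\<in>fvt u. \<not> rsv (fst p) \<Longrightarrow> clean2 (subst x \<tau> u \<phi>)"
proof (induction \<phi>)
  case (Eq0 s t)
  then show ?case using fvt_substt_subset[of x \<tau> u s] fvt_substt_subset[of x \<tau> u t] by auto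
qed auto

text \<open>\<open>induct\<close> is stated for formulas with arbitrary names, whereas axioms
  transfer to the model only when clean. Prefixing a letter removes reserved names; the induction
  variable \<open>''x''\<close> is kept.\<close>

definition shift :: "tm env" where
  "shift = (\<lambda>(y, \<tau>). Var (if y = ''x'' then y else CHR ''a'' # y) \<tau>)"

lemma typed_shift: "typed shift"
  by (simp add: typed_def shift_def)

lemma shift_names: "(y, \<tau>) \<in> fvt (sst shift t) \<Longrightarrow> \<not> rsv y"
  by (induction t) (auto simp: shift_def rsv_def split: if_splits)

lemma qf_ssub: "qf (ssub \<sigma> \<phi>) = qf \<phi>"
  by (induction \<phi> arbitrary: \<sigma>) auto

lemma shift_clean2: "qf \<phi> \<Longrightarrow> clean2 (ssub shift \<phi>)"
  by (induction \<phi>) (auto dest: shift_names)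

context struct
begin

lemma ev_sst: "ev \<rho> (sst \<sigma> t) = ev (\<lambda>p. ev \<rho> (\<sigma> p)) t"
  by (induction t) auto

lemma sat_ssub_qf: "qf \<phi> \<Longrightarrow> sat \<rho> (ssub \<sigma> \<phi>) = sat (\<lambda>p. ev \<rho> (\<sigma> p)) \<phi>"
  by (induction \<phi>) (auto simp: ev_sst)

end

lemma rsv_simps [simp]: "\<not> rsv []" "rsv (c # x) \<longleftrightarrow> c = CHR ''#''"
  by (auto simp: rsv_def)

lemma arith_axioms:
  fixes D :: "ty \<Rightarrow> 'a set" and ap and cst
  assumes "struct D ap cst"
    and EQ: "\<And>a b \<tau>. a \<in> D \<tau> \<Longrightarrow> b \<in> D \<tau> \<Longrightarrow> struct.EQ D ap cst (=) \<tau> a b \<Longrightarrow> a = b"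
    and ax: "\<And>\<phi> \<rho>. \<phi> \<in> E_PRA_omega \<Longrightarrow> clean2 \<phi> \<Longrightarrow> struct.ok D \<rho> \<Longrightarrow> struct.sat D ap cst (=) \<rho> \<phi>"
  shows "arith D ap cst"
proof -
  interpret struct D ap cst "(=)" by fact
  show ?thesis
  proof
    fix a b \<sigma> \<tau> assume *: "a \<in> D \<sigma>" "b \<in> D \<tau>"
    have "sat (upd (upd dflt ''x'' \<sigma> a) ''y'' \<tau> b) (eqF \<sigma> (KC \<sigma> \<tau> \<cdot> Var ''x'' \<sigma> \<cdot> Var ''y'' \<tau>) (Var ''x'' \<sigma>))"
      by (rule ax[OF comb_K]) (use * in simp_all)
    then show "ap (ap (cst (KC \<sigma> \<tau>)) a) b = a"
      using * ap_D[OF ap_D[OF csts_D(3)]] by (intro EQ[of _ \<sigma>]) (simp_all add: sat_eqF)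
  next
    fix a b c \<delta> \<sigma> \<tau> assume *: "a \<in> D (\<delta> \<rightarrow> \<sigma> \<rightarrow> \<tau>)" "b \<in> D (\<delta> \<rightarrow> \<sigma>)" "c \<in> D \<delta>"
    have "sat (upd (upd (upd dflt ''x'' (\<delta> \<rightarrow> \<sigma> \<rightarrow> \<tau>) a) ''y'' (\<delta> \<rightarrow> \<sigma>) b) ''z'' \<delta> c) (eqF \<tau>
      (SC \<delta> \<sigma> \<tau> \<cdot> Var ''x'' (\<delta> \<rightarrow> \<sigma> \<rightarrow> \<tau>) \<cdot> Var ''y'' (\<delta> \<rightarrow> \<sigma>) \<cdot> Var ''z'' \<delta>)
      (Var ''x'' (\<delta> \<rightarrow> \<sigma> \<rightarrow> \<tau>) \<cdot> Var ''z'' \<delta> \<cdot> (Var ''y'' (\<delta> \<rightarrow> \<sigma>) \<cdot> Var ''z'' \<delta>)))"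
      by (rule ax[OF comb_S]) (use * in simp_all)
    then have "EQ \<tau> (ap (ap (ap (cst (SC \<delta> \<sigma> \<tau>)) a) b) c) (ap (ap a c) (ap b c))"
      by (simp add: sat_eqF)
    then show "ap (ap (ap (cst (SC \<delta> \<sigma> \<tau>)) a) b) c = ap (ap a c) (ap b c)"
      by (rule EQ[rotated 2])
        (rule ap_D[OF ap_D[OF ap_D[OF csts_D(4)]]], fact+, rule ap_D[OF ap_D ap_D], fact+)
  next
    fix a b assume *: "a \<in> D N" "b \<in> D N" "ap (cst SucC) a = ap (cst SucC) b"
    have "sat (upd (upd dflt ''x'' N a) ''y'' N b) (Succ (n0 ''x'') \<^bold>= Succ (n0 ''y'') \<^bold>\<longrightarrow> n0 ''x'' \<^bold>= n0 ''y'')"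
      by (rule ax[OF suc_inj]) (use * in simp_all)
    then show "a = b" using * by simp
  next
    fix a assume *: "a \<in> D N"
    have "sat (upd dflt ''x'' N a) (\<^bold>\<not> (Succ (n0 ''x'') \<^bold>= ZeroC))"
      by (rule ax[OF suc_nonzero]) (use * in simp_all)
    then show "ap (cst SucC) a \<noteq> cst ZeroC" by simp
  next
    fix b g assume *: "b \<in> D N" "g \<in> D (N \<rightarrow> N \<rightarrow> N)"
    have "sat (upd (upd dflt ''y'' N b) ''z'' (N \<rightarrow> N \<rightarrow> N) g)
      (RecC \<cdot> ZeroC \<cdot> n0 ''y'' \<cdot> Var ''z'' (N \<rightarrow> N \<rightarrow> N) \<^bold>= n0 ''y'')"
      by (rule ax[OF rec_zero]) (use * in simp_all)
    then show "ap (ap (ap (cst RecC) (cst ZeroC)) b) g = b" by simp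
  next
    fix a b g assume *: "a \<in> D N" "b \<in> D N" "g \<in> D (N \<rightarrow> N \<rightarrow> N)"
    have "sat (upd (upd (upd dflt ''x'' N a) ''y'' N b) ''z'' (N \<rightarrow> N \<rightarrow> N) g)
      (RecC \<cdot> Succ (n0 ''x'') \<cdot> n0 ''y'' \<cdot> Var ''z'' (N \<rightarrow> N \<rightarrow> N) \<^bold>=
      Var ''z'' (N \<rightarrow> N \<rightarrow> N) \<cdot> (RecC \<cdot> n0 ''x'' \<cdot> n0 ''y'' \<cdot> Var ''z'' (N \<rightarrow> N \<rightarrow> N)) \<cdot> n0 ''x'')"
      by (rule ax[OF rec_suc]) (use * in simp_all)
    then show "ap (ap (ap (cst RecC) (ap (cst SucC) a)) b) g = ap (ap g (ap (ap (ap (cst RecC) a) b) g)) a"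
      by simp
  next
    fix \<phi> \<rho> a
    assume \<phi>: "qf \<phi>" "wff \<phi>" and \<rho>: "ok \<rho>" and base: "sat (upd \<rho> ''x'' N (cst ZeroC)) \<phi>"
      and step: "\<And>a. a \<in> D N \<Longrightarrow> sat (upd \<rho> ''x'' N a) \<phi> \<Longrightarrow> sat (upd \<rho> ''x'' N (ap (cst SucC) a)) \<phi>"
      and a: "a \<in> D N"
    let ?\<psi> = "ssub shift \<phi>"
    \<comment> \<open>Undoes the renaming: \<open>tl\<close> drops the added letter.\<close>
    define \<rho>' where "\<rho>' = (\<lambda>(y, \<tau>). \<rho> (if y = ''x'' then y else tl y, \<tau>))"
    have q: "qf ?\<psi>" "wff ?\<psi>" using \<phi> wff_ssub typed_shift by (auto simp: qf_ssub)
    have ok': "ok \<rho>'" using \<rho> by (simp add: ok_def \<rho>'_def)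
    have eq: "sat (upd \<rho>' ''x'' N b) ?\<psi> = sat (upd \<rho> ''x'' N b) \<phi>" for b
    proof -
      have "(\<lambda>p. ev (upd \<rho>' ''x'' N b) (shift p)) = upd \<rho> ''x'' N b"
        by (auto simp: shift_def \<rho>'_def upd_def)
      then show ?thesis using sat_ssub_qf[OF \<phi>(1)] by simp
    qed
    have "sat \<rho>' (subst ''x'' N ZeroC ?\<psi> \<^bold>\<longrightarrow> (\<^bold>\<forall>''x''\<^bold>:N. ?\<psi> \<^bold>\<longrightarrow> subst ''x'' N (Succ (n0 ''x'')) ?\<psi>) \<^bold>\<longrightarrow>
      (\<^bold>\<forall>''x''\<^bold>:N. ?\<psi>))"
      by (rule ax[OF qf_induct[OF q]])
        (use ok' shift_clean2[OF \<phi>(1)] clean2_subst[OF q(1)] in simp_all)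
    then show "sat (upd \<rho> ''x'' N a) \<phi>"
      using base step a by (simp add: sat_subst qf_free_for[OF q(1)] eq)
  qed
qed

lemma goal_wff: "wff mu2" "wff UATR" "wff ex_SFF" "wff WKL"
  by (simp_all add: mu2_def UATR_def WO_def LO_def H_def is_restr_def theta_of_def is_set_def
      le1_one_def le_in_def less_in_def in_field_def mem_def ex_SFF_def SFF_def elem_of_def
      extends_seq_def WKL_def binary_tree_def infinite_set_def wff_eqF del: eqF.simps)

lemma goal_clean: "clean2 mu2" "clean2 UATR" "clean2 ex_SFF"
  by (simp_all add: mu2_def UATR_def WO_def LO_def H_def is_restr_def theta_of_def is_set_def
      le1_one_def le_in_def less_in_def in_field_def mem_def ex_SFF_def SFF_def elem_of_def
      extends_seq_def del: eqF.simps)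

lemma goal_fv: "fv mu2 = {}" "fv UATR = {}"
  by (auto simp: mu2_def UATR_def WO_def LO_def H_def is_restr_def theta_of_def is_set_def
      le1_one_def le_in_def less_in_def in_field_def mem_def)

lemma equivalence_provable: "RCA0_omega \<union> {ex_SFF} \<^bold>\<turnstile> mu2 \<^bold>\<longleftrightarrow> UATR"
proof (rule ccontr)
  let ?T = "RCA0_omega \<union> {ex_SFF}" and ?g = "mu2 \<^bold>\<longleftrightarrow> UATR"
  assume no: "\<not> (?T \<^bold>\<turnstile> ?g)"
  have T: "\<forall>\<phi>\<in>?T. wff \<phi>" "E_PRA_omega \<subseteq> ?T"
    using RCA0_wff goal_wff by (auto simp: RCA0_omega_def)
  have g: "wff ?g" "fv ?g = {}" "clean ?g"
    using goal_wff goal_fv goal_clean by (auto simp: clean2_def clean_def)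
  obtain D :: "ty \<Rightarrow> tm set" and ap (infixl "\<bullet>" 100) and cst where M: "struct D ap cst"
    "\<And>a b \<tau>. a \<in> D \<tau> \<Longrightarrow> b \<in> D \<tau> \<Longrightarrow> struct.EQ D ap cst (=) \<tau> a b \<Longrightarrow> a = b"
    "\<And>\<rho>. struct.ok D \<rho> \<Longrightarrow> \<not> struct.sat D ap cst (=) \<rho> ?g"
    "\<And>\<phi> \<rho>. ?T \<^bold>\<turnstile> \<phi> \<Longrightarrow> clean \<phi> \<Longrightarrow> (\<And>x \<tau>. (x, \<tau>) \<in> fv \<phi> \<Longrightarrow> \<not> rsv x) \<Longrightarrow> struct.ok D \<rho> \<Longrightarrow>
      struct.sat D ap cst (=) \<rho> \<phi>"
    using completeness[OF T g no] by blast
  have ax: "struct.sat D ap cst (=) \<rho> \<phi>" if "\<phi> \<in> ?T" "clean2 \<phi>" "struct.ok D \<rho>" for \<phi> \<rho>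
    using M(4)[OF axiom[OF that(1)]] that(2,3) unfolding clean2_def by blast
  interpret arith D ap cst
    by (rule arith_axioms[OF M(1,2)]) (use ax in \<open>auto simp: RCA0_omega_def\<close>)
  have "sat dflt UATR \<Longrightarrow> sat dflt mu2"
  proof (erule uatr_mu2)
    fix \<phi> \<rho>
    assume \<phi>: "qf \<phi>" "wff \<phi>" "(''mu'', T2) \<notin> fv \<phi>" "fst ` fv \<phi> \<subseteq> {''f'', ''n'', ''Phi''}" and \<rho>: "ok \<rho>"
      and all: "\<forall>a\<in>D T1. \<exists>b\<in>D N. sat (upd (upd \<rho> ''f'' T1 a) ''n'' N b) \<phi>"
    have cl: "clean2 \<phi>" by (rule clean2_qf[OF \<phi>(1)]) (use \<phi>(4) in force)
    have "sat \<rho> ((\<^bold>\<forall>''f''\<^bold>:T1. \<^bold>\<exists>''n''\<^bold>:N. \<phi>) \<^bold>\<longrightarrow>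
      (\<^bold>\<exists>''mu''\<^bold>:T2. \<^bold>\<forall>''f''\<^bold>:T1. subst ''n'' N (Var ''mu'' T2 \<cdot> n1 ''f'') \<phi>))"
      by (rule ax) (use \<phi>(1-3) \<rho> cl clean2_subst[OF \<phi>(1) cl] in
        \<open>auto simp: RCA0_omega_def intro: QF_AC_1_0.intros\<close>)
    then obtain F where F: "F \<in> D T2"
      "\<forall>a\<in>D T1. sat (upd (upd \<rho> ''mu'' T2 F) ''f'' T1 a) (subst ''n'' N (Var ''mu'' T2 \<cdot> n1 ''f'') \<phi>)"
      using all by auto
    have "sat (upd (upd \<rho> ''f'' T1 a) ''n'' N (F \<bullet> a)) \<phi>" if "a \<in> D T1" for a
    proof -
      have "sat (upd (upd (upd \<rho> ''mu'' T2 F) ''f'' T1 a) ''n'' N (F \<bullet> a)) \<phi>"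
        using F(2) that by (simp add: sat_subst[OF qf_free_for[OF \<phi>(1)]])
      also have "sat (upd (upd (upd \<rho> ''mu'' T2 F) ''f'' T1 a) ''n'' N (F \<bullet> a)) \<phi> =
          sat (upd (upd \<rho> ''f'' T1 a) ''n'' N (F \<bullet> a)) \<phi>"
        by (rule sat_cong) (use \<phi>(3) in \<open>auto simp: upd_apply'\<close>)
      finally show ?thesis .
    qed
    then show "\<exists>F\<in>D T2. \<forall>a\<in>D T1. sat (upd (upd \<rho> ''f'' T1 a) ''n'' N (F \<bullet> a)) \<phi>" using F(1) by blast
  qed
  moreover have "sat dflt mu2 \<Longrightarrow> sat dflt UATR"
  proof -
    assume "sat dflt mu2"
    then obtain mu where mu: "mu \<in> D T2" "\<And>f n. f \<in> D T1 \<Longrightarrow> n \<in> D N \<Longrightarrow> f \<bullet> n = Z \<Longrightarrow> f \<bullet> (mu \<bullet> f) = Z"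
      unfolding sat_mu2 by blast
    have "sat dflt ex_SFF" by (rule ax) (use goal_clean in simp_all)
    then obtain \<Theta> where \<Theta>: "\<Theta> \<in> D (T2 \<rightarrow> Star T1)"
      and sff: "sat (upd dflt ''Theta'' (T2 \<rightarrow> Star T1) \<Theta>) (SFF (Var ''Theta'' (T2 \<rightarrow> Star T1)))"
      unfolding ex_SFF_def by auto
    have "thetarith D ap cst mu \<Theta>"
    proof
      fix f g assume "f \<in> D T1" "g \<in> D T1" "\<And>n. n \<in> D N \<Longrightarrow> f \<bullet> n = g \<bullet> n"
      then show "f = g" by (intro M(2)[of f T1 g]) simp_all
    next
      fix G f assume G: "G \<in> D T2" and f: "f \<in> D T1" "\<And>p. p \<in> D N \<Longrightarrow> le (f \<bullet> p) (S Z)"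
      have "\<Theta> \<bullet> G \<in> D (Star T1)" using ap_D[OF \<Theta> G] .
      have "\<forall>G\<in>D T2. \<forall>f\<in>D T1. (\<forall>p\<in>D N. le (f \<bullet> p) (S Z)) \<longrightarrow>
        (\<exists>g\<in>D T1. (\<exists>i\<in>D N. le (S i) (cst (LenC T1) \<bullet> (\<Theta> \<bullet> G)) \<and>
            (\<forall>n\<in>D N. g \<bullet> n = cst (EntC T1) \<bullet> (\<Theta> \<bullet> G) \<bullet> i \<bullet> n)) \<and>
          (\<forall>n\<in>D N. le (S n) (cst (LenC N) \<bullet> (cst (SeqC N) \<bullet> (G \<bullet> g) \<bullet> g)) \<longrightarrow>
            f \<bullet> n = cst (EntC N) \<bullet> (cst (SeqC N) \<bullet> (G \<bullet> g) \<bullet> g) \<bullet> n))"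
        using sff by (simp add: SFF_def le1_one_def elem_of_def extends_seq_def sat_eqF del: eqF.simps)
      then obtain g i where g: "g \<in> D T1" "i \<in> D N" "le (S i) (cst (LenC T1) \<bullet> (\<Theta> \<bullet> G))"
        "\<forall>n\<in>D N. g \<bullet> n = cst (EntC T1) \<bullet> (\<Theta> \<bullet> G) \<bullet> i \<bullet> n"
        "\<forall>n\<in>D N. le (S n) (cst (LenC N) \<bullet> (cst (SeqC N) \<bullet> (G \<bullet> g) \<bullet> g)) \<longrightarrow>
          f \<bullet> n = cst (EntC N) \<bullet> (cst (SeqC N) \<bullet> (G \<bullet> g) \<bullet> g) \<bullet> n"
        using G f by blast
      \<comment> \<open>The witness of \<open>elem_of\<close> equals the entry pointwise, which in
        this model means identity.\<close>
      have eq: "g = cst (EntC T1) \<bullet> (\<Theta> \<bullet> G) \<bullet> i"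
        by (rule M(2)[of _ T1]) (use g \<open>\<Theta> \<bullet> G \<in> D (Star T1)\<close> in simp_all)
      have Gg: "G \<bullet> g \<in> D N" using G g by simp
      have "sat (upd (upd dflt ''n'' N (G \<bullet> g)) ''f'' T1 g) (LenC N \<cdot> (SeqC N \<cdot> n0 ''n'' \<cdot> n1 ''f'') \<^bold>= n0 ''n'')"
        by (rule ax) (use Gg g seq_len[of N] in \<open>auto simp: RCA0_omega_def\<close>)
      then have len: "cst (LenC N) \<bullet> (cst (SeqC N) \<bullet> (G \<bullet> g) \<bullet> g) = G \<bullet> g" by simp
      have ent: "cst (EntC N) \<bullet> (cst (SeqC N) \<bullet> (G \<bullet> g) \<bullet> g) \<bullet> n = g \<bullet> n" if "n \<in> D N" "le (S n) (G \<bullet> g)" for n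
      proof -
        have "sat (upd (upd (upd dflt ''n'' N (G \<bullet> g)) ''f'' T1 g) ''i'' N n) (n0 ''i'' \<^bold>< n0 ''n'' \<^bold>\<longrightarrow>
          eqF N (EntC N \<cdot> (SeqC N \<cdot> n0 ''n'' \<cdot> n1 ''f'') \<cdot> n0 ''i'') (n1 ''f'' \<cdot> n0 ''i''))"
          by (rule ax) (use Gg g that seq_ent[of N] in \<open>auto simp: RCA0_omega_def\<close>)
        then show ?thesis using that by simp
      qed
      have "\<forall>n\<in>D N. le (S n) (G \<bullet> g) \<longrightarrow> f \<bullet> n = g \<bullet> n" using g(5) len ent by simp
      then show "\<exists>i\<in>D N. le (S i) (cst (LenC T1) \<bullet> (\<Theta> \<bullet> G)) \<and>
        (\<forall>n\<in>D N. le (S n) (G \<bullet> (cst (EntC T1) \<bullet> (\<Theta> \<bullet> G) \<bullet> i)) \<longrightarrow> f \<bullet> n = cst (EntC T1) \<bullet> (\<Theta> \<bullet> G) \<bullet> i \<bullet> n)"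
        using g(2,3) unfolding eq by blast
    qed (use mu \<Theta> in auto)
    then show ?thesis by (rule thetarith.mu2_uatr)
  qed
  ultimately have "sat dflt ?g" by auto
  then show False using M(3) ok_dflt by blast
qed

section \<open>Predicates of finite Borel rank\<close>

type_synonym baire = "nat \<Rightarrow> nat"

text \<open>Countable unions of complements generate the finite levels of the Borel hierarchy from
  subbasic clopen sets; \<open>k\<close> bounds the nesting.\<close>

inductive fin :: "nat \<Rightarrow> (baire \<Rightarrow> bool) \<Rightarrow> bool" where
  base: "fin k (\<lambda>x. x i = j)"
| nand: "(\<And>n::nat. fin k (P n)) \<Longrightarrow> fin (Suc k) (\<lambda>x. \<exists>n. \<not> P n x)"

lemma fin_mono: "fin k P \<Longrightarrow> k \<le> m \<Longrightarrow> fin m P"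
proof (induction arbitrary: m rule: fin.induct)
  case (nand k P)
  then obtain m' where "m = Suc m'" "k \<le> m'" by (cases m) auto
  then show ?case using nand.IH by (auto intro: fin.nand)
qed (rule fin.base)

text \<open>One bound for the whole family: a countable union of members of unbounded finite ranks
  could leave the finite levels.\<close>

definition ufin :: "('i \<Rightarrow> baire \<Rightarrow> bool) \<Rightarrow> bool" where
  "ufin P \<longleftrightarrow> (\<exists>k. \<forall>i. fin k (P i))"

lemma ufin_sub: "ufin P \<Longrightarrow> (\<And>i. \<exists>j. Q i = P j) \<Longrightarrow> ufin Q"
  unfolding ufin_def by metis

lemma ufin_reindex: "ufin P \<Longrightarrow> ufin (\<lambda>j. P (h j))"
  unfolding ufin_def by metis

lemma ufin_base: "ufin (\<lambda>i x. x (f i) = g i)"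
  unfolding ufin_def using fin.base by blast

lemma ufin_not: "ufin P \<Longrightarrow> ufin (\<lambda>i x. \<not> P i x)"
proof -
  assume "ufin P"
  then obtain k where k: "fin k (P i)" for i unfolding ufin_def by blast
  have "fin (Suc k) (\<lambda>x. \<exists>n::nat. \<not> P i x)" for i by (rule fin.nand) (rule k)
  then show ?thesis unfolding ufin_def by auto
qed

lemma ufin_ex_nat: "ufin (\<lambda>(i, n::nat). P i n) \<Longrightarrow> ufin (\<lambda>i x. \<exists>n. P i n x)"
proof -
  assume "ufin (\<lambda>(i, n). P i n)"
  then have "ufin (\<lambda>(i, n) x. \<not> P i n x)" using ufin_not by (auto simp: case_prod_unfold)
  then obtain k where k: "fin k (\<lambda>x. \<not> P i n x)" for i n unfolding ufin_def by (metis case_prod_conv)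
  have "fin (Suc k) (\<lambda>x. \<exists>n. \<not> \<not> P i n x)" for i by (rule fin.nand) (rule k)
  then show ?thesis unfolding ufin_def by auto
qed

lemma ufin_ex: "ufin (\<lambda>(i, n::'c::countable). P i n) \<Longrightarrow> ufin (\<lambda>i x. \<exists>n. P i n x)"
proof -
  assume "ufin (\<lambda>(i, n::'c). P i n)"
  then have "ufin (\<lambda>(i, n::nat). P i (from_nat n :: 'c))" by (rule ufin_sub) auto
  then have "ufin (\<lambda>i x. \<exists>n::nat. P i (from_nat n :: 'c) x)" by (rule ufin_ex_nat)
  moreover have "(\<exists>n::nat. P i (from_nat n :: 'c) x) = (\<exists>n. P i n x)" for i x
    by (metis from_nat_to_nat)
  ultimately show ?thesis by simp
qed

lemma ufin_all: "ufin (\<lambda>(i, n::'c::countable). P i n) \<Longrightarrow> ufin (\<lambda>i x. \<forall>n. P i n x)"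
proof -
  assume "ufin (\<lambda>(i, n::'c). P i n)"
  then have "ufin (\<lambda>(i, n::'c) x. \<not> P i n x)" using ufin_not by (auto simp: case_prod_unfold)
  then have "ufin (\<lambda>i x. \<not> (\<exists>n. \<not> P i n x))" by (intro ufin_not ufin_ex)
  then show ?thesis by simp
qed

lemma ufin_conj: "ufin P \<Longrightarrow> ufin Q \<Longrightarrow> ufin (\<lambda>i x. P i x \<and> Q i x)"
proof -
  assume "ufin P" "ufin Q"
  then obtain k m where "fin k (P i)" "fin m (Q i)" for i unfolding ufin_def by blast
  then have "fin (max k m) (P i)" "fin (max k m) (Q i)" for i
    by (meson fin_mono max.cobounded1 max.cobounded2)+
  \<comment> \<open>Conjunction is a universal quantifier over the countable type
    \<open>bool\<close>.\<close>
  then have "ufin (\<lambda>(i, b). if b then P i else Q i)" unfolding ufin_def by auto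
  then have "ufin (\<lambda>i x. \<forall>b. (if b then P i else Q i) x)" by (rule ufin_all)
  moreover have "(\<forall>b. (if b then P i else Q i) x) = (P i x \<and> Q i x)" for i x by auto
  ultimately show ?thesis by simp
qed

lemma ufin_disj: "ufin P \<Longrightarrow> ufin Q \<Longrightarrow> ufin (\<lambda>i x. P i x \<or> Q i x)"
  using ufin_not[OF ufin_conj[OF ufin_not ufin_not]] by fastforce

lemma ufin_const: "ufin (\<lambda>i x. c i)"
proof -
  \<comment> \<open>Truth as a union of complements: \<open>x 0\<close> differs from some
    number.\<close>
  have 1: "fin (Suc 0) (\<lambda>x. \<exists>n. x 0 \<noteq> n)" by (intro fin.nand fin.base)
  moreover have "\<exists>n. (x :: baire) 0 \<noteq> n" for x using n_not_Suc_n[of "x 0"] by blast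
  ultimately have T: "fin (Suc 0) (\<lambda>x. True)" by simp
  then have "fin (Suc (Suc 0)) (\<lambda>x. \<exists>n::nat. \<not> True)" by (intro fin.nand)
  then have "fin (Suc (Suc 0)) (\<lambda>x. c i)" for i
    using fin_mono[OF T, of "Suc (Suc 0)"] by (cases "c i") auto
  then show ?thesis unfolding ufin_def by blast
qed

lemma ufin_imp: "ufin P \<Longrightarrow> ufin Q \<Longrightarrow> ufin (\<lambda>i x. P i x \<longrightarrow> Q i x)"
proof -
  assume "ufin P" "ufin Q"
  then have "ufin (\<lambda>i x. \<not> P i x \<or> Q i x)" by (intro ufin_disj ufin_not)
  then show ?thesis by (simp only: imp_conv_disj)
qed

section \<open>Maps of finite Borel rank\<close>

definition fr :: "(baire \<Rightarrow> nat) \<Rightarrow> bool" where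
  "fr g \<longleftrightarrow> ufin (\<lambda>v x. g x = v)"

text \<open>All coordinates share one bound, so that substituting \<rho> into a predicate adds a
  fixed number to its rank.\<close>

definition frm :: "(baire \<Rightarrow> baire) \<Rightarrow> bool" where
  "frm \<rho> \<longleftrightarrow> ufin (\<lambda>(i, v) x. \<rho> x i = v)"

lemma fin_comp:
  assumes "fin m P" "\<And>i v. fin k (\<lambda>x. \<rho> x i = v)"
  shows "fin (m + k) (\<lambda>x. P (\<rho> x))"
  using assms(1)
proof (induction rule: fin.induct)
  case (base m i j)
  then show ?case using fin_mono[OF assms(2)] by simp
next
  case (nand m P)
  then show ?case using fin.nand[of "m + k" "\<lambda>n x. P n (\<rho> x)"] by simp
qed

lemma ufin_comp:
  assumes "ufin P" "ufin (\<lambda>(j, i, v) x. \<rho> j x i = v)"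
  shows "ufin (\<lambda>(i, j) x. P i (\<rho> j x))"
proof -
  obtain m where "fin m (P i)" for i using assms(1) unfolding ufin_def by blast
  moreover obtain k where "fin k (\<lambda>x. \<rho> j x i = v)" for j i v
    using assms(2) unfolding ufin_def by (metis case_prod_conv)
  ultimately have "fin (m + k) (\<lambda>x. P i (\<rho> j x))" for i j by (intro fin_comp)
  then show ?thesis unfolding ufin_def by auto
qed

lemma ufin_comp1: "ufin P \<Longrightarrow> frm \<rho> \<Longrightarrow> ufin (\<lambda>i x. P i (\<rho> x))"
proof -
  assume "ufin P" "frm \<rho>"
  then obtain m k where "fin m (P i)" "fin k (\<lambda>x. \<rho> x j = v)" for i j v
    unfolding ufin_def frm_def by (metis case_prod_conv)
  then have "fin (m + k) (\<lambda>x. P i (\<rho> x))" for i by (intro fin_comp)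
  then show ?thesis unfolding ufin_def by auto
qed

lemma fr_comp: "fr g \<Longrightarrow> frm \<rho> \<Longrightarrow> fr (\<lambda>x. g (\<rho> x))"
  unfolding fr_def by (rule ufin_comp1)

lemma frm_comp: "frm \<rho> \<Longrightarrow> frm \<rho>' \<Longrightarrow> frm (\<lambda>x. \<rho> (\<rho>' x))"
  using ufin_comp1[of "\<lambda>(i, v) x. \<rho> x i = v" \<rho>'] by (simp add: frm_def case_prod_unfold)

lemma frm_id: "frm (\<lambda>x. x)"
  using ufin_base[of fst snd] by (simp add: frm_def case_prod_unfold)

lemma frm_const: "frm (\<lambda>x. c)"
  using ufin_const[of "\<lambda>(i, v). c i = v"] by (simp add: frm_def case_prod_unfold)

definition tl' :: "baire \<Rightarrow> baire" where
  "tl' x = (\<lambda>i. x (Suc i))"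

lemma frm_tl: "frm tl'"
  using ufin_base[of "\<lambda>p. Suc (fst p)" snd] by (simp add: frm_def tl'_def case_prod_unfold)

lemma fr_proj: "fr (\<lambda>x. x i)"
  using ufin_base[of "\<lambda>_. i" "\<lambda>v. v"] by (simp add: fr_def)

lemma fr_const: "fr (\<lambda>x. c)"
  using ufin_const[of "\<lambda>v. c = v"] by (simp add: fr_def)

lemma frm_cons: assumes "fr g" "frm \<rho>" shows "frm (\<lambda>x. case_nat (g x) (\<rho> x))"
proof -
  have "ufin (\<lambda>p x. g x = snd p)" "ufin (\<lambda>p x. \<rho> x (fst p - 1) = snd p)"
    using ufin_reindex[OF assms(1)[unfolded fr_def], of snd]
      ufin_reindex[OF assms(2)[unfolded frm_def], of "\<lambda>p. (fst p - 1, snd p)"] by simp_all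
  then have "ufin (\<lambda>p x. fst p = 0 \<and> g x = snd p \<or> fst p \<noteq> (0::nat) \<and> \<rho> x (fst p - 1) = snd p)"
    by (intro ufin_disj ufin_conj ufin_const)
  moreover have "(i = 0 \<and> g x = v \<or> i \<noteq> 0 \<and> \<rho> x (i - 1) = v) = (case_nat (g x) (\<rho> x) i = v)" for i v x
    by (cases i) auto
  ultimately show ?thesis by (simp add: frm_def case_prod_unfold)
qed

lemma fr_map: "fr g \<Longrightarrow> fr (\<lambda>x. h (g x))"
proof -
  assume "fr g"
  then have "ufin (\<lambda>p x. g x = snd p)"
    unfolding fr_def using ufin_reindex[of _ snd] by fastforce
  then have "ufin (\<lambda>p x. h (snd p) = fst p \<and> g x = snd p)" by (intro ufin_conj ufin_const)
  then have "ufin (\<lambda>v x. \<exists>n. h n = v \<and> g x = n)" by (intro ufin_ex) (simp add: case_prod_unfold)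
  then show ?thesis by (simp add: fr_def)
qed

section \<open>Values and application\<close>

text \<open>Values are untyped; \<open>VFun f\<close> represents an arbitrary function on the numbers and \<open>VMu\<close> a
  least-number operator. Entries of a sequence beyond its length are \<open>z\<close> in \<open>VEnt z\<close>.\<close>

datatype val = VNum nat | VSuc | VK | VK1 val | VS | VS1 val | VS2 val val | VRec | VRec1 val
  | VRec2 val val | VSeq | VSeq1 nat | VList "val list" | VLen | VEnt val | VEnt1 val val
  | VMu | VFun "nat \<Rightarrow> nat"

definition nth0 :: "val \<Rightarrow> val list \<Rightarrow> nat \<Rightarrow> val" where
  "nth0 z l i = (if i < length l then l ! i else z)"

definition least0 :: "(nat \<Rightarrow> nat) \<Rightarrow> nat" where
  "least0 v = (if \<exists>m. v m = 0 then LEAST m. v m = 0 else 0)"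

text \<open>A relation, because untyped application may have no value; \<open>app_det\<close> makes
  it a partial function, and \<open>rel\<close> later guarantees values. Rule \<open>appM\<close>
  has infinitely many premises: \<open>VMu\<close> has a value only at total functions.\<close>

inductive app :: "val \<Rightarrow> val \<Rightarrow> val \<Rightarrow> bool" where
  "app VSuc (VNum n) (VNum (Suc n))"
| "app VK a (VK1 a)"
| "app (VK1 a) b a"
| "app VS a (VS1 a)"
| "app (VS1 a) b (VS2 a b)"
| appS: "app a c p \<Longrightarrow> app b c q \<Longrightarrow> app p q r \<Longrightarrow> app (VS2 a b) c r"
| "app VRec a (VRec1 a)"
| "app (VRec1 a) b (VRec2 a b)"
| "app (VRec2 (VNum 0) b) g b"
| appR: "app (VRec2 (VNum n) b) g p \<Longrightarrow> app g p q \<Longrightarrow> app q (VNum n) r \<Longrightarrow>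
    app (VRec2 (VNum (Suc n)) b) g r"
| "app VSeq (VNum n) (VSeq1 n)"
| appQ: "length l = n \<Longrightarrow> (\<And>i. i < n \<Longrightarrow> app f (VNum i) (l ! i)) \<Longrightarrow> app (VSeq1 n) f (VList l)"
| "app VLen (VList l) (VNum (length l))"
| "app (VEnt z) w (VEnt1 z w)"
| "app (VEnt1 z (VList l)) (VNum i) (nth0 z l i)"
| appM: "(\<And>m. app f (VNum m) (VNum (v m))) \<Longrightarrow> app VMu f (VNum (least0 v))"
| "app (VFun f) (VNum n) (VNum (f n))"

inductive_simps app_simps [simp]:
  "app VSuc a c" "app VK a c" "app (VK1 a) b c" "app VS a c" "app (VS1 a) b c"
  "app VRec a c" "app (VRec1 a) b c" "app (VRec2 (VNum 0) b) g c"
  "app VSeq a c" "app VLen a c" "app (VEnt z) a c" "app (VEnt1 z w) a c" "app (VFun f) a c"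

inductive_cases appS_E: "app (VS2 a b) c r"
inductive_cases appR_E: "app (VRec2 (VNum (Suc n)) b) g r"
inductive_cases appQ_E: "app (VSeq1 n) f r"
inductive_cases appM_E: "app VMu f r"

lemma app_det: "app a b c \<Longrightarrow> app a b d \<Longrightarrow> c = d"
proof (induction arbitrary: d rule: app.induct)
  case (appS a c p b q r)
  from appS.prems show ?case by (rule appS_E) (use appS.IH in blast)
next
  case (appR n b g p q r)
  from appR.prems show ?case by (rule appR_E) (use appR.IH in blast)
next
  case (appQ l n f)
  from appQ.prems obtain l' where l': "d = VList l'" "length l' = n" "\<And>i. i < n \<Longrightarrow> app f (VNum i) (l' ! i)"
    by (rule appQ_E) blast
  then have "l = l'" using appQ by (intro nth_equalityI) auto
  then show ?case using l' by simp
next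
  case (appM f v)
  from appM.prems obtain v' where v': "d = VNum (least0 v')" "\<And>m. app f (VNum m) (VNum (v' m))"
    by (rule appM_E) blast
  then have "v = v'" using appM.IH by blast
  then show ?case using v' by simp
qed auto

definition vap :: "val \<Rightarrow> val \<Rightarrow> val" where
  "vap a b = (THE c. app a b c)"

lemma vap_eq: "app a b c \<Longrightarrow> vap a b = c"
  unfolding vap_def using app_det by blast

text \<open>Chosen to agree literally with the values of the terms \<open>zero_tm\<close>, to which
  the axiom on entries beyond the length refers.\<close>

primrec zv :: "ty \<Rightarrow> val" where
  "zv N = VNum 0"
| "zv (\<sigma> \<rightarrow> \<tau>) = VK1 (zv \<tau>)"
| "zv (Star \<tau>) = VList []"

section \<open>The logical relation\<close>

text \<open>A Kripke logical relation: the function clause applies a family, reparametrised by any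
  map of finite rank, to a new family. In the sequence clause coordinate 0 is the index and the tail
  the old parameter, so that the entries are related uniformly and not merely one by one; positions
  beyond the length hold \<open>zv \<tau>\<close>.\<close>

primrec rel :: "ty \<Rightarrow> (baire \<Rightarrow> val) \<Rightarrow> (baire \<Rightarrow> val) \<Rightarrow> bool" where
  "rel N = (\<lambda>T T'. T' = T \<and> (\<exists>g. fr g \<and> T = (\<lambda>x. VNum (g x))))"
| "rel (\<sigma> \<rightarrow> \<tau>) = (\<lambda>T T'. \<forall>\<rho> S S'. frm \<rho> \<longrightarrow> rel \<sigma> S S' \<longrightarrow> (\<exists>P P'. rel \<tau> P P' \<and>
     (\<forall>x. app (T (\<rho> x)) (S x) (P x) \<and> app (T' (\<rho> x)) (S' x) (P' x))))"
| "rel (Star \<tau>) = (\<lambda>T T'. \<exists>l l'. T = (\<lambda>x. VList (l x)) \<and> T' = (\<lambda>x. VList (l' x)) \<and>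
     fr (\<lambda>x. length (l x)) \<and> (\<forall>x. length (l x) = length (l' x)) \<and>
     rel \<tau> (\<lambda>x. nth0 (zv \<tau>) (l (tl' x)) (x 0)) (\<lambda>x. nth0 (zv \<tau>) (l' (tl' x)) (x 0)))"

lemma rel_StarI:
  assumes "fr (\<lambda>x. length (l x))" "\<And>x. length (l x) = length (l' x)"
    "rel \<tau> (\<lambda>x. nth0 (zv \<tau>) (l (tl' x)) (x 0)) (\<lambda>x. nth0 (zv \<tau>) (l' (tl' x)) (x 0))"
  shows "rel (Star \<tau>) (\<lambda>x. VList (l x)) (\<lambda>x. VList (l' x))"
  unfolding rel.simps using assms by blast

lemma rel_StarE:
  assumes "rel (Star \<tau>) T T'"
  obtains l l' where "T = (\<lambda>x. VList (l x))" "T' = (\<lambda>x. VList (l' x))" "fr (\<lambda>x. length (l x))"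
    "\<And>x. length (l x) = length (l' x)"
    "rel \<tau> (\<lambda>x. nth0 (zv \<tau>) (l (tl' x)) (x 0)) (\<lambda>x. nth0 (zv \<tau>) (l' (tl' x)) (x 0))"
  using assms unfolding rel.simps by blast

lemma rel_FnI:
  assumes "\<And>\<rho> S S'. frm \<rho> \<Longrightarrow> rel \<sigma> S S' \<Longrightarrow> \<exists>P P'. rel \<tau> P P' \<and>
     (\<forall>x. app (T (\<rho> x)) (S x) (P x) \<and> app (T' (\<rho> x)) (S' x) (P' x))"
  shows "rel (\<sigma> \<rightarrow> \<tau>) T T'"
  using assms by simp

lemma rel_FnE:
  assumes "rel (\<sigma> \<rightarrow> \<tau>) T T'" "frm \<rho>" "rel \<sigma> S S'"
  obtains P P' where "rel \<tau> P P'" "\<And>x. app (T (\<rho> x)) (S x) (P x)" "\<And>x. app (T' (\<rho> x)) (S' x) (P' x)"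
  using assms by (metis rel.simps(2))

lemma rel_reparam: "rel \<tau> T T' \<Longrightarrow> frm \<rho> \<Longrightarrow> rel \<tau> (\<lambda>x. T (\<rho> x)) (\<lambda>x. T' (\<rho> x))"
proof (induction \<tau> arbitrary: T T' \<rho>)
  case N
  then show ?case using fr_comp by auto
next
  case (Fn \<sigma> \<tau> T T' \<rho>)
  show ?case
  proof (rule rel_FnI)
    fix \<rho>' S S' assume "frm \<rho>'" "rel \<sigma> S S'"
    then obtain P P' where "rel \<tau> P P'" "\<And>x. app (T (\<rho> (\<rho>' x))) (S x) (P x)"
      "\<And>x. app (T' (\<rho> (\<rho>' x))) (S' x) (P' x)"
      using rel_FnE[OF Fn.prems(1) frm_comp[OF Fn.prems(2)]] by metis
    then show "\<exists>P P'. rel \<tau> P P' \<and> (\<forall>x. app (T (\<rho> (\<rho>' x))) (S x) (P x) \<and> app (T' (\<rho> (\<rho>' x))) (S' x) (P' x))"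
      by blast
  qed
next
  case (Star \<tau> T T' \<rho>)
  from Star.prems(1) obtain l l' where l: "T = (\<lambda>x. VList (l x))" "T' = (\<lambda>x. VList (l' x))" "fr (\<lambda>x. length (l x))"
    "\<And>x. length (l x) = length (l' x)"
    "rel \<tau> (\<lambda>x. nth0 (zv \<tau>) (l (tl' x)) (x 0)) (\<lambda>x. nth0 (zv \<tau>) (l' (tl' x)) (x 0))" by (rule rel_StarE) blast
  \<comment> \<open>The reparametrisation acts on the tail and must leave the index in coordinate 0
    alone.\<close>
  have "frm (\<lambda>x. case_nat (x 0) (\<rho> (tl' x)))"
    by (intro frm_cons fr_proj frm_comp[OF Star.prems(2) frm_tl])
  from Star.IH[OF l(5) this]
  have "rel \<tau> (\<lambda>x. nth0 (zv \<tau>) (l (\<rho> (tl' x))) (x 0)) (\<lambda>x. nth0 (zv \<tau>) (l' (\<rho> (tl' x))) (x 0))"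
    by (simp add: tl'_def)
  moreover have "fr (\<lambda>x. length (l (\<rho> x)))" using fr_comp[OF l(3) Star.prems(2)] .
  ultimately show ?case unfolding l(1,2) by (intro rel_StarI) (simp_all add: l(4))
qed

lemma rel_sym: "rel \<tau> T T' \<Longrightarrow> rel \<tau> T' T"
proof (induction \<tau> arbitrary: T T')
  case N
  then show ?case by auto
next
  case (Fn \<sigma> \<tau> T T')
  show ?case
  proof (rule rel_FnI)
    fix \<rho> S S' assume "frm \<rho>" "rel \<sigma> S S'"
    then obtain P P' where "rel \<tau> P P'" "\<And>x. app (T (\<rho> x)) (S' x) (P x)" "\<And>x. app (T' (\<rho> x)) (S x) (P' x)"
      using rel_FnE[OF Fn.prems] Fn.IH(1) by metis
    then show "\<exists>P P'. rel \<tau> P P' \<and> (\<forall>x. app (T' (\<rho> x)) (S x) (P x) \<and> app (T (\<rho> x)) (S' x) (P' x))"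
      using Fn.IH(2) by blast
  qed
next
  case (Star \<tau> T T')
  from Star.prems obtain l l' where l: "T = (\<lambda>x. VList (l x))" "T' = (\<lambda>x. VList (l' x))" "fr (\<lambda>x. length (l x))"
    "\<And>x. length (l x) = length (l' x)"
    "rel \<tau> (\<lambda>x. nth0 (zv \<tau>) (l (tl' x)) (x 0)) (\<lambda>x. nth0 (zv \<tau>) (l' (tl' x)) (x 0))" by (rule rel_StarE) blast
  show ?case unfolding l(1,2) by (rule rel_StarI) (use l(3,4) Star.IH[OF l(5)] in simp_all)
qed

lemma rel_trans: "rel \<tau> T T' \<Longrightarrow> rel \<tau> T' T'' \<Longrightarrow> rel \<tau> T T''"
proof (induction \<tau> arbitrary: T T' T'')
  case N
  then show ?case by auto
next
  case (Fn \<sigma> \<tau> T T' T'')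
  show ?case
  proof (rule rel_FnI)
    fix \<rho> S S' assume *: "frm \<rho>" "rel \<sigma> S S'"
    have S': "rel \<sigma> S' S'" using Fn.IH(1) rel_sym * by blast
    obtain P P' where P: "rel \<tau> P P'" "\<And>x. app (T (\<rho> x)) (S x) (P x)" "\<And>x. app (T' (\<rho> x)) (S' x) (P' x)"
      using rel_FnE[OF Fn.prems(1) *] by metis
    obtain Q Q' where Q: "rel \<tau> Q Q'" "\<And>x. app (T' (\<rho> x)) (S' x) (Q x)" "\<And>x. app (T'' (\<rho> x)) (S' x) (Q' x)"
      using rel_FnE[OF Fn.prems(2) *(1) S'] by metis
    have "P' = Q" using P(3) Q(2) app_det by blast
    then show "\<exists>P P'. rel \<tau> P P' \<and> (\<forall>x. app (T (\<rho> x)) (S x) (P x) \<and> app (T'' (\<rho> x)) (S' x) (P' x))"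
      using Fn.IH(2) P Q by blast
  qed
next
  case (Star \<tau> T T' T'')
  obtain l l' where l: "T = (\<lambda>x. VList (l x))" "T' = (\<lambda>x. VList (l' x))" "fr (\<lambda>x. length (l x))"
    "\<And>x. length (l x) = length (l' x)"
    "rel \<tau> (\<lambda>x. nth0 (zv \<tau>) (l (tl' x)) (x 0)) (\<lambda>x. nth0 (zv \<tau>) (l' (tl' x)) (x 0))"
    using Star.prems(1) by (rule rel_StarE) blast
  obtain k k' where k: "T' = (\<lambda>x. VList (k x))" "T'' = (\<lambda>x. VList (k' x))"
    "fr (\<lambda>x. length (k x))" "\<And>x. length (k x) = length (k' x)"
    "rel \<tau> (\<lambda>x. nth0 (zv \<tau>) (k (tl' x)) (x 0)) (\<lambda>x. nth0 (zv \<tau>) (k' (tl' x)) (x 0))"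
    using Star.prems(2) by (rule rel_StarE) blast
  have "k = l'" using l(2) k(1) by (auto simp: fun_eq_iff)
  then have "rel \<tau> (\<lambda>x. nth0 (zv \<tau>) (l (tl' x)) (x 0)) (\<lambda>x. nth0 (zv \<tau>) (k' (tl' x)) (x 0))"
    using Star.IH[OF l(5)] k(5) by simp
  then show ?case unfolding l(1) k(2) by (intro rel_StarI l(3)) (simp add: l(4) k(4)[symmetric] \<open>k = l'\<close>)
qed

lemma rel_left: "rel \<tau> T T' \<Longrightarrow> rel \<tau> T T" and rel_right: "rel \<tau> T T' \<Longrightarrow> rel \<tau> T' T'"
  using rel_sym rel_trans by blast+

definition el :: "ty \<Rightarrow> val \<Rightarrow> val \<Rightarrow> bool" where
  "el \<tau> a b \<longleftrightarrow> rel \<tau> (\<lambda>_. a) (\<lambda>_. b)"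

lemma rel_el: "rel \<tau> T T' \<Longrightarrow> el \<tau> (T x) (T' x)"
  unfolding el_def using rel_reparam[OF _ frm_const[of x]] by simp

text \<open>Uniformity is already contained in the two families separately, so relating them takes
  only agreement at each parameter. This allows equality of elements to be checked
  pointwise.\<close>

lemma rel_pointwise: "rel \<tau> T T \<Longrightarrow> rel \<tau> T' T' \<Longrightarrow> (\<And>x. el \<tau> (T x) (T' x)) \<Longrightarrow> rel \<tau> T T'"
proof (induction \<tau> arbitrary: T T')
  case (N T T')
  then have "T x = T' x" for x unfolding el_def by (auto simp: fun_eq_iff)
  then have "T = T'" by blast
  then show ?case using N by simp
next
  case (Fn \<sigma> \<tau> T T')
  show ?case
  proof (rule rel_FnI)
    fix \<rho> S S' assume *: "frm \<rho>" "rel \<sigma> S S'"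
    obtain P P0 where P: "rel \<tau> P P0" "\<And>x. app (T (\<rho> x)) (S x) (P x)"
      using rel_FnE[OF Fn.prems(1) * ] by metis
    obtain P1 P' where P': "rel \<tau> P1 P'" "\<And>x. app (T' (\<rho> x)) (S' x) (P' x)"
      using rel_FnE[OF Fn.prems(2) *] by metis
    have "el \<tau> (P x) (P' x)" for x
    proof -
      obtain Q Q' where Q: "rel \<tau> Q Q'" "\<And>y. app (T (\<rho> x)) (S x) (Q y)" "\<And>y. app (T' (\<rho> x)) (S' x) (Q' y)"
        using rel_FnE[OF Fn.prems(3)[of "\<rho> x", unfolded el_def] frm_id rel_el[OF *(2), of x, unfolded el_def]]
        by metis
      have "Q = (\<lambda>_. P x)" "Q' = (\<lambda>_. P' x)" using Q(2,3) P(2) P'(2) app_det by blast+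
      then show ?thesis using Q(1) by (simp add: el_def)
    qed
    then show "\<exists>P P'. rel \<tau> P P' \<and> (\<forall>x. app (T (\<rho> x)) (S x) (P x) \<and> app (T' (\<rho> x)) (S' x) (P' x))"
      using Fn.IH(2)[OF rel_left[OF P(1)] rel_right[OF P'(1)]] P(2) P'(2) by blast
  qed
next
  case (Star \<tau> T T')
  obtain l0 l where l0: "T = (\<lambda>x. VList (l0 x))" "T = (\<lambda>x. VList (l x))" "fr (\<lambda>x. length (l0 x))"
    "\<And>x. length (l0 x) = length (l x)"
    "rel \<tau> (\<lambda>x. nth0 (zv \<tau>) (l0 (tl' x)) (x 0)) (\<lambda>x. nth0 (zv \<tau>) (l (tl' x)) (x 0))"
    using Star.prems(1) by (rule rel_StarE) blast
  have "l0 = l" using l0(1,2) by (auto simp: fun_eq_iff)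
  then have l: "T = (\<lambda>x. VList (l x))" "fr (\<lambda>x. length (l x))"
    "rel \<tau> (\<lambda>x. nth0 (zv \<tau>) (l (tl' x)) (x 0)) (\<lambda>x. nth0 (zv \<tau>) (l (tl' x)) (x 0))"
    using l0 by simp_all
  obtain k l' where k: "T' = (\<lambda>x. VList (k x))" "T' = (\<lambda>x. VList (l' x))" "fr (\<lambda>x. length (k x))"
    "\<And>x. length (k x) = length (l' x)"
    "rel \<tau> (\<lambda>x. nth0 (zv \<tau>) (k (tl' x)) (x 0)) (\<lambda>x. nth0 (zv \<tau>) (l' (tl' x)) (x 0))"
    using Star.prems(2) by (rule rel_StarE) blast
  have "k = l'" using k(1,2) by (auto simp: fun_eq_iff)
  then have l': "T' = (\<lambda>x. VList (l' x))"
    "rel \<tau> (\<lambda>x. nth0 (zv \<tau>) (l' (tl' x)) (x 0)) (\<lambda>x. nth0 (zv \<tau>) (l' (tl' x)) (x 0))"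
    using k by simp_all
  have pt: "length (l x) = length (l' x)" "rel \<tau> (\<lambda>y. nth0 (zv \<tau>) (l x) (y 0)) (\<lambda>y. nth0 (zv \<tau>) (l' x) (y 0))" for x
    using Star.prems(3)[of x] unfolding el_def l(1) l'(1) by (auto simp: fun_eq_iff)
  have "rel \<tau> (\<lambda>x. nth0 (zv \<tau>) (l (tl' x)) (x 0)) (\<lambda>x. nth0 (zv \<tau>) (l' (tl' x)) (x 0))"
  proof (rule Star.IH[OF l(3) l'(2)])
    fix x show "el \<tau> (nth0 (zv \<tau>) (l (tl' x)) (x 0)) (nth0 (zv \<tau>) (l' (tl' x)) (x 0))"
      using rel_el[OF pt(2)[of "tl' x"], of x] .
  qed
  then show ?case unfolding l(1) l'(1) by (intro rel_StarI l(2) pt(1))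
qed

section \<open>The model\<close>

lemma fr_if:
  assumes "ufin (\<lambda>_::unit. c)" "fr g" "fr h"
  shows "fr (\<lambda>x. if c x then g x else h x)"
proof -
  have "ufin (\<lambda>v. c)" by (rule ufin_sub[OF assms(1)]) simp
  then have "ufin (\<lambda>v x. c x \<and> g x = v \<or> \<not> c x \<and> h x = v)"
    using assms(2,3) unfolding fr_def by (intro ufin_disj ufin_conj ufin_not)
  moreover have "(c x \<and> g x = v \<or> \<not> c x \<and> h x = v) = ((if c x then g x else h x) = v)" for x v by auto
  ultimately show ?thesis by (simp add: fr_def)
qed

text \<open>Gluing along a predicate of finite rank handles the border between entries and padding,
  and fixed finite lists.\<close>

lemma rel_if:
  "ufin (\<lambda>_::unit. c) \<Longrightarrow> rel \<tau> T U \<Longrightarrow> rel \<tau> T' U' \<Longrightarrow>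
    rel \<tau> (\<lambda>x. if c x then T x else T' x) (\<lambda>x. if c x then U x else U' x)"
proof (induction \<tau> arbitrary: T U T' U' c)
  case (N T U T' U' c)
  then obtain g h where "fr g" "T = (\<lambda>x. VNum (g x))" "U = T" "fr h" "T' = (\<lambda>x. VNum (h x))" "U' = T'"
    by auto
  then show ?case using fr_if[OF N(1), of g h]
    by (auto intro!: exI[of _ "\<lambda>x. if c x then g x else h x"])
next
  case (Fn \<sigma> \<tau> T U T' U' c)
  show ?case
  proof (rule rel_FnI)
    fix \<rho> S S' assume *: "frm \<rho>" "rel \<sigma> S S'"
    obtain P P' where P: "rel \<tau> P P'" "\<And>x. app (T (\<rho> x)) (S x) (P x)" "\<And>x. app (U (\<rho> x)) (S' x) (P' x)"
      using rel_FnE[OF Fn.prems(2) *] by metis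
    obtain Q Q' where Q: "rel \<tau> Q Q'" "\<And>x. app (T' (\<rho> x)) (S x) (Q x)" "\<And>x. app (U' (\<rho> x)) (S' x) (Q' x)"
      using rel_FnE[OF Fn.prems(3) *] by metis
    show "\<exists>P P'. rel \<tau> P P' \<and> (\<forall>x. app (if c (\<rho> x) then T (\<rho> x) else T' (\<rho> x)) (S x) (P x) \<and>
        app (if c (\<rho> x) then U (\<rho> x) else U' (\<rho> x)) (S' x) (P' x))"
      using Fn.IH(2)[OF ufin_comp1[OF Fn.prems(1) *(1)] P(1) Q(1)] P Q
      by (intro exI[of _ "\<lambda>x. if c (\<rho> x) then P x else Q x"] exI[of _ "\<lambda>x. if c (\<rho> x) then P' x else Q' x"])
        auto
  qed
next
  case (Star \<tau> T U T' U' c)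
  from Star.prems(2) obtain l l' where l: "T = (\<lambda>x. VList (l x))" "U = (\<lambda>x. VList (l' x))"
    "fr (\<lambda>x. length (l x))" "\<And>x. length (l x) = length (l' x)"
    "rel \<tau> (\<lambda>x. nth0 (zv \<tau>) (l (tl' x)) (x 0)) (\<lambda>x. nth0 (zv \<tau>) (l' (tl' x)) (x 0))"
    by (rule rel_StarE) blast
  from Star.prems(3) obtain k k' where k: "T' = (\<lambda>x. VList (k x))" "U' = (\<lambda>x. VList (k' x))"
    "fr (\<lambda>x. length (k x))" "\<And>x. length (k x) = length (k' x)"
    "rel \<tau> (\<lambda>x. nth0 (zv \<tau>) (k (tl' x)) (x 0)) (\<lambda>x. nth0 (zv \<tau>) (k' (tl' x)) (x 0))"
    by (rule rel_StarE) blast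
  have "rel (Star \<tau>) (\<lambda>x. VList (if c x then l x else k x)) (\<lambda>x. VList (if c x then l' x else k' x))"
  proof (rule rel_StarI)
    show "fr (\<lambda>x. length (if c x then l x else k x))"
      using fr_if[OF Star.prems(1) l(3) k(3)] by (simp add: if_distrib cong: if_cong)
    show "length (if c x then l x else k x) = length (if c x then l' x else k' x)" for x
      using l k by simp
    show "rel \<tau> (\<lambda>x. nth0 (zv \<tau>) (if c (tl' x) then l (tl' x) else k (tl' x)) (x 0))
        (\<lambda>x. nth0 (zv \<tau>) (if c (tl' x) then l' (tl' x) else k' (tl' x)) (x 0))"
      using Star.IH[OF ufin_comp1[OF Star.prems(1) frm_tl] l(5) k(5)]
      by (simp add: if_distrib[of "\<lambda>u. nth0 _ u _"] cong: if_cong)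
  qed
  then show ?case unfolding l(1,2) k(1,2) by (simp add: if_distrib cong: if_cong)
qed

lemma rel_zv: "rel \<tau> (\<lambda>_. zv \<tau>) (\<lambda>_. zv \<tau>)"
proof (induction \<tau>)
  case N
  then show ?case using fr_const by auto
next
  case (Fn \<sigma> \<tau>)
  show ?case by (rule rel_FnI) (use Fn.IH(2) in \<open>auto intro!: exI[of _ "\<lambda>_. zv \<tau>"]\<close>)
next
  case (Star \<tau>)
  have "rel (Star \<tau>) (\<lambda>_. VList []) (\<lambda>_. VList [])"
    by (rule rel_StarI) (use Star fr_const in \<open>simp_all add: nth0_def\<close>)
  then show ?case by simp
qed

lemma rel_N: "rel N T T' \<longleftrightarrow> T' = T \<and> (\<exists>g. fr g \<and> T = (\<lambda>x. VNum (g x)))"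
  by simp

lemma rel_NI: "fr g \<Longrightarrow> rel N (\<lambda>x. VNum (g x)) (\<lambda>x. VNum (g x))"
  by auto

declare rel.simps [simp del]

lemma tl'_case [simp]: "tl' (case_nat n x) = x" and case_nat_tl' [simp]: "case_nat (x 0) (tl' x) = x"
  by (auto simp: tl'_def split: nat.splits)

lemma ufin_cons: "ufin (\<lambda>(j, i, v) x. case_nat j x i = v)"
proof -
  have "ufin (\<lambda>p x. (fst (snd p) = 0 \<and> fst p = snd (snd p)) \<or>
      fst (snd p) \<noteq> (0::nat) \<and> x (fst (snd p) - 1) = snd (snd p))"
    by (intro ufin_disj ufin_conj ufin_const ufin_base)
  moreover have "(\<lambda>p x. (fst (snd p) = 0 \<and> fst p = snd (snd p)) \<or> fst (snd p) \<noteq> (0::nat) \<and>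
      x (fst (snd p) - 1) = snd (snd p)) = (\<lambda>(j, i, v) x. case_nat j (x :: baire) i = v)"
    by (auto simp: fun_eq_iff split: nat.split)
  ultimately show ?thesis by (simp only:)
qed

lemma ufin_cons_comp: "ufin P \<Longrightarrow> ufin (\<lambda>(i, n) x. P i (case_nat n x))"
  by (rule ufin_comp[OF _ ufin_cons])

text \<open>Applying the family to the generic number \<open>x 0\<close>, with the parameter moved
  to the tail, captures the values at all numbers in one family.\<close>

lemma uniform:
  assumes "rel (N \<rightarrow> \<tau>) f f'"
  obtains P P' where "rel \<tau> P P'" "\<And>x n. app (f x) (VNum n) (P (case_nat n x))"
    "\<And>x n. app (f' x) (VNum n) (P' (case_nat n x))"
proof -
  obtain P P' where P: "rel \<tau> P P'" "\<And>x. app (f (tl' x)) (VNum (x 0)) (P x)"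
    "\<And>x. app (f' (tl' x)) (VNum (x 0)) (P' x)"
    using rel_FnE[OF assms frm_tl rel_NI[OF fr_proj[of 0]]] by metis
  have "app (f x) (VNum n) (P (case_nat n x))" "app (f' x) (VNum n) (P' (case_nat n x))" for x n
    using P(2)[of "case_nat n x"] P(3)[of "case_nat n x"] by simp_all
  then show thesis using that P(1) by blast
qed

lemma uniform1:
  assumes "rel T1 f f'"
  obtains F where "ufin (\<lambda>(v, n) x. F x n = v)" "\<And>x n. app (f x) (VNum n) (VNum (F x n))"
    "\<And>x n. app (f' x) (VNum n) (VNum (F x n))"
proof -
  obtain P P' where P: "rel N P P'" "\<And>x n. app (f x) (VNum n) (P (case_nat n x))"
    "\<And>x n. app (f' x) (VNum n) (P' (case_nat n x))" using uniform[OF assms] by metis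
  then obtain g where g: "fr g" "P = (\<lambda>x. VNum (g x))" "P' = P" unfolding rel_N by blast
  have "ufin (\<lambda>(v, n) x. g (case_nat n x) = v)" using ufin_cons_comp[OF g(1)[unfolded fr_def]] .
  then show thesis using that[of "\<lambda>x n. g (case_nat n x)"] P(2,3) g by simp
qed

lemma uniform2:
  assumes "rel (N \<rightarrow> N \<rightarrow> N) f f'"
  obtains F where "ufin (\<lambda>(v, y, n) x. F x y n = v)"
    "\<And>x y n. \<exists>p. app (f x) (VNum y) p \<and> app p (VNum n) (VNum (F x y n))"
    "\<And>x y n. \<exists>p. app (f' x) (VNum y) p \<and> app p (VNum n) (VNum (F x y n))"
proof -
  obtain P P' where P: "rel T1 P P'" "\<And>x n. app (f x) (VNum n) (P (case_nat n x))"
    "\<And>x n. app (f' x) (VNum n) (P' (case_nat n x))" using uniform[OF assms] by metis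
  obtain F where F: "ufin (\<lambda>(v, n) x. F x n = v)" "\<And>x n. app (P x) (VNum n) (VNum (F x n))"
    "\<And>x n. app (P' x) (VNum n) (VNum (F x n))" using uniform1[OF P(1)] by metis
  have "ufin (\<lambda>((v, n), y) x. F (case_nat y x) n = v)"
    using ufin_cons_comp[OF F(1)] by (simp add: case_prod_unfold)
  from ufin_reindex[OF this, of "\<lambda>(v, y, n). ((v, n), y)"]
  have "ufin (\<lambda>(v, y, n) x. F (case_nat y x) n = v)" by (simp add: case_prod_unfold)
  then show thesis using that[of "\<lambda>x y n. F (case_nat y x) n"] P(2,3) F(2,3) by blast
qed

text \<open>Constant families of this kind put every function into type 1; a varying one will be fed
  to the functional of \<open>UATR\<close>.\<close>

lemma rel_VFun: "ufin (\<lambda>(v, n) x. h x n = v) \<Longrightarrow> rel T1 (\<lambda>x. VFun (h x)) (\<lambda>x. VFun (h x))"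
proof (rule rel_FnI)
  fix \<rho> S S' assume h: "ufin (\<lambda>(v, n) x. h x n = v)" and \<rho>: "frm \<rho>" and "rel N S S'"
  then obtain s where s: "fr s" "S = (\<lambda>x. VNum (s x))" "S' = S" unfolding rel_N by blast
  have "ufin (\<lambda>p x. s x = snd p)" using ufin_reindex[OF s(1)[unfolded fr_def], of snd] by simp
  moreover have "ufin (\<lambda>p x. h (\<rho> x) (snd p) = fst p)"
    using ufin_comp1[OF h \<rho>] by (simp add: case_prod_unfold)
  ultimately have "ufin (\<lambda>p x. s x = snd p \<and> h (\<rho> x) (snd p) = fst p)" by (intro ufin_conj)
  then have "ufin (\<lambda>v x. \<exists>n. s x = n \<and> h (\<rho> x) n = v)" by (intro ufin_ex) (simp add: case_prod_unfold)
  then have "fr (\<lambda>x. h (\<rho> x) (s x))" by (simp add: fr_def)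
  from rel_NI[OF this]
  show "\<exists>P P'. rel N P P' \<and> (\<forall>x. app (VFun (h (\<rho> x))) (S x) (P x) \<and> app (VFun (h (\<rho> x))) (S' x) (P' x))"
    using s by (auto intro!: exI[of _ "\<lambda>x. VNum (h (\<rho> x) (s x))"])
qed

section \<open>The constants respect the relation\<close>

fun vc :: "tm \<Rightarrow> val" where
  "vc ZeroC = VNum 0"
| "vc SucC = VSuc"
| "vc (KC _ _) = VK"
| "vc (SC _ _ _) = VS"
| "vc RecC = VRec"
| "vc (SeqC _) = VSeq"
| "vc (LenC _) = VLen"
| "vc (EntC \<tau>) = VEnt (zv \<tau>)"
| "vc _ = VNum 0"

lemma rel_Suc: "rel T1 (\<lambda>_. VSuc) (\<lambda>_. VSuc)"
proof (rule rel_FnI)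
  fix \<rho> S S' assume "frm \<rho>" "rel N S S'"
  then obtain s where s: "fr s" "S = (\<lambda>x. VNum (s x))" "S' = S" unfolding rel_N by blast
  show "\<exists>P P'. rel N P P' \<and> (\<forall>x. app VSuc (S x) (P x) \<and> app VSuc (S' x) (P' x))"
    using rel_NI[OF fr_map[OF s(1), of Suc]] s by (auto intro!: exI[of _ "\<lambda>x. VNum (Suc (s x))"])
qed

lemma rel_K: "rel (\<sigma> \<rightarrow> \<tau> \<rightarrow> \<sigma>) (\<lambda>_. VK) (\<lambda>_. VK)"
proof (rule rel_FnI)
  fix \<rho> S S' assume S: "frm \<rho>" "rel \<sigma> S S'"
  have "rel (\<tau> \<rightarrow> \<sigma>) (\<lambda>x. VK1 (S x)) (\<lambda>x. VK1 (S' x))"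
  proof (rule rel_FnI)
    fix \<rho>' U U' assume "frm \<rho>'" "rel \<tau> U U'"
    then show "\<exists>P P'. rel \<sigma> P P' \<and> (\<forall>x. app (VK1 (S (\<rho>' x))) (U x) (P x) \<and> app (VK1 (S' (\<rho>' x))) (U' x) (P' x))"
      using rel_reparam[OF S(2)] by auto
  qed
  then show "\<exists>P P'. rel (\<tau> \<rightarrow> \<sigma>) P P' \<and> (\<forall>x. app VK (S x) (P x) \<and> app VK (S' x) (P' x))" by auto
qed

lemma rel_S: "rel ((\<delta> \<rightarrow> \<sigma> \<rightarrow> \<tau>) \<rightarrow> (\<delta> \<rightarrow> \<sigma>) \<rightarrow> \<delta> \<rightarrow> \<tau>) (\<lambda>_. VS) (\<lambda>_. VS)"
proof (rule rel_FnI)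
  fix \<rho>0 A A' assume A: "frm \<rho>0" "rel (\<delta> \<rightarrow> \<sigma> \<rightarrow> \<tau>) A A'"
  have "rel ((\<delta> \<rightarrow> \<sigma>) \<rightarrow> \<delta> \<rightarrow> \<tau>) (\<lambda>x. VS1 (A x)) (\<lambda>x. VS1 (A' x))"
  proof (rule rel_FnI)
    fix \<rho> B B' assume B: "frm \<rho>" "rel (\<delta> \<rightarrow> \<sigma>) B B'"
    have "rel (\<delta> \<rightarrow> \<tau>) (\<lambda>x. VS2 (A (\<rho> x)) (B x)) (\<lambda>x. VS2 (A' (\<rho> x)) (B' x))"
    proof (rule rel_FnI)
      fix \<rho>' C C' assume C: "frm \<rho>'" "rel \<delta> C C'"
      obtain P P' where P: "rel (\<sigma> \<rightarrow> \<tau>) P P'" "\<And>x. app (A (\<rho> (\<rho>' x))) (C x) (P x)"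
        "\<And>x. app (A' (\<rho> (\<rho>' x))) (C' x) (P' x)"
        using rel_FnE[OF A(2) frm_comp[OF B(1) C(1)] C(2)] by metis
      obtain Q Q' where Q: "rel \<sigma> Q Q'" "\<And>x. app (B (\<rho>' x)) (C x) (Q x)" "\<And>x. app (B' (\<rho>' x)) (C' x) (Q' x)"
        using rel_FnE[OF B(2) C] by metis
      obtain R R' where R: "rel \<tau> R R'" "\<And>x. app (P x) (Q x) (R x)" "\<And>x. app (P' x) (Q' x) (R' x)"
        using rel_FnE[OF P(1) frm_id Q(1)] by metis
      show "\<exists>P P'. rel \<tau> P P' \<and> (\<forall>x. app (VS2 (A (\<rho> (\<rho>' x))) (B (\<rho>' x))) (C x) (P x) \<and>
          app (VS2 (A' (\<rho> (\<rho>' x))) (B' (\<rho>' x))) (C' x) (P' x))"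
        using R(1) appS[OF P(2) Q(2) R(2)] appS[OF P(3) Q(3) R(3)] by blast
    qed
    then show "\<exists>P P'. rel (\<delta> \<rightarrow> \<tau>) P P' \<and> (\<forall>x. app (VS1 (A (\<rho> x))) (B x) (P x) \<and> app (VS1 (A' (\<rho> x))) (B' x) (P' x))"
      by auto
  qed
  then show "\<exists>P P'. rel ((\<delta> \<rightarrow> \<sigma>) \<rightarrow> \<delta> \<rightarrow> \<tau>) P P' \<and> (\<forall>x. app VS (A x) (P x) \<and> app VS (A' x) (P' x))" by auto
qed

lemma app_rec:
  assumes "\<And>y n. \<exists>p. app g (VNum y) p \<and> app p (VNum n) (VNum (F y n))"
  shows "app (VRec2 (VNum n) (VNum b)) g (VNum (rec_nat b (\<lambda>n y. F y n) n))"
proof (induction n)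
  case (Suc n)
  obtain p where "app g (VNum (rec_nat b (\<lambda>n y. F y n) n)) p"
    "app p (VNum n) (VNum (F (rec_nat b (\<lambda>n y. F y n) n) n))" using assms by blast
  then show ?case using appR[OF Suc] by simp
qed simp

text \<open>Unfolding a recursion step by step would raise the rank with the number of steps. One
  existential quantifier over a whole computation describes the value with a rank that does not
  depend on \<open>n\<close>.\<close>

lemma rec_nat_list:
  "rec_nat b (\<lambda>n y. F y n) n = v \<longleftrightarrow>
    (\<exists>l::nat list. length l = Suc n \<and> l ! 0 = b \<and> (\<forall>i. i < n \<longrightarrow> F (l ! i) i = l ! Suc i) \<and> l ! n = v)"
proof
  assume "rec_nat b (\<lambda>n y. F y n) n = v"
  then show "\<exists>l::nat list. length l = Suc n \<and> l ! 0 = b \<and> (\<forall>i. i < n \<longrightarrow> F (l ! i) i = l ! Suc i) \<and> l ! n = v"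
    by (intro exI[of _ "map (rec_nat b (\<lambda>n y. F y n)) [0..<Suc n]"]) (auto simp del: upt_Suc)
next
  assume "\<exists>l::nat list. length l = Suc n \<and> l ! 0 = b \<and> (\<forall>i. i < n \<longrightarrow> F (l ! i) i = l ! Suc i) \<and> l ! n = v"
  then obtain l :: "nat list" where l: "l ! 0 = b" "\<And>i. i < n \<Longrightarrow> F (l ! i) i = l ! Suc i" "l ! n = v" by blast
  have "i \<le> n \<Longrightarrow> rec_nat b (\<lambda>n y. F y n) i = l ! i" for i
    by (induction i) (use l in auto)
  then show "rec_nat b (\<lambda>n y. F y n) n = v" using l(3) by simp
qed

lemma fr_rec:
  assumes "fr a" "fr b" "ufin (\<lambda>(v, y, n) x. F x y n = v)"
  shows "fr (\<lambda>x. rec_nat (b x) (\<lambda>n y. F x y n) (a x))"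
proof -
  let ?Q = "\<lambda>(q :: nat \<times> nat list) n x. a x = n \<and> length (snd q) = Suc n \<and> b x = snd q ! 0 \<and>
      (\<forall>i. i < n \<longrightarrow> F x (snd q ! i) i = snd q ! Suc i) \<and> snd q ! n = fst q"
  have 1: "ufin (\<lambda>p x. a x = h p)" for h :: "'p \<Rightarrow> nat"
    using ufin_reindex[OF assms(1)[unfolded fr_def], of h] by simp
  have 2: "ufin (\<lambda>p x. b x = h p)" for h :: "'p \<Rightarrow> nat"
    using ufin_reindex[OF assms(2)[unfolded fr_def], of h] by simp
  have 3: "ufin (\<lambda>p x. F x (h1 p) (h2 p) = h3 p)" for h1 h2 h3 :: "'p \<Rightarrow> nat"
    using ufin_reindex[OF assms(3), of "\<lambda>p. (h3 p, h1 p, h2 p)"] by simp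
  have "ufin (\<lambda>q x. snd q < snd (fst q) \<longrightarrow> F x (snd (fst (fst q)) ! snd q) (snd q) = snd (fst (fst q)) ! Suc (snd q))"
    by (intro ufin_imp ufin_const 3)
  then have all: "ufin (\<lambda>p x. \<forall>i. i < snd p \<longrightarrow> F x (snd (fst p) ! i) i = snd (fst p) ! Suc i)"
    by (intro ufin_all) (auto simp: case_prod_unfold elim!: ufin_sub)
  have "ufin (\<lambda>p x. a x = snd p \<and> length (snd (fst p)) = Suc (snd p) \<and> b x = snd (fst p) ! 0 \<and>
      (\<forall>i. i < snd p \<longrightarrow> F x (snd (fst p) ! i) i = snd (fst p) ! Suc i) \<and> snd (fst p) ! snd p = fst (fst p))"
    by (intro ufin_conj ufin_const 1 2 all)
  then have "ufin (\<lambda>(q, n). ?Q q n)" by (simp only: case_prod_unfold)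
  then have "ufin (\<lambda>q x. \<exists>n. ?Q q n x)" by (rule ufin_ex)
  then have "ufin (\<lambda>(v, l) x. \<exists>n. ?Q (v, l) n x)" by (simp only: case_prod_unfold prod.collapse)
  then have "ufin (\<lambda>v x. \<exists>l n. ?Q (v, l) n x)" by (rule ufin_ex)
  then have "ufin (\<lambda>v x. \<exists>l n. a x = n \<and> length l = Suc n \<and> b x = l ! 0 \<and>
      (\<forall>i. i < n \<longrightarrow> F x (l ! i) i = l ! Suc i) \<and> l ! n = v)" by (simp only: fst_conv snd_conv)
  moreover have "(\<exists>l n. a x = n \<and> length l = Suc n \<and> b x = l ! 0 \<and>
      (\<forall>i. i < n \<longrightarrow> F x (l ! i) i = l ! Suc i) \<and> l ! n = v) =
    (rec_nat (b x) (\<lambda>n y. F x y n) (a x) = v)" for x v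
    unfolding rec_nat_list by auto
  ultimately show ?thesis by (simp add: fr_def)
qed

lemma rel_Rec: "rel (N \<rightarrow> N \<rightarrow> (N \<rightarrow> N \<rightarrow> N) \<rightarrow> N) (\<lambda>_. VRec) (\<lambda>_. VRec)"
proof (rule rel_FnI)
  fix \<rho>0 A A' assume "frm \<rho>0" "rel N A A'"
  then obtain a where a: "fr a" "A = (\<lambda>x. VNum (a x))" "A' = A" unfolding rel_N by blast
  have "rel (N \<rightarrow> (N \<rightarrow> N \<rightarrow> N) \<rightarrow> N) (\<lambda>x. VRec1 (A x)) (\<lambda>x. VRec1 (A' x))"
  proof (rule rel_FnI)
    fix \<rho> B B' assume \<rho>: "frm \<rho>" and "rel N B B'"
    then obtain b where b: "fr b" "B = (\<lambda>x. VNum (b x))" "B' = B" unfolding rel_N by blast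
    have "rel ((N \<rightarrow> N \<rightarrow> N) \<rightarrow> N) (\<lambda>x. VRec2 (A (\<rho> x)) (B x)) (\<lambda>x. VRec2 (A' (\<rho> x)) (B' x))"
    proof (rule rel_FnI)
      fix \<rho>' G G' assume \<rho>': "frm \<rho>'" and G: "rel (N \<rightarrow> N \<rightarrow> N) G G'"
      obtain F where F: "ufin (\<lambda>(v, y, n) x. F x y n = v)"
        "\<And>x y n. \<exists>p. app (G x) (VNum y) p \<and> app p (VNum n) (VNum (F x y n))"
        "\<And>x y n. \<exists>p. app (G' x) (VNum y) p \<and> app p (VNum n) (VNum (F x y n))"
        using uniform2[OF G] by metis
      have "fr (\<lambda>x. rec_nat (b (\<rho>' x)) (\<lambda>n y. F x y n) (a (\<rho> (\<rho>' x))))"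
        by (rule fr_rec[OF fr_comp[OF a(1) frm_comp[OF \<rho> \<rho>']] fr_comp[OF b(1) \<rho>'] F(1)])
      from rel_NI[OF this] app_rec[OF F(2)] app_rec[OF F(3)]
      show "\<exists>P P'. rel N P P' \<and> (\<forall>x. app (VRec2 (A (\<rho> (\<rho>' x))) (B (\<rho>' x))) (G x) (P x) \<and>
          app (VRec2 (A' (\<rho> (\<rho>' x))) (B' (\<rho>' x))) (G' x) (P' x))"
        unfolding a(2,3) b(2,3) by blast
    qed
    then show "\<exists>P P'. rel ((N \<rightarrow> N \<rightarrow> N) \<rightarrow> N) P P' \<and>
        (\<forall>x. app (VRec1 (A (\<rho> x))) (B x) (P x) \<and> app (VRec1 (A' (\<rho> x))) (B' x) (P' x))" by auto
  qed
  then show "\<exists>P P'. rel (N \<rightarrow> (N \<rightarrow> N \<rightarrow> N) \<rightarrow> N) P P' \<and> (\<forall>x. app VRec (A x) (P x) \<and> app VRec (A' x) (P' x))"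
    by auto
qed

lemma rel_Seq: "rel (N \<rightarrow> (N \<rightarrow> \<tau>) \<rightarrow> Star \<tau>) (\<lambda>_. VSeq) (\<lambda>_. VSeq)"
proof (rule rel_FnI)
  fix \<rho>0 A A' assume "frm \<rho>0" "rel N A A'"
  then obtain a where a: "fr a" "A = (\<lambda>x. VNum (a x))" "A' = A" unfolding rel_N by blast
  have "rel ((N \<rightarrow> \<tau>) \<rightarrow> Star \<tau>) (\<lambda>x. VSeq1 (a x)) (\<lambda>x. VSeq1 (a x))"
  proof (rule rel_FnI)
    fix \<rho> f f' assume \<rho>: "frm \<rho>" and f: "rel (N \<rightarrow> \<tau>) f f'"
    obtain P P' where P: "rel \<tau> P P'" "\<And>x n. app (f x) (VNum n) (P (case_nat n x))"
      "\<And>x n. app (f' x) (VNum n) (P' (case_nat n x))" using uniform[OF f] by metis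
    define m where "m x = a (\<rho> x)" for x
    have m: "fr m" unfolding m_def using fr_comp[OF a(1) \<rho>] .
    let ?l = "\<lambda>P x. map (\<lambda>i. P (case_nat i x)) [0..<m x]"
    have "rel (Star \<tau>) (\<lambda>x. VList (?l P x)) (\<lambda>x. VList (?l P' x))"
    proof (rule rel_StarI)
      have "ufin (\<lambda>p x. x 0 = snd p \<and> snd p < fst p)"
        by (intro ufin_conj ufin_const ufin_base)
      then have "ufin (\<lambda>(n, i) x. x 0 = i \<and> i < n)" by (simp only: case_prod_unfold)
      then have 1: "ufin (\<lambda>n x. \<exists>i. x 0 = i \<and> i < n)" by (rule ufin_ex)
      have "ufin (\<lambda>n x. m (tl' x) = n)" using ufin_comp1[OF m[unfolded fr_def] frm_tl] .
      from ufin_conj[OF this 1]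
      have "ufin (\<lambda>(u::unit, n) x. m (tl' x) = n \<and> (\<exists>i. x 0 = i \<and> i < n))"
        by (rule ufin_sub) auto
      then have "ufin (\<lambda>_::unit. \<lambda>x. \<exists>n. m (tl' x) = n \<and> (\<exists>i. x 0 = i \<and> i < n))"
        by (rule ufin_ex)
      then have "ufin (\<lambda>_::unit. \<lambda>x. x 0 < m (tl' x))" by simp
      \<comment> \<open>Below the length the entries come from \<open>P\<close>, from there on they
        are padding.\<close>
      from rel_if[OF this P(1) rel_zv]
      show "rel \<tau> (\<lambda>x. nth0 (zv \<tau>) (?l P (tl' x)) (x 0)) (\<lambda>x. nth0 (zv \<tau>) (?l P' (tl' x)) (x 0))"
        by (simp add: nth0_def if_distrib cong: if_cong)
    qed (use m in simp_all)
    moreover have "app (VSeq1 (a (\<rho> x))) (f x) (VList (?l P x))" "app (VSeq1 (a (\<rho> x))) (f' x) (VList (?l P' x))" for x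
      using P(2,3) by (auto intro!: appQ simp: m_def)
    ultimately show "\<exists>P P'. rel (Star \<tau>) P P' \<and> (\<forall>x. app (VSeq1 (a (\<rho> x))) (f x) (P x) \<and> app (VSeq1 (a (\<rho> x))) (f' x) (P' x))"
      by blast
  qed
  then show "\<exists>P P'. rel ((N \<rightarrow> \<tau>) \<rightarrow> Star \<tau>) P P' \<and> (\<forall>x. app VSeq (A x) (P x) \<and> app VSeq (A' x) (P' x))"
    unfolding a by auto
qed

lemma rel_Len: "rel (Star \<tau> \<rightarrow> N) (\<lambda>_. VLen) (\<lambda>_. VLen)"
proof (rule rel_FnI)
  fix \<rho> S S' assume "frm \<rho>" "rel (Star \<tau>) S S'"
  from this(2) obtain l l' where l: "S = (\<lambda>x. VList (l x))" "S' = (\<lambda>x. VList (l' x))"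
    "fr (\<lambda>x. length (l x))" "\<And>x. length (l x) = length (l' x)"
    by (rule rel_StarE) blast
  then show "\<exists>P P'. rel N P P' \<and> (\<forall>x. app VLen (S x) (P x) \<and> app VLen (S' x) (P' x))"
    using rel_NI[OF l(3)] by auto
qed

lemma rel_Ent: "rel (Star \<tau> \<rightarrow> N \<rightarrow> \<tau>) (\<lambda>_. VEnt (zv \<tau>)) (\<lambda>_. VEnt (zv \<tau>))"
proof (rule rel_FnI)
  fix \<rho>0 S S' assume "frm \<rho>0" "rel (Star \<tau>) S S'"
  from this(2) obtain l l' where l: "S = (\<lambda>x. VList (l x))" "S' = (\<lambda>x. VList (l' x))"
    "rel \<tau> (\<lambda>x. nth0 (zv \<tau>) (l (tl' x)) (x 0)) (\<lambda>x. nth0 (zv \<tau>) (l' (tl' x)) (x 0))"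
    by (rule rel_StarE) blast
  have "rel (N \<rightarrow> \<tau>) (\<lambda>x. VEnt1 (zv \<tau>) (S x)) (\<lambda>x. VEnt1 (zv \<tau>) (S' x))"
  proof (rule rel_FnI)
    fix \<rho> I I' assume \<rho>: "frm \<rho>" and "rel N I I'"
    then obtain i where i: "fr i" "I = (\<lambda>x. VNum (i x))" "I' = I" unfolding rel_N by blast
    have "rel \<tau> (\<lambda>x. nth0 (zv \<tau>) (l (\<rho> x)) (i x)) (\<lambda>x. nth0 (zv \<tau>) (l' (\<rho> x)) (i x))"
      using rel_reparam[OF l(3) frm_cons[OF i(1) \<rho>]] by simp
    then show "\<exists>P P'. rel \<tau> P P' \<and> (\<forall>x. app (VEnt1 (zv \<tau>) (S (\<rho> x))) (I x) (P x) \<and>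
        app (VEnt1 (zv \<tau>) (S' (\<rho> x))) (I' x) (P' x))"
      unfolding l(1,2) i by auto
  qed
  then show "\<exists>P P'. rel (N \<rightarrow> \<tau>) P P' \<and> (\<forall>x. app (VEnt (zv \<tau>)) (S x) (P x) \<and> app (VEnt (zv \<tau>)) (S' x) (P' x))"
    by auto
qed

lemma least0_iff: "least0 v = k \<longleftrightarrow> v k = 0 \<and> (\<forall>m. m < k \<longrightarrow> v m \<noteq> 0) \<or> (\<forall>n. v n \<noteq> 0) \<and> k = 0"
proof (cases "\<forall>m. v m \<noteq> 0")
  case True
  then have "\<not> (\<exists>m. v m = 0)" by metis
  then have "least0 v = 0" unfolding least0_def by (rule if_not_P)
  then show ?thesis using True by metis
next
  case False
  then have ex: "\<exists>m. v m = 0" by metis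
  define L where "L = (LEAST m. v m = 0)"
  have L: "v L = 0" unfolding L_def using ex by (rule LeastI_ex)
  have lt: "v m \<noteq> 0" if "m < L" for m using not_less_Least[OF that[unfolded L_def]] .
  have "least0 v = L" unfolding least0_def L_def using ex by (rule if_P)
  moreover have "L = k" if "v k = 0" "\<forall>m. m < k \<longrightarrow> v m \<noteq> 0"
    using L lt[of k] that by (meson linorder_neqE_nat)
  ultimately show ?thesis using L lt by metis
qed

text \<open>By \<open>least0_iff\<close> the graph of the operator is arithmetical in that of its
  argument, which costs a fixed number of levels.\<close>

lemma rel_Mu: "rel T2 (\<lambda>_. VMu) (\<lambda>_. VMu)"
proof (rule rel_FnI)
  fix \<rho> f f' assume "frm \<rho>" and f: "rel T1 f f'"
  obtain F where F: "ufin (\<lambda>(v, n) x. F x n = v)" "\<And>x n. app (f x) (VNum n) (VNum (F x n))"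
    "\<And>x n. app (f' x) (VNum n) (VNum (F x n))" using uniform1[OF f] by metis
  have 1: "ufin (\<lambda>p x. F x (h p) = 0)" for h :: "'p \<Rightarrow> nat"
    using ufin_reindex[OF F(1), of "\<lambda>p. (0, h p)"] by simp
  have "ufin (\<lambda>p x. snd p < fst p \<longrightarrow> F x (snd p) \<noteq> 0)"
    by (intro ufin_imp ufin_const ufin_not 1)
  then have 2: "ufin (\<lambda>k x. \<forall>m. m < k \<longrightarrow> F x m \<noteq> 0)"
    by (intro ufin_all) (simp add: case_prod_unfold)
  have "ufin (\<lambda>p x. F x (snd p) \<noteq> 0)" by (intro ufin_not 1)
  then have 3: "ufin (\<lambda>k::nat. \<lambda>x. \<forall>n. F x n \<noteq> 0)"
    by (intro ufin_all) (simp add: case_prod_unfold)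
  have "ufin (\<lambda>k x. F x k = 0 \<and> (\<forall>m. m < k \<longrightarrow> F x m \<noteq> 0) \<or> (\<forall>n. F x n \<noteq> 0) \<and> k = 0)"
    by (intro ufin_disj ufin_conj ufin_const 1 2 3)
  then have "fr (\<lambda>x. least0 (F x))" by (simp add: fr_def least0_iff)
  from rel_NI[OF this] appM[of "f _" "F _", OF F(2)] appM[of "f' _" "F _", OF F(3)]
  show "\<exists>P P'. rel N P P' \<and> (\<forall>x. app VMu (f x) (P x) \<and> app VMu (f' x) (P' x))" by blast
qed

lemma rel_const: "is_cst c \<Longrightarrow> rel (typ_of c) (\<lambda>_. vc c) (\<lambda>_. vc c)"
  using rel_NI[OF fr_const] rel_Suc rel_K rel_S rel_Rec rel_Seq rel_Len rel_Ent
  by (cases c) simp_all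

section \<open>The structure of related values\<close>

definition VD :: "ty \<Rightarrow> val set" where
  "VD \<tau> = {a. el \<tau> a a}"

lemma el_sym: "el \<tau> a b \<Longrightarrow> el \<tau> b a" and el_trans: "el \<tau> a b \<Longrightarrow> el \<tau> b c \<Longrightarrow> el \<tau> a c"
  unfolding el_def using rel_sym rel_trans by blast+

lemma el_VD: "el \<tau> a b \<Longrightarrow> a \<in> VD \<tau> \<and> b \<in> VD \<tau>"
  unfolding VD_def using el_sym el_trans by blast

lemma el_ap:
  assumes "el (\<sigma> \<rightarrow> \<tau>) a a'" "el \<sigma> b b'"
  shows "\<exists>p p'. app a b p \<and> app a' b' p' \<and> el \<tau> p p'"
proof -
  obtain P P' where P: "rel \<tau> P P'" "\<And>x. app a b (P x)" "\<And>x. app a' b' (P' x)"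
    using rel_FnE[OF assms(1)[unfolded el_def] frm_id assms(2)[unfolded el_def]] by metis
  then show ?thesis using rel_el[OF P(1), of undefined] by blast
qed

lemma app_vap: "a \<in> VD (\<sigma> \<rightarrow> \<tau>) \<Longrightarrow> b \<in> VD \<sigma> \<Longrightarrow> app a b (vap a b)"
  using el_ap[of \<sigma> \<tau> a a b b] vap_eq unfolding VD_def by auto

lemma el_vap: "el (\<sigma> \<rightarrow> \<tau>) a a' \<Longrightarrow> el \<sigma> b b' \<Longrightarrow> el \<tau> (vap a b) (vap a' b')"
  using el_ap vap_eq by metis

lemma VD_ap: "a \<in> VD (\<sigma> \<rightarrow> \<tau>) \<Longrightarrow> b \<in> VD \<sigma> \<Longrightarrow> vap a b \<in> VD \<tau>"
  unfolding VD_def using el_vap by blast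

lemma el_N: "el N a b \<longleftrightarrow> a = b \<and> (\<exists>n. a = VNum n)"
proof -
  have "fr (\<lambda>_. n)" for n by (rule fr_const)
  moreover have "(\<exists>g. fr g \<and> (\<lambda>_. a) = (\<lambda>x. VNum (g x))) \<Longrightarrow> \<exists>n. a = VNum n" by (metis (no_types))
  ultimately show ?thesis unfolding el_def rel_N by (auto simp: fun_eq_iff)
qed

lemma VD_N: "a \<in> VD N \<longleftrightarrow> (\<exists>n. a = VNum n)"
  by (simp add: VD_def el_N)

lemma VNum_VD [simp]: "VNum n \<in> VD N"
  by (simp add: VD_N)

lemma VD_cst: "is_cst c \<Longrightarrow> vc c \<in> VD (typ_of c)"
  using rel_const by (simp add: VD_def el_def)

declare vc.simps [simp del]

lemma vap_simps [simp]:
  "vap VSuc (VNum n) = VNum (Suc n)" "vap VK a = VK1 a" "vap (VK1 a) b = a" "vap VS a = VS1 a"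
  "vap (VS1 a) b = VS2 a b" "vap VRec a = VRec1 a" "vap (VRec1 a) b = VRec2 a b"
  "vap (VRec2 (VNum 0) b) g = b" "vap VSeq (VNum n) = VSeq1 n" "vap VLen (VList l) = VNum (length l)"
  "vap (VEnt z) w = VEnt1 z w" "vap (VEnt1 z (VList l)) (VNum i) = nth0 z l i"
  "vap (VFun f) (VNum n) = VNum (f n)"
  by (auto intro!: vap_eq)

text \<open>Identity is used for numerals only. No quotient is taken at higher types, since equality
  there is built from type 0 by \<open>EQ\<close>.\<close>

interpretation V0: struct VD vap vc "(=)"
  by unfold_locales (auto intro: VD_ap VD_cst)

interpretation V: arith VD vap vc
proof
  fix a b \<sigma> \<tau> assume "a \<in> VD \<sigma>" "b \<in> VD \<tau>"
  then show "vap (vap (vc (KC \<sigma> \<tau>)) a) b = a" by (simp add: vc.simps)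
next
  fix a b c \<delta> \<sigma> \<tau> assume *: "a \<in> VD (\<delta> \<rightarrow> \<sigma> \<rightarrow> \<tau>)" "b \<in> VD (\<delta> \<rightarrow> \<sigma>)" "c \<in> VD \<delta>"
  have "app (VS2 a b) c (vap (vap a c) (vap b c))"
    using appS[OF app_vap[OF *(1,3)] app_vap[OF *(2,3)] app_vap[OF VD_ap[OF *(1,3)] VD_ap[OF *(2,3)]]] .
  then show "vap (vap (vap (vc (SC \<delta> \<sigma> \<tau>)) a) b) c = vap (vap a c) (vap b c)"
    by (simp add: vc.simps vap_eq)
next
  fix a b assume "a \<in> VD N" "b \<in> VD N" "vap (vc SucC) a = vap (vc SucC) b"
  then show "a = b" by (auto simp: VD_N vc.simps)
next
  fix a assume "a \<in> VD N"
  then show "vap (vc SucC) a \<noteq> vc ZeroC" by (auto simp: VD_N vc.simps)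
next
  fix b g assume "b \<in> VD N" "g \<in> VD (N \<rightarrow> N \<rightarrow> N)"
  then show "vap (vap (vap (vc RecC) (vc ZeroC)) b) g = b" by (simp add: vc.simps)
next
  fix a b g assume *: "a \<in> VD N" "b \<in> VD N" "g \<in> VD (N \<rightarrow> N \<rightarrow> N)"
  then obtain n where n: "a = VNum n" by (auto simp: VD_N)
  let ?r = "vap (vap (vap (vc RecC) a) b) g"
  have r: "?r \<in> VD N" using * V0.csts_D(5) VD_ap by metis
  have "app (VRec2 a b) g ?r"
    using app_vap[OF VD_ap[OF VD_ap[OF V0.csts_D(5) *(1)] *(2)] *(3)] by (simp add: vc.simps)
  then have "app (VRec2 (VNum (Suc n)) b) g (vap (vap g ?r) a)"
    using appR[OF _ app_vap[OF *(3) r]] app_vap[OF VD_ap[OF *(3) r] *(1)] n by blast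
  then show "vap (vap (vap (vc RecC) (vap (vc SucC) a)) b) g = vap (vap g ?r) a"
    by (simp add: vc.simps vap_eq n)
next
  fix \<phi> \<rho> a
  assume base: "V0.sat (upd \<rho> ''x'' N (vc ZeroC)) \<phi>"
    and step: "\<And>a. a \<in> VD N \<Longrightarrow> V0.sat (upd \<rho> ''x'' N a) \<phi> \<Longrightarrow> V0.sat (upd \<rho> ''x'' N (vap (vc SucC) a)) \<phi>"
    and "a \<in> VD N"
  then obtain n where n: "a = VNum n" by (auto simp: VD_N)
  have "V0.sat (upd \<rho> ''x'' N (VNum n)) \<phi>"
  proof (induction n)
    case 0
    then show ?case using base by (simp add: vc.simps)
  next
    case (Suc n)
    then show ?case using step[of "VNum n"] by (simp add: vc.simps)
  qed
  then show "V0.sat (upd \<rho> ''x'' N a) \<phi>" using n by simp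
qed

lemma pl_num [simp]: "vap (vap V.cplus (VNum a)) (VNum b) = VNum (a + b)"
proof (induction a)
  case 0
  then show ?case using V.pl_Z[of "VNum b"] by (simp add: vc.simps)
next
  case (Suc a)
  then show ?case using V.pl_S[of "VNum a" "VNum b"] by (simp add: vc.simps)
qed

lemma pd_num [simp]: "vap V.cpred (VNum a) = VNum (a - 1)"
proof (cases a)
  case 0
  then show ?thesis using V.pd_Z by (simp add: vc.simps)
next
  case (Suc b)
  then show ?thesis using V.pd_S[of "VNum b"] by (simp add: vc.simps)
qed

lemma mn_num [simp]: "vap (vap V.cmon (VNum a)) (VNum b) = VNum (a - b)"
proof (induction b)
  case 0
  then show ?case using V.mn_Z[of "VNum a"] by (simp add: vc.simps)
next
  case (Suc b)
  then show ?case using V.mn_S[of "VNum a" "VNum b"] by (simp add: vc.simps)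
qed

lemma tri_num [simp]: "vap V.ctri (VNum a) = VNum (triangle a)"
proof (induction a)
  case 0
  then show ?case using V.tri_Z by (simp add: vc.simps)
next
  case (Suc a)
  then show ?case using V.tri_S[of "VNum a"] by (simp add: vc.simps)
qed

lemma pr_num [simp]: "vap (vap V.cpair (VNum a)) (VNum b) = VNum (prod_encode (a, b))"
  using V.pair_eq[of "VNum a" "VNum b"] by (simp add: prod_encode_def)

lemma VD_Star_iff: "el (Star \<tau>) a b \<longleftrightarrow> (\<exists>l m. a = VList l \<and> b = VList m \<and> length l = length m \<and>
    (\<forall>i < length l. el \<tau> (l ! i) (m ! i)))"
proof
  assume "el (Star \<tau>) a b"
  then obtain l l' where l: "(\<lambda>_. a) = (\<lambda>x. VList (l x))" "(\<lambda>_. b) = (\<lambda>x. VList (l' x))"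
    "\<And>x. length (l x) = length (l' x)"
    "rel \<tau> (\<lambda>x. nth0 (zv \<tau>) (l (tl' x)) (x 0)) (\<lambda>x. nth0 (zv \<tau>) (l' (tl' x)) (x 0))"
    unfolding el_def by (rule rel_StarE) blast
  fix x0 :: baire
  have "el \<tau> (l x0 ! i) (l' x0 ! i)" if "i < length (l x0)" for i
    using rel_el[OF l(4), of "case_nat i x0"] that l(3)[of x0] by (simp add: nth0_def)
  then show "\<exists>l m. a = VList l \<and> b = VList m \<and> length l = length m \<and> (\<forall>i < length l. el \<tau> (l ! i) (m ! i))"
    using fun_cong[OF l(1), of x0] fun_cong[OF l(2), of x0] l(3)[of x0] by blast
next
  assume "\<exists>l m. a = VList l \<and> b = VList m \<and> length l = length m \<and> (\<forall>i < length l. el \<tau> (l ! i) (m ! i))"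
  then obtain l m where lm: "a = VList l" "b = VList m" "length l = length m"
    "\<And>i. i < length l \<Longrightarrow> el \<tau> (l ! i) (m ! i)" by blast
  \<comment> \<open>A fixed list is finite, so its entries can be glued one at a time by
    \<open>rel_if\<close>.\<close>
  have key: "rel \<tau> (\<lambda>x. nth0 (zv \<tau>) k (x 0)) (\<lambda>x. nth0 (zv \<tau>) k (x 0))"
    if "\<And>i. i < length k \<Longrightarrow> el \<tau> (k ! i) (k ! i)" for k
    using that
  proof (induction k rule: rev_induct)
    case Nil
    then show ?case using rel_zv by (simp add: nth0_def)
  next
    case (snoc a k)
    have "el \<tau> a a" using snoc.prems[of "length k"] by simp
    moreover have "rel \<tau> (\<lambda>x. nth0 (zv \<tau>) k (x 0)) (\<lambda>x. nth0 (zv \<tau>) k (x 0))"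
      using snoc.IH snoc.prems by (metis length_append less_Suc_eq length_append_singleton nth_append)
    moreover have "ufin (\<lambda>_::unit. \<lambda>x. x 0 = length k)" by (rule ufin_base)
    ultimately have "rel \<tau> (\<lambda>x. if x 0 = length k then a else nth0 (zv \<tau>) k (x 0))
      (\<lambda>x. if x 0 = length k then a else nth0 (zv \<tau>) k (x 0))"
      unfolding el_def using rel_if by blast
    moreover have "(\<lambda>x :: baire. if x 0 = length k then a else nth0 (zv \<tau>) k (x 0)) =
      (\<lambda>x. nth0 (zv \<tau>) (k @ [a]) (x 0))" by (auto simp: nth0_def nth_append fun_eq_iff)
    ultimately show ?case by (simp only:)
  qed
  have "rel (Star \<tau>) (\<lambda>_. VList l) (\<lambda>_. VList m)"
  proof (rule rel_StarI)
    show "rel \<tau> (\<lambda>x. nth0 (zv \<tau>) l (x 0)) (\<lambda>x. nth0 (zv \<tau>) m (x 0))"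
    proof (rule rel_pointwise)
      show "rel \<tau> (\<lambda>x. nth0 (zv \<tau>) l (x 0)) (\<lambda>x. nth0 (zv \<tau>) l (x 0))"
        by (rule key) (use lm(4) el_sym el_trans in blast)
      show "rel \<tau> (\<lambda>x. nth0 (zv \<tau>) m (x 0)) (\<lambda>x. nth0 (zv \<tau>) m (x 0))"
        by (rule key) (use lm(3,4) el_sym el_trans in metis)
      show "el \<tau> (nth0 (zv \<tau>) l (x 0)) (nth0 (zv \<tau>) m (x 0))" for x :: baire
        using lm(3,4) rel_zv by (simp add: nth0_def el_def)
    qed
  qed (use lm(3) fr_const in simp_all)
  then show "el (Star \<tau>) a b" using lm by (simp add: el_def)
qed

text \<open>At function types \<open>EQ\<close> tests single arguments while \<open>el\<close>
  concerns families; \<open>rel_pointwise\<close> bridges the gap. Extensionality of the model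
  follows, as application respects \<open>el\<close>.\<close>

lemma EQ_el: "a \<in> VD \<tau> \<Longrightarrow> b \<in> VD \<tau> \<Longrightarrow> V0.EQ \<tau> a b \<longleftrightarrow> el \<tau> a b"
proof (induction \<tau> arbitrary: a b)
  case N
  then show ?case by (auto simp: VD_N el_N)
next
  case (Fn \<sigma> \<tau> a b)
  show ?case
  proof
    assume EQ: "V0.EQ (\<sigma> \<rightarrow> \<tau>) a b"
    show "el (\<sigma> \<rightarrow> \<tau>) a b"
      unfolding el_def
    proof (rule rel_FnI)
      fix \<rho> S S' assume S: "frm \<rho>" "rel \<sigma> S S'"
      have a: "rel (\<sigma> \<rightarrow> \<tau>) (\<lambda>_. a) (\<lambda>_. a)" and b: "rel (\<sigma> \<rightarrow> \<tau>) (\<lambda>_. b) (\<lambda>_. b)"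
        using Fn.prems by (simp_all add: VD_def el_def)
      obtain P P0 where P: "rel \<tau> P P0" "\<And>x. app a (S x) (P x)"
        using rel_FnE[OF a S] by metis
      obtain Q0 Q where Q: "rel \<tau> Q0 Q" "\<And>x. app b (S x) (Q0 x)" "\<And>x. app b (S' x) (Q x)"
        using rel_FnE[OF b S] by metis
      have "el \<tau> (P x) (Q x)" for x
      proof -
        have Sx: "S x \<in> VD \<sigma>" using rel_el[OF S(2)] el_VD by blast
        have "V0.EQ \<tau> (vap a (S x)) (vap b (S x))" using EQ Sx by simp
        then have "el \<tau> (vap a (S x)) (vap b (S x))"
          using Fn.IH(2)[OF VD_ap[OF Fn.prems(1) Sx] VD_ap[OF Fn.prems(2) Sx]] by blast
        then have "el \<tau> (P x) (Q0 x)" using vap_eq[OF P(2)] vap_eq[OF Q(2)] by simp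
        then show ?thesis using rel_el[OF Q(1)] el_trans by blast
      qed
      then have "rel \<tau> P Q" using rel_pointwise rel_left[OF P(1)] rel_right[OF Q(1)] by blast
      then show "\<exists>P P'. rel \<tau> P P' \<and> (\<forall>x. app a (S x) (P x) \<and> app b (S' x) (P' x))"
        using P(2) Q(3) by blast
    qed
  next
    assume "el (\<sigma> \<rightarrow> \<tau>) a b"
    then have "el \<tau> (vap a x) (vap b x)" if "x \<in> VD \<sigma>" for x
      using el_vap that unfolding VD_def by blast
    then show "V0.EQ (\<sigma> \<rightarrow> \<tau>) a b"
      using Fn.IH(2) VD_ap[OF Fn.prems(1)] VD_ap[OF Fn.prems(2)] by auto
  qed
next
  case (Star \<tau> a b)
  obtain l where l: "a = VList l" "\<And>i. i < length l \<Longrightarrow> l ! i \<in> VD \<tau>"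
    using Star.prems(1) unfolding VD_def VD_Star_iff by auto
  obtain m where m: "b = VList m" "\<And>i. i < length m \<Longrightarrow> m ! i \<in> VD \<tau>"
    using Star.prems(2) unfolding VD_def VD_Star_iff by auto
  have e: "vap (vap (vc (EntC \<tau>)) (VList k)) (VNum i) = (if i < length k then k ! i else zv \<tau>)" for k i
    by (simp add: vc.simps nth0_def)
  have ball: "(\<forall>i\<in>VD N. R i) \<longleftrightarrow> (\<forall>n. R (VNum n))" for R by (auto simp: VD_N)
  have "V0.EQ (Star \<tau>) a b \<longleftrightarrow> length l = length m \<and> (\<forall>n. n < length l \<longrightarrow> V0.EQ \<tau> (l ! n) (m ! n))"
    unfolding V0.EQ.simps V.ev_arith ball l(1) m(1) by (auto simp: vc.simps nth0_def)
  also have "\<dots> \<longleftrightarrow> el (Star \<tau>) a b"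
    unfolding VD_Star_iff l(1) m(1) using Star.IH l(2) m(2) by auto
  finally show ?case .
qed

lemma sat_eqF_el: "V0.ok \<rho> \<Longrightarrow> wt s \<Longrightarrow> wt t \<Longrightarrow> typ_of s = \<tau> \<Longrightarrow> typ_of t = \<tau> \<Longrightarrow>
    V0.sat \<rho> (eqF \<tau> s t) \<longleftrightarrow> el \<tau> (V0.ev \<rho> s) (V0.ev \<rho> t)"
  by (simp add: V0.sat_eqF EQ_el V0.ev_D')

lemma VMu_VD: "VMu \<in> VD T2"
  using rel_Mu by (simp add: VD_def el_def)

lemma VFun_VD [simp]: "VFun h \<in> VD T1"
proof -
  have "ufin (\<lambda>(v, n) x. h n = v)" using ufin_const[of "\<lambda>(v, n). h n = v"] by (simp add: case_prod_unfold)
  from rel_VFun[OF this] show ?thesis by (simp add: VD_def el_def)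
qed

lemma VD_T1: "a \<in> VD T1 \<Longrightarrow> \<exists>h. \<forall>n. app a (VNum n) (VNum (h n))"
proof -
  assume a: "a \<in> VD T1"
  have "\<exists>v. app a (VNum n) (VNum v)" for n
    using app_vap[OF a VNum_VD] VD_ap[OF a VNum_VD] by (metis VD_N)
  then show ?thesis by metis
qed

lemma VMu_spec: "f \<in> VD T1 \<Longrightarrow> n \<in> VD N \<Longrightarrow> vap f n = vc ZeroC \<Longrightarrow> vap f (vap VMu f) = vc ZeroC"
proof -
  assume f: "f \<in> VD T1" and n: "n \<in> VD N" "vap f n = vc ZeroC"
  obtain h where h: "\<And>n. app f (VNum n) (VNum (h n))" using VD_T1[OF f] by blast
  have v: "vap f (VNum k) = VNum (h k)" for k using vap_eq[OF h] .
  obtain k where "h k = 0" using n v by (auto simp: VD_N vc.simps)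
  then have "h (least0 h) = 0" using least0_iff[of h "least0 h"] by metis
  then show ?thesis using v vap_eq[OF appM[OF h]] by (simp add: vc.simps)
qed

section \<open>Validity of the axioms\<close>

lemma VD_iff: "a \<in> VD \<tau> \<longleftrightarrow> el \<tau> a a"
  by (simp add: VD_def)

lemma ev_zero_tm: "V0.ev \<rho> (zero_tm \<tau>) = zv \<tau>"
proof (induction \<tau>)
  case (Star \<tau>)
  have "app (VSeq1 0) (VK1 (zv \<tau>)) (VList [])" by (rule appQ) simp_all
  then show ?case using Star by (simp add: vc.simps vap_eq)
qed (simp_all add: vc.simps)

lemma vap_Seq:
  assumes "f \<in> VD (N \<rightarrow> \<tau>)"
  shows "vap (VSeq1 n) f = VList (map (\<lambda>i. vap f (VNum i)) [0..<n])"
  by (intro vap_eq appQ) (simp_all add: app_vap[OF assms VNum_VD])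

text \<open>The choice functional is the value of a term in \<open>VMu\<close> and the parameters of
  the formula, and so lies in the model.\<close>

lemma sat_QF_AC: "\<phi> \<in> QF_AC_1_0 \<Longrightarrow> V0.ok \<rho> \<Longrightarrow> V0.sat \<rho> \<phi>"
proof (induction rule: QF_AC_1_0.induct)
  case (1 \<phi> F x y)
  obtain m where "m \<notin> fst ` fv \<phi>" using ex_rsv[of "fst ` fv \<phi>"] finite_fv by blast
  then have m: "(m, T2) \<notin> fv \<phi>" by force
  let ?\<rho> = "upd \<rho> m T2 VMu"
  let ?t = "lam x T1 (Var m T2 \<cdot> lam y N (V.chr \<phi>))"
  let ?F = "V0.ev ?\<rho> ?t"
  have ok': "V0.ok ?\<rho>" using 1 VMu_VD by simp
  have w: "wt (V.chr \<phi>)" "typ_of (V.chr \<phi>) = N" using V.wt_chr[OF 1(1,2)] by blast+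
  have F_D: "?F \<in> VD T2" using ok' w by (intro V0.ev_D') simp_all
  have all: "V0.sat (upd (upd \<rho> x T1 a) y N (vap ?F a)) \<phi>"
    if a: "a \<in> VD T1" and ex: "\<exists>b\<in>VD N. V0.sat (upd (upd \<rho> x T1 a) y N b) \<phi>" for a
  proof -
    let ?g = "V0.ev (upd ?\<rho> x T1 a) (lam y N (V.chr \<phi>))"
    have oka: "V0.ok (upd ?\<rho> x T1 a)" using ok' a by simp
    have drop: "V0.sat (upd (upd ?\<rho> x T1 a) y N b) \<phi> = V0.sat (upd (upd \<rho> x T1 a) y N b) \<phi>" for b
      by (rule V0.sat_cong) (use m in \<open>auto simp: upd_apply'\<close>)
    have Fa: "vap ?F a = vap VMu ?g" if "(x, T1) \<noteq> (m, T2)"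
      using ok' w a that by simp
    have g_D: "?g \<in> VD T1" using oka w by (intro V0.ev_D') simp_all
    have g: "vap ?g b = (if V0.sat (upd (upd \<rho> x T1 a) y N b) \<phi> then vc ZeroC else vap (vc SucC) (vc ZeroC))"
      if "b \<in> VD N" for b
      using V.ev_lam[OF oka w(1) that, of y] V.ev_chr[OF 1(1,2), of "upd (upd ?\<rho> x T1 a) y N b"] oka that
      by (simp add: drop)
    obtain b where "b \<in> VD N" "vap ?g b = vc ZeroC" using ex g by auto
    then have "vap ?g (vap VMu ?g) = vc ZeroC" using VMu_spec g_D by blast
    moreover have "vap VMu ?g \<in> VD N" using VD_ap[OF VMu_VD g_D] .
    ultimately have "V0.sat (upd (upd \<rho> x T1 a) y N (vap VMu ?g)) \<phi>"
      using g[of "vap VMu ?g"] by (auto split: if_splits)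
    then show ?thesis using Fa by simp
  qed
  have "V0.sat (upd (upd \<rho> F T2 ?F) x T1 a) (subst y N (Var F T2 \<cdot> n1 x) \<phi>)"
    if a: "a \<in> VD T1" and ex: "\<exists>b\<in>VD N. V0.sat (upd (upd \<rho> x T1 a) y N b) \<phi>" for a
  proof -
    have "V0.sat (upd (upd \<rho> F T2 ?F) x T1 a) (subst y N (Var F T2 \<cdot> n1 x) \<phi>) =
      V0.sat (upd (upd (upd \<rho> F T2 ?F) x T1 a) y N (vap ?F a)) \<phi>"
      by (simp add: V0.sat_subst[OF V0.qf_free_for[OF 1(1)]])
    also have "\<dots> = V0.sat (upd (upd \<rho> x T1 a) y N (vap ?F a)) \<phi>"
      by (rule V0.sat_cong) (use 1(3) in \<open>auto simp: upd_apply'\<close>)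
    finally show ?thesis using all[OF that] by simp
  qed
  then have "\<exists>G\<in>VD T2. \<forall>a\<in>VD T1. V0.sat (upd (upd \<rho> F T2 G) x T1 a) (subst y N (Var F T2 \<cdot> n1 x) \<phi>)"
    if "\<forall>a\<in>VD T1. \<exists>b\<in>VD N. V0.sat (upd (upd \<rho> x T1 a) y N b) \<phi>"
    using F_D that by blast
  then show ?case by simp
qed

lemma sat_E_PRA: "\<phi> \<in> E_PRA_omega \<Longrightarrow> V0.ok \<rho> \<Longrightarrow> V0.sat \<rho> \<phi>"
proof (induction rule: E_PRA_omega.induct)
  case (comb_K \<sigma> \<tau>)
  have "V0.sat \<rho> (eqF \<sigma> (KC \<sigma> \<tau> \<cdot> Var ''x'' \<sigma> \<cdot> Var ''y'' \<tau>) (Var ''x'' \<sigma>)) \<longleftrightarrow>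
    el \<sigma> (\<rho> (''x'', \<sigma>)) (\<rho> (''x'', \<sigma>))"
    using comb_K by (subst sat_eqF_el) (simp_all add: vc.simps)
  then show ?case using V0.ok_D[OF comb_K, of "''x''" \<sigma>] by (simp add: VD_iff)
next
  case (comb_S \<tau> \<delta> \<sigma>)
  let ?l = "SC \<delta> \<sigma> \<tau> \<cdot> Var ''x'' (\<delta> \<rightarrow> \<sigma> \<rightarrow> \<tau>) \<cdot> Var ''y'' (\<delta> \<rightarrow> \<sigma>) \<cdot> Var ''z'' \<delta>"
  let ?r = "Var ''x'' (\<delta> \<rightarrow> \<sigma> \<rightarrow> \<tau>) \<cdot> Var ''z'' \<delta> \<cdot> (Var ''y'' (\<delta> \<rightarrow> \<sigma>) \<cdot> Var ''z'' \<delta>)"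
  have "V0.ev \<rho> ?l = V0.ev \<rho> ?r"
    using V.S_eq[of "\<rho> (''x'', \<delta> \<rightarrow> \<sigma> \<rightarrow> \<tau>)" \<delta> \<sigma> \<tau> "\<rho> (''y'', \<delta> \<rightarrow> \<sigma>)" "\<rho> (''z'', \<delta>)"] comb_S by simp
  moreover have "V0.ev \<rho> ?r \<in> VD \<tau>" by (rule V0.ev_D') (use comb_S in simp_all)
  ultimately show ?case using comb_S by (subst sat_eqF_el) (simp_all add: VD_iff)
next
  case (rec_suc)
  then show ?case using V.rec_suc[of "\<rho> (''x'', N)" "\<rho> (''y'', N)" "\<rho> (''z'', N \<rightarrow> N \<rightarrow> N)"] by simp
next
  case (ext \<sigma> \<tau>)
  show ?case
    using el_vap[of \<sigma> \<tau> "\<rho> (''z'', \<sigma> \<rightarrow> \<tau>)" "\<rho> (''z'', \<sigma> \<rightarrow> \<tau>)" "\<rho> (''x'', \<sigma>)" "\<rho> (''y'', \<sigma>)"]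
      V0.ok_D[OF ext, of "''z''" "\<sigma> \<rightarrow> \<tau>"] ext
    by (simp add: sat_eqF_el VD_iff del: eqF.simps)
next
  \<comment> \<open>The numbers of this model are the standard numerals, so outer induction
    applies.\<close>
  case (qf_induct \<phi> x)
  have ff: "free_for u x N \<phi>" for u using V0.qf_free_for[OF qf_induct(1)] .
  show ?case
  proof (simp add: V0.sat_subst[OF ff], intro impI ballI)
    fix a assume base: "V0.sat (upd \<rho> x N (vc ZeroC)) \<phi>"
      and step: "\<forall>a\<in>VD N. V0.sat (upd \<rho> x N a) \<phi> \<longrightarrow> V0.sat (upd \<rho> x N (vap (vc SucC) a)) \<phi>"
      and "a \<in> VD N"
    then obtain n where n: "a = VNum n" by (auto simp: VD_N)
    have "V0.sat (upd \<rho> x N (VNum n)) \<phi>"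
    proof (induction n)
      case 0
      then show ?case using base by (simp add: vc.simps)
    next
      case (Suc n)
      then show ?case using step[rule_format, of "VNum n"] by (simp add: vc.simps)
    qed
    then show "V0.sat (upd \<rho> x N a) \<phi>" using n by simp
  qed
next
  case (seq_len \<tau>)
  obtain n where n: "\<rho> (''n'', N) = VNum n" using V0.ok_D[OF seq_len, of "''n''" N] by (auto simp: VD_N)
  show ?case using vap_Seq[OF V0.ok_D[OF seq_len, of "''f''" "N \<rightarrow> \<tau>"], of n] n by (simp add: vc.simps)
next
  case (seq_ent \<tau>)
  obtain n where n: "\<rho> (''n'', N) = VNum n" using V0.ok_D[OF seq_ent, of "''n''" N] by (auto simp: VD_N)
  obtain i where i: "\<rho> (''i'', N) = VNum i" using V0.ok_D[OF seq_ent, of "''i''" N] by (auto simp: VD_N)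
  note f = V0.ok_D[OF seq_ent, of "''f''" "N \<rightarrow> \<tau>"]
  have "vap (\<rho> (''f'', N \<rightarrow> \<tau>)) (VNum i) \<in> VD \<tau>" using VD_ap[OF f VNum_VD] .
  then show ?case using seq_ent vap_Seq[OF f, of n] n i
    by (simp add: sat_eqF_el vc.simps nth0_def VD_iff del: eqF.simps)
next
  case (seq_ent_beyond \<tau>)
  obtain n where n: "\<rho> (''n'', N) = VNum n" using V0.ok_D[OF seq_ent_beyond, of "''n''" N] by (auto simp: VD_N)
  obtain i where i: "\<rho> (''i'', N) = VNum i" using V0.ok_D[OF seq_ent_beyond, of "''i''" N] by (auto simp: VD_N)
  note f = V0.ok_D[OF seq_ent_beyond, of "''f''" "N \<rightarrow> \<tau>"]
  have "el \<tau> (zv \<tau>) (zv \<tau>)" using rel_zv by (simp add: el_def)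
  then show ?case using seq_ent_beyond vap_Seq[OF f, of n] n i
    by (simp add: sat_eqF_el vc.simps nth0_def ev_zero_tm del: eqF.simps)
next
  case suc_nonzero
  then show ?case using V.suc_nonzero[of "\<rho> (''x'', N)"] by simp
next
  case suc_inj
  then show ?case using V.suc_inj[of "\<rho> (''x'', N)" "\<rho> (''y'', N)"] by simp
next
  case rec_zero
  then show ?case using V.rec_zero[of "\<rho> (''y'', N)" "\<rho> (''z'', N \<rightarrow> N \<rightarrow> N)"] by simp
qed simp_all

lemma sat_RCA0: "\<phi> \<in> RCA0_omega \<Longrightarrow> V0.ok \<rho> \<Longrightarrow> V0.sat \<rho> \<phi>"
  using sat_E_PRA sat_QF_AC by (auto simp: RCA0_omega_def)

lemma model_mu2: "V0.sat \<rho> mu2"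
  unfolding V.sat_mu2 using VMu_VD VMu_spec by blast

section \<open>Codes of finite sequences in the model\<close>

definition cde :: "nat list \<Rightarrow> nat" where
  "cde l = foldl (\<lambda>c k. Suc (prod_encode (c, k))) 0 l"

lemma cde_snoc [simp]: "cde (l @ [k]) = Suc (prod_encode (cde l, k))" and cde_Nil [simp]: "cde [] = 0"
  by (simp_all add: cde_def)

lemma cde_inj: "cde l = cde m \<Longrightarrow> l = m"
proof (induction l arbitrary: m rule: rev_induct)
  case Nil
  then show ?case by (cases m rule: rev_cases) auto
next
  case (snoc k l)
  then show ?case by (cases m rule: rev_cases) auto
qed

text \<open>All numbers are codes, so an infinite set of numbers gives infinitely many sequences, as
  \<open>koenig\<close> requires.\<close>

lemma cde_surj: "\<exists>l. cde l = n"
proof (induction n rule: less_induct)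
  case (less n)
  show ?case
  proof (cases n)
    case 0
    then show ?thesis using cde_Nil by blast
  next
    case (Suc k)
    obtain c j where cj: "prod_encode (c, j) = k" by (metis surj_pair prod_decode_inverse)
    then have "c < n" using Suc le_prod_encode_1[of c j] by simp
    then obtain l where "cde l = c" using less by blast
    then show ?thesis using cde_snoc[of l j] cj Suc by blast
  qed
qed

lemma code_num: "vap V.ccode (VList (map VNum l)) = VNum (cde l)"
proof -
  let ?w = "VList (map VNum l)"
  have w: "?w \<in> VD (Star N)" by (auto simp: VD_iff VD_Star_iff el_N)
  let ?g = "V0.ev (upd V0.dflt ''w'' (Star N) ?w) (lam ''y'' N (lam ''x'' N
       (SucC \<cdot> (pairC \<cdot> Var ''y'' N \<cdot> (EntC N \<cdot> Var ''w'' (Star N) \<cdot> Var ''x'' N)))))"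
  have g_D: "?g \<in> VD (N \<rightarrow> N \<rightarrow> N)" by (rule V0.ev_D') (use w in simp_all)
  have g: "vap (vap ?g (VNum c)) (VNum i) = VNum (Suc (prod_encode (c, l ! i)))" if "i < length l" for c i
    using w that by (simp add: vc.simps nth0_def)
  have rec: "i \<le> length l \<Longrightarrow> vap (vap (vap (vc RecC) (VNum i)) (VNum 0)) ?g = VNum (cde (take i l))" for i
  proof (induction i)
    case 0
    then show ?case by (simp add: vc.simps)
  next
    case (Suc i)
    have "vap (vap (vap (vc RecC) (VNum (Suc i))) (VNum 0)) ?g =
      vap (vap ?g (vap (vap (vap (vc RecC) (VNum i)) (VNum 0)) ?g)) (VNum i)"
      using V.rec_suc[of "VNum i" "VNum 0" ?g] g_D by (simp add: vc.simps(2))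
    then show ?case using Suc g[of i] by (simp add: take_Suc_conv_app_nth)
  qed
  have "vap V.ccode ?w = vap (vap (vap (vc RecC) (VNum (length l))) (VNum 0)) ?g"
    unfolding V.ccode_def codeC_def using w by (simp add: vc.simps(1,7))
  then show ?thesis using rec[of "length l"] by simp
qed

section \<open>Weak Koenig lemma\<close>

lemma VD_Star_N: "s \<in> VD (Star N) \<longleftrightarrow> (\<exists>l. s = VList (map VNum l))"
proof
  assume "s \<in> VD (Star N)"
  then obtain k where k: "s = VList k" "\<forall>i<length k. \<exists>n. k ! i = VNum n"
    unfolding VD_iff VD_Star_iff el_N by blast
  then obtain f where "\<forall>i<length k. k ! i = VNum (f i)" by metis
  then have "k = map VNum (map f [0..<length k])" by (intro nth_equalityI) auto
  then show "\<exists>l. s = VList (map VNum l)" using k(1) by blast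
qed (auto simp: VD_iff VD_Star_iff el_N)

text \<open>The usual argument, carried out outside the model: a node with infinitely many
  extensions in the tree has a successor of the same kind.\<close>

lemma koenig:
  fixes t :: "nat list \<Rightarrow> bool"
  assumes bin: "\<And>l i. t l \<Longrightarrow> i < length l \<Longrightarrow> l ! i \<le> 1"
    and take: "\<And>l n. t l \<Longrightarrow> n \<le> length l \<Longrightarrow> t (take n l)"
    and inf: "infinite {l. t l}"
  shows "\<exists>g. \<forall>n. t (map g [0..<n])"
proof -
  define ext where "ext l = {l'. t l' \<and> length l \<le> length l' \<and> take (length l) l' = l}" for l
  define big where "big l = infinite (ext l)" for l
  have big_t: "t l" if big: "big l" for l
  proof -
    obtain l' where "l' \<in> ext l" using big unfolding big_def by (metis finite.emptyI ex_in_conv)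
    then show ?thesis using take[of l' "length l"] by (auto simp: ext_def)
  qed
  have split: "big (l @ [0]) \<or> big (l @ [1])" if "big l" for l
  proof (rule ccontr)
    assume "\<not> ?thesis"
    then have fin: "finite (insert l (ext (l @ [0]) \<union> ext (l @ [1])))" by (simp add: big_def)
    have "ext l \<subseteq> insert l (ext (l @ [0]) \<union> ext (l @ [1]))"
    proof
      fix l' assume l': "l' \<in> ext l"
      show "l' \<in> insert l (ext (l @ [0]) \<union> ext (l @ [1]))"
      proof (cases "length l' = length l")
        case False
        then have lt: "length l < length l'" using l' by (auto simp: ext_def)
        then have "take (Suc (length l)) l' = l @ [l' ! length l]"
          using l' by (auto simp: ext_def take_Suc_conv_app_nth)
        moreover have "l' ! length l = 0 \<or> l' ! length l = 1"
          using bin[of l' "length l"] lt l' by (auto simp: ext_def)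
        ultimately show ?thesis using l' lt by (auto simp: ext_def)
      qed (use l' in \<open>auto simp: ext_def\<close>)
    qed
    then show False using fin that unfolding big_def by (metis finite_subset)
  qed
  define p where "p = rec_nat [] (\<lambda>_ l. l @ [if big (l @ [0]) then 0 else 1])"
  have p: "p 0 = []" "\<And>n. p (Suc n) = p n @ [if big (p n @ [0]) then 0 else 1]" by (simp_all add: p_def)
  have big_p: "big (p n)" for n
  proof (induction n)
    case 0
    then show ?case using inf by (simp add: p big_def ext_def)
  next
    case (Suc n)
    then show ?case using split[OF Suc] by (auto simp: p(2))
  qed
  have len: "length (p n) = n" for n by (induction n) (simp_all add: p)
  define g where "g i = p (Suc i) ! i" for i
  have "map g [0..<n] = p n" for n
  proof (induction n)
    case (Suc n)
    then show ?case using len[of n] by (simp add: p(2) g_def nth_append)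
  qed (simp add: p)
  then show ?thesis using big_t[OF big_p] by metis
qed

lemma VN_ball: "(\<forall>a\<in>VD N. P a) \<longleftrightarrow> (\<forall>n. P (VNum n))" and VN_bex: "(\<exists>a\<in>VD N. P a) \<longleftrightarrow> (\<exists>n. P (VNum n))"
  by (auto simp: VD_N)

text \<open>The path may be taken from \<open>koenig\<close> with no regard to its complexity, as
  \<open>VFun g\<close> lies in the model for every \<open>g\<close>.\<close>

lemma model_WKL: "V0.sat \<rho> WKL"
proof -
  have "\<exists>g\<in>VD T1. \<forall>n\<in>VD N. vap T (vap V.ccode (vap (vap (vc (SeqC N)) n) g)) = VNum 1"
    if T: "T \<in> VD T1" and bt: "V0.sat (upd \<rho> ''T'' T1 T) (binary_tree (n1 ''T''))"
      and inf: "V0.sat (upd \<rho> ''T'' T1 T) (infinite_set (n1 ''T''))" for T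
  proof -
    obtain h where h: "\<And>n. app T (VNum n) (VNum (h n))" using VD_T1[OF T] by blast
    then have v: "vap T (VNum n) = VNum (h n)" for n by (rule vap_eq)
    define t where "t l \<longleftrightarrow> h (cde l) = 1" for l
    have seq: "vap (vap (vc (SeqC N)) (VNum n)) f = VList (map (\<lambda>i. vap f (VNum i)) [0..<n])"
      if "f \<in> VD T1" for f n
      using vap_Seq[OF that] by (simp add: vc.simps)
    have 1: "\<forall>s\<in>VD (Star N). vap T (vap V.ccode s) = VNum 1 \<longrightarrow>
      (\<forall>i\<in>VD N. vap (vap V.cmon (vap (vc SucC) i)) (vap (vc (LenC N)) s) = VNum 0 \<longrightarrow>
         vap (vap V.cmon (vap (vap (vc (EntC N)) s) i)) (VNum 1) = VNum 0) \<and>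
      (\<forall>n\<in>VD N. vap (vap V.cmon n) (vap (vc (LenC N)) s) = VNum 0 \<longrightarrow>
         vap T (vap V.ccode (vap (vap (vc (SeqC N)) n) (vap (vc (EntC N)) s))) = VNum 1)"
      using bt by (simp add: binary_tree_def mem_def vc.simps(1,2))
    have tr: "(\<forall>i<length l. l ! i \<le> 1) \<and> (\<forall>n\<le>length l. t (take n l))" if "t l" for l
    proof -
      let ?s = "VList (map VNum l)"
      have s: "?s \<in> VD (Star N)" using VD_Star_N by blast
      have E: "vap (vc (EntC N)) ?s \<in> VD T1" using VD_ap[OF V0.csts_D(8) s] .
      have e: "vap (vap (vc (EntC N)) ?s) (VNum i) = VNum (l ! i)" if "i < length l" for i
        using that by (simp add: vc.simps nth0_def)
      have "vap T (vap V.ccode ?s) = VNum 1" using \<open>t l\<close> by (simp add: code_num v t_def)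
      then have 2: "\<forall>i\<in>VD N. vap (vap V.cmon (vap (vc SucC) i)) (vap (vc (LenC N)) ?s) = VNum 0 \<longrightarrow>
         vap (vap V.cmon (vap (vap (vc (EntC N)) ?s) i)) (VNum 1) = VNum 0"
        "\<forall>n\<in>VD N. vap (vap V.cmon n) (vap (vc (LenC N)) ?s) = VNum 0 \<longrightarrow>
         vap T (vap V.ccode (vap (vap (vc (SeqC N)) n) (vap (vc (EntC N)) ?s))) = VNum 1"
        using 1 s by blast+
      have "l ! i \<le> 1" if "i < length l" for i
        using 2(1)[rule_format, OF VNum_VD[of i]] that e[OF that] by (simp add: vc.simps(2,7))
      moreover have "t (take n l)" if "n \<le> length l" for n
      proof -
        have "vap (vap (vc (SeqC N)) (VNum n)) (vap (vc (EntC N)) ?s) = VList (map VNum (take n l))"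
          unfolding seq[OF E] using e that by (auto intro!: nth_equalityI)
        then show ?thesis
          using 2(2)[rule_format, OF VNum_VD[of n]] that by (simp add: vc.simps(7) code_num v t_def)
      qed
      ultimately show ?thesis by blast
    qed
    have "\<forall>m\<in>VD N. \<exists>n\<in>VD N. vap (vap V.cmon (vap (vc SucC) m)) n = VNum 0 \<and> vap T n = VNum 1"
      using inf by (simp add: infinite_set_def mem_def vc.simps(1,2))
    then have ex: "\<exists>n>m. h n = 1" for m
      unfolding VN_ball VN_bex by (simp add: vc.simps(2) v Suc_le_eq)
    have "infinite {n. h n = 1}"
    proof
      assume "finite {n. h n = 1}"
      then obtain m where "\<forall>n\<in>{n. h n = 1}. n < m" unfolding finite_nat_set_iff_bounded by blast
      with ex[of m] show False by auto
    qed
    moreover have "{n. h n = 1} = cde ` {l. t l}" using cde_surj by (auto simp: t_def image_iff) metis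
    ultimately have "infinite {l. t l}" by (metis finite_imageI)
    then obtain g where g: "\<forall>n. t (map g [0..<n])" using koenig[of t] tr by blast
    have "vap T (vap V.ccode (vap (vap (vc (SeqC N)) (VNum n)) (VFun g))) = VNum 1" for n
    proof -
      have "vap (vap (vc (SeqC N)) (VNum n)) (VFun g) = VList (map VNum (map g [0..<n]))"
        unfolding seq[OF VFun_VD] by simp
      then show ?thesis using g by (simp only: code_num v t_def)
    qed
    then have "\<forall>n\<in>VD N. vap T (vap V.ccode (vap (vap (vc (SeqC N)) n) (VFun g))) = VNum 1"
      unfolding VN_ball by blast
    then show ?thesis using VFun_VD by (rule bexI)
  qed
  then show ?thesis unfolding WKL_def by (simp add: mem_def vc.simps(1,2))
qed

section \<open>Failure of uniform arithmetical transfinite recursion\<close>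

text \<open>Positions 0, 1 and 2 of a code hold a coordinate, a value and the tag separating basic
  from compound predicates; subcodes start at 3.\<close>

definition sub :: "baire \<Rightarrow> nat \<Rightarrow> baire" where
  "sub e n = (\<lambda>i. e (3 + prod_encode (n, i)))"

text \<open>Universal predicates: by \<open>fin_U\<close> the predicates \<open>U k e\<close>
  exhaust rank \<open>k\<close>. At level 0 every code counts as basic.\<close>

primrec U :: "nat \<Rightarrow> baire \<Rightarrow> baire \<Rightarrow> bool" where
  "U 0 e x \<longleftrightarrow> x (e 0) = e 1"
| "U (Suc k) e x \<longleftrightarrow> (if e 2 = 0 then x (e 0) = e 1 else \<exists>n. \<not> U k (sub e n) x)"

lemma fin_U: "fin k P \<Longrightarrow> \<exists>e. \<forall>x. P x = U k e x"
proof (induction rule: fin.induct)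
  case (base k i j)
  show ?case
    by (cases k) (auto intro!: exI[of _ "\<lambda>n. if n = 0 then i else if n = 1 then j else 0"])
next
  case (nand k P)
  then obtain e where e: "\<And>n x. P n x = U k (e n) x" by metis
  let ?e = "\<lambda>i. if i < 3 then 1 else e (fst (prod_decode (i - 3))) (snd (prod_decode (i - 3)))"
  have "sub ?e n = e n" for n by (simp add: sub_def)
  then show ?case using e by (intro exI[of _ ?e]) simp
qed

text \<open>Subcodes arise by reindexing, so a position of the subcode at address \<open>p\<close>
  is a position of the whole code, and reading it is a basic predicate.\<close>

definition ix :: "nat list \<Rightarrow> nat \<Rightarrow> nat" where
  "ix p i = foldr (\<lambda>n i. 3 + prod_encode (n, i)) p i"

definition es :: "baire \<Rightarrow> nat list \<Rightarrow> baire" where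
  "es e p = foldl sub e p"

lemma es_ix: "es e p i = e (ix p i)"
  unfolding es_def ix_def by (induction p arbitrary: e) (simp_all add: sub_def)

lemma es_snoc: "es e (p @ [n]) = sub (es e p) n"
  by (simp add: es_def)

text \<open>\<open>qn k p\<close> is the place of the statement \<open>U k (es e p) x\<close> in column \<open>k\<close> of the hierarchy.\<close>

definition qn :: "nat \<Rightarrow> nat list \<Rightarrow> nat" where
  "qn k p = prod_encode (prod_encode (k, list_encode p), k)"

text \<open>The parameter \<open>x\<close> plays three roles: it is the point, its tail is the code,
  and its head will be the level in the diagonal argument.\<close>

definition Bx :: "baire \<Rightarrow> nat list \<Rightarrow> bool" where
  "Bx x p \<longleftrightarrow> x (es (tl' x) p 0) = es (tl' x) p 1"

text \<open>The kernel of the recursion step: a compound statement is read off from an initial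
  segment \<open>z\<close> of the earlier columns. Places beyond the segment count for nothing; as
  \<open>theta_of\<close> quantifies over lengths, some segment is long enough.\<close>

definition Cx :: "baire \<Rightarrow> nat \<Rightarrow> nat list \<Rightarrow> nat list \<Rightarrow> bool" where
  "Cx x k p z \<longleftrightarrow> (if k = 0 \<or> es (tl' x) p 2 = 0 then Bx x p
     else \<exists>n. qn (k - 1) (p @ [n]) < length z \<and> z ! qn (k - 1) (p @ [n]) \<noteq> 1)"

definition Fx :: "baire \<Rightarrow> nat \<Rightarrow> nat" where
  "Fx x u = (let n = fst (prod_decode u); c = snd (prod_decode (snd (prod_decode u))) in
     if Cx x (fst (prod_decode n)) (list_decode (snd (prod_decode n))) (SOME l. cde l = c) then 0 else 1)"

lemma Fx: "Fx x (prod_encode (prod_encode (k, list_encode p), prod_encode (m, cde l))) = 0 \<longleftrightarrow> Cx x k p l"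
proof -
  have "(SOME l'. cde l' = cde l) = l" using cde_inj by blast
  then show ?thesis by (simp add: Fx_def)
qed

text \<open>Basic predicates compare a fixed coordinate with a fixed value, so the coordinate and
  the value stored in the code are first named by \<open>m\<close> and \<open>n\<close>.\<close>

lemma ufin_Bx: "ufin (\<lambda>i x. Bx x (p i))"
proof -
  have "ufin (\<lambda>q x. x (Suc (ix (p (fst (fst q))) 0)) = snd (fst q) \<and> x (Suc (ix (p (fst (fst q))) 1)) = snd q \<and>
      x (snd (fst q)) = snd q)"
    by (intro ufin_conj ufin_base)
  then have "ufin (\<lambda>(i, n) x. x (Suc (ix (p (fst i)) 0)) = snd i \<and> x (Suc (ix (p (fst i)) 1)) = n \<and> x (snd i) = n)"
    by (simp only: case_prod_unfold)
  then have "ufin (\<lambda>i x. \<exists>n. x (Suc (ix (p (fst i)) 0)) = snd i \<and> x (Suc (ix (p (fst i)) 1)) = n \<and> x (snd i) = n)"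
    by (rule ufin_ex)
  then have "ufin (\<lambda>(i, m) x. \<exists>n. x (Suc (ix (p i) 0)) = m \<and> x (Suc (ix (p i) 1)) = n \<and> x m = n)"
    by (simp only: case_prod_unfold)
  then have "ufin (\<lambda>i x. \<exists>m n. x (Suc (ix (p i) 0)) = m \<and> x (Suc (ix (p i) 1)) = n \<and> x m = n)"
    by (rule ufin_ex)
  then show ?thesis by (simp add: Bx_def es_ix tl'_def eq_commute)
qed

text \<open>The rank is independent of the level: deeper statements are looked up in the list, which
  is part of the index, and not evaluated.\<close>

lemma ufin_Cx: "ufin (\<lambda>i x. Cx x (k i) (p i) (z i))"
proof -
  have "ufin (\<lambda>i x. x (Suc (ix (p i) 2)) = 0)" by (rule ufin_base)
  then have "ufin (\<lambda>i x. (k i = 0 \<or> x (Suc (ix (p i) 2)) = 0) \<and> Bx x (p i) \<or>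
      \<not> (k i = 0 \<or> x (Suc (ix (p i) 2)) = 0) \<and>
      (\<exists>n. qn (k i - 1) (p i @ [n]) < length (z i) \<and> z i ! qn (k i - 1) (p i @ [n]) \<noteq> 1))"
    by (intro ufin_disj ufin_conj ufin_not ufin_const ufin_Bx)
  moreover have "Cx x k p z \<longleftrightarrow> (k = 0 \<or> x (Suc (ix p 2)) = 0) \<and> Bx x p \<or>
      \<not> (k = 0 \<or> x (Suc (ix p 2)) = 0) \<and>
      (\<exists>n. qn (k - 1) (p @ [n]) < length z \<and> z ! qn (k - 1) (p @ [n]) \<noteq> 1)" for x k p z
    unfolding Cx_def es_ix tl'_def by simp
  ultimately show ?thesis by (simp only:)
qed

lemma ufin_Fx: "ufin (\<lambda>(v, u) x. Fx x u = v)"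
proof -
  define C where "C x u = Cx x (fst (prod_decode (fst (prod_decode u))))
    (list_decode (snd (prod_decode (fst (prod_decode u)))))
    (SOME l. cde l = snd (prod_decode (snd (prod_decode u))))" for x u
  have "ufin (\<lambda>q x. C x (snd q))" unfolding C_def by (rule ufin_Cx)
  then have "ufin (\<lambda>q x. C x (snd q) \<and> fst q = (0::nat) \<or> \<not> C x (snd q) \<and> fst q = 1)"
    by (intro ufin_disj ufin_conj ufin_not ufin_const)
  moreover have "(C x u \<and> v = 0 \<or> \<not> C x u \<and> v = 1) = (Fx x u = v)" for x u v
    unfolding Fx_def C_def Let_def by auto
  ultimately show ?thesis by (simp only: case_prod_unfold)
qed

section \<open>Diagonalisation along omega\<close>

definition X0 :: val where
  "X0 = VFun (\<lambda>u. if fst (prod_decode u) \<le> snd (prod_decode u) then 1 else 0)"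

lemma X0_VD: "X0 \<in> VD T1" by (simp add: X0_def)

lemma X0 [simp]: "vap X0 (VNum (prod_encode (i, j))) = VNum (if i \<le> j then 1 else 0)"
  by (simp add: X0_def)

lemma X0_WO: "V.WOs X0"
proof -
  have "V.LOs X0"
    unfolding V.LOs_def VN_ball pr_num X0 vc.simps(1,2) vap_simps(1) by (auto simp: X0_def)
  moreover have False
    if h: "h \<in> VD T1" and d: "\<forall>n\<in>VD N. vap X0 (vap (vap V.cpair (vap h (vap (vc SucC) n))) (vap h n)) = VNum 1 \<and>
      vap X0 (vap (vap V.cpair (vap h n)) (vap h (vap (vc SucC) n))) \<noteq> VNum 1" for h
  proof -
    obtain f where f: "\<And>n. app h (VNum n) (VNum (f n))" using VD_T1[OF h] by blast
    then have v: "vap h (VNum n) = VNum (f n)" for n by (rule vap_eq)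
    have dec: "f (Suc n) < f n" for n
      using d[rule_format, OF VNum_VD[of n]] by (simp add: vc.simps(2) v split: if_splits)
    have "f n + n \<le> f 0" for n
    proof (induction n)
      case (Suc n)
      then show ?case using dec[of n] by simp
    qed simp
    from this[of "Suc (f 0)"] show False by simp
  qed
  ultimately show ?thesis unfolding V.WOs_def by (auto simp: vc.simps(1,2))
qed

lemma not_UATR: "\<not> V0.sat \<rho> UATR"
proof
  assume "V0.sat \<rho> UATR"
  then obtain \<Phi> where \<Phi>: "\<Phi> \<in> VD (T1 \<rightarrow> T1 \<rightarrow> T1)"
    and H: "\<And>f. f \<in> VD T1 \<Longrightarrow> V.Hs f X0 (vap (vap \<Phi> X0) f)"
    unfolding V.sat_UATR using X0_VD X0_WO by blast
  have "vap \<Phi> X0 \<in> VD (T1 \<rightarrow> T1)" using VD_ap[OF \<Phi> X0_VD] .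
  then have r: "rel (T1 \<rightarrow> T1) (\<lambda>_. vap \<Phi> X0) (\<lambda>_. vap \<Phi> X0)" by (simp add: VD_iff el_def)
  \<comment> \<open>The functional is applied to the whole family of the \<open>Fx x\<close> at
    once; this is where one finite rank for all the hierarchies comes from.\<close>
  obtain P P' where P: "rel T1 P P'" "\<And>x. app (vap \<Phi> X0) (VFun (Fx x)) (P x)"
    using rel_FnE[OF r frm_id rel_VFun[OF ufin_Fx]] by metis
  obtain y where y: "ufin (\<lambda>(v, n) x. y x n = v)" "\<And>x n. app (P x) (VNum n) (VNum (y x n))"
    using uniform1[OF P(1)] by metis
  have vy: "vap (P x) (VNum n) = VNum (y x n)" for x n using vap_eq[OF y(2)] .
  have P_D: "P x \<in> VD T1" for x using rel_el[OF P(1)] el_VD by blast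
  \<comment> \<open>Column \<open>k\<close> decides all statements of level \<open>k\<close>; the
    induction is on the level, with the address arbitrary.\<close>
  have key: "y x (qn k p) = 1 \<longleftrightarrow> U k (es (tl' x) p) x" for x k p
  proof (induction k arbitrary: p rule: less_induct)
    case (less k)
    have "V.Hs (VFun (Fx x)) X0 (P x)" using H[OF VFun_VD] vap_eq[OF P(2)] by metis
    then have "\<forall>k\<in>VD N. vap (P x) k = VNum 1 \<longleftrightarrow> (\<exists>n\<in>VD N. \<exists>j\<in>VD N. k = vap (vap V.cpair n) j \<and>
       vap X0 (vap (vap V.cpair j) j) = VNum 1 \<and>
       (\<exists>W\<in>VD T1. V.restrs X0 (P x) j W \<and> V.thetas (VFun (Fx x)) n W))"
      unfolding V.Hs_def by (simp add: vc.simps(1,2))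
    then have yk: "y x u = 1 \<longleftrightarrow> (\<exists>n j. u = prod_encode (n, j) \<and>
       (\<exists>W\<in>VD T1. V.restrs X0 (P x) (VNum j) W \<and> V.thetas (VFun (Fx x)) (VNum n) W))" for u
      unfolding VN_ball VN_bex pr_num X0 vy by simp
    have restr: "V.restrs X0 (P x) (VNum j) W \<longleftrightarrow>
      (\<forall>l. w l \<le> 1) \<and> (\<forall>l. w l = 1 \<longleftrightarrow> (\<exists>m i. l = prod_encode (m, i) \<and> y x l = 1 \<and> i < j))"
      if w: "\<And>n. vap W (VNum n) = VNum (w n)" for W w j
      unfolding V.restrs_def VN_ball VN_bex pr_num X0 vy w vc.simps(1,2) vap_simps(1) mn_num
      by (rule arg_cong2[where f=conj], simp, rule iff_allI, rule arg_cong2[where f="(=)"], simp, rule iff_exI, rule iff_exI, auto)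
    have theta: "V.thetas (VFun (Fx x)) (VNum (prod_encode (k, list_encode p))) W \<longleftrightarrow>
      (\<exists>m. Cx x k p (map w [0..<m]))"
      if W: "W \<in> VD T1" and w: "\<And>n. vap W (VNum n) = VNum (w n)" for W w
    proof -
      have "vap (vap (vc (SeqC N)) (VNum m)) W = VList (map VNum (map w [0..<m]))" for m
        using vap_Seq[OF W, of m] w by (simp add: vc.simps(6))
      then show ?thesis
        unfolding V.thetas_def VN_bex by (simp only: code_num pr_num vap_simps vc.simps(1) val.inject Fx)
    qed
    \<comment> \<open>The actual restriction, which shows that the quantifier over \<open>W\<close>
      is not void.\<close>
    define w0 where "w0 l = (if snd (prod_decode l) < k \<and> y x l = 1 then 1 else 0 :: nat)" for l
    have w0: "V.restrs X0 (P x) (VNum k) (VFun w0)"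
    proof (subst restr[of _ w0])
      have "w0 l = 1 \<longleftrightarrow> (\<exists>m i. l = prod_encode (m, i) \<and> y x l = 1 \<and> i < k)" for l
        unfolding w0_def by (metis fst_conv prod.collapse prod_decode_inverse prod_encode_inverse snd_conv zero_neq_one)
      then show "(\<forall>l. w0 l \<le> 1) \<and> (\<forall>l. w0 l = 1 \<longleftrightarrow> (\<exists>m i. l = prod_encode (m, i) \<and> y x l = 1 \<and> i < k))"
        by (simp add: w0_def)
    qed simp
    have "y x (qn k p) = 1 \<longleftrightarrow> (\<exists>W\<in>VD T1. V.restrs X0 (P x) (VNum k) W \<and>
        V.thetas (VFun (Fx x)) (VNum (prod_encode (k, list_encode p))) W)"
      unfolding yk qn_def by simp
    also have "\<dots> \<longleftrightarrow> U k (es (tl' x) p) x"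
    proof -
      have "V.thetas (VFun (Fx x)) (VNum (prod_encode (k, list_encode p))) W \<longleftrightarrow> U k (es (tl' x) p) x"
        if W: "W \<in> VD T1" and R: "V.restrs X0 (P x) (VNum k) W" for W
      proof -
        obtain w where "\<And>n. app W (VNum n) (VNum (w n))" using VD_T1[OF W] by blast
        then have w: "vap W (VNum n) = VNum (w n)" for n by (rule vap_eq)
        show ?thesis
        proof (cases "k = 0 \<or> es (tl' x) p 2 = 0")
          case True
          then show ?thesis unfolding theta[OF W w] Cx_def Bx_def by (cases k) auto
        next
          case False
          then obtain k' where k: "k = Suc k'" by (cases k) auto
          \<comment> \<open>Statements of level \<open>k'\<close> sit in column \<open>k'\<close>,
            which is below \<open>k\<close>, so the restriction retains them.\<close>
          have wq: "w (qn k' (p @ [n])) = 1 \<longleftrightarrow> U k' (sub (es (tl' x) p) n) x" for n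
          proof -
            have "w (qn k' (p @ [n])) = 1 \<longleftrightarrow> y x (qn k' (p @ [n])) = 1"
              using R[unfolded restr[of W w, OF w]] k by (auto simp: qn_def)
            then show ?thesis using less.IH[of k' "p @ [n]"] k by (simp add: es_snoc)
          qed
          have "(\<exists>m. Cx x k p (map w [0..<m])) \<longleftrightarrow> (\<exists>m n. qn k' (p @ [n]) < m \<and> w (qn k' (p @ [n])) \<noteq> 1)"
            unfolding Cx_def using False k by (auto cong: conj_cong)
          also have "\<dots> \<longleftrightarrow> (\<exists>n. w (qn k' (p @ [n])) \<noteq> 1)" by blast
          finally show ?thesis unfolding theta[OF W w] using False wq k by simp
        qed
      qed
      then show ?thesis using w0 VFun_VD by blast
    qed
    finally show ?case .
  qed
  \<comment> \<open>The level is read from coordinate 0: the diagonal predicate ranges over all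
    levels and still has one finite rank.\<close>
  have "ufin (\<lambda>q x. x 0 = snd q \<and> y x (qn (snd q) []) = 1)"
    using ufin_reindex[OF y(1), of "\<lambda>q. (1, qn (snd q) [])"] by (intro ufin_conj ufin_base) simp
  then have "ufin (\<lambda>(u::unit, k) x. x 0 = k \<and> y x (qn k []) = 1)" by (simp only: case_prod_unfold)
  then have "ufin (\<lambda>_::unit. \<lambda>x. \<exists>k. x 0 = k \<and> y x (qn k []) = 1)" by (rule ufin_ex)
  then have "ufin (\<lambda>_::unit. \<lambda>x. \<not> (\<exists>k. x 0 = k \<and> y x (qn k []) = 1))" by (rule ufin_not)
  then obtain K where "fin K (\<lambda>x. \<not> (\<exists>k. x 0 = k \<and> y x (qn k []) = 1))" unfolding ufin_def by blast
  moreover have "(\<exists>k. x 0 = k \<and> y x (qn k []) = 1) = U (x 0) (tl' x) x" for x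
    using key[of x "x 0" "[]"] unfolding es_def by (simp del: One_nat_def)
  ultimately have "fin K (\<lambda>x. \<not> U (x 0) (tl' x) x)" by (simp only:)
  then obtain e where e: "\<And>x. (\<not> U (x 0) (tl' x) x) = U K e x" using fin_U by blast
  \<comment> \<open>With the rank \<open>K\<close> as head and the code \<open>e\<close> as tail,
    both sides are the same statement, one of them negated.\<close>
  show False using e[of "case_nat K e"] by simp
qed

theorem corollary6p12:
  shows "(RCA0_omega \<union> {ex_SFF} \<^bold>\<turnstile> mu2 \<^bold>\<longleftrightarrow> UATR) \<and>
         \<not> (RCA0_omega \<union> {WKL} \<^bold>\<turnstile> mu2 \<^bold>\<longleftrightarrow> UATR)"
proof
  show "RCA0_omega \<union> {ex_SFF} \<^bold>\<turnstile> mu2 \<^bold>\<longleftrightarrow> UATR" by (rule equivalence_provable)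
  show "\<not> (RCA0_omega \<union> {WKL} \<^bold>\<turnstile> mu2 \<^bold>\<longleftrightarrow> UATR)"
  proof
    assume "RCA0_omega \<union> {WKL} \<^bold>\<turnstile> mu2 \<^bold>\<longleftrightarrow> UATR"
    then have "V0.sat V0.dflt (mu2 \<^bold>\<longleftrightarrow> UATR)"
      by (rule V0.sound) (use sat_RCA0 model_WKL V0.ok_dflt in auto)
    then show False using model_mu2 not_UATR by (simp add: V0.sat_connectives)
  qed
qed

end
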